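(* Let $S_1$ and $S_\hbar$ ($\hbar\in\mathbb{R}\setminus\{0\}$) be the position and momentum operators on $L^2(\mathbb{R})$, and let $D_0\subset L^2(\mathbb{R})$ be their common dense domain. Then $$\liminf_{|\hbar|\to0}\ \inf_{h_i=h_i^*}\left\{\|(S_1-h_1)|_{D_0}\|+\|(S_\hbar-h_2)|_{D_0}\|:\ h_1h_2=h_2h_1\right\}\ \ge\ \frac1{32},$$ where the infimum is over all pairs of (possibly unbounded) self-adjoint operators $h_1,h_2$ on $L^2(\mathbb{R})$ with $h_1h_2=h_2h_1$. Thus, one cannot approximate the pair $(S_1,S_\hbar)$ arbitrarily well by a commuting pair $(h_1,h_2)$ as $\hbar\to0$.
   Context: On $H=L^2(\mathbb{R})$ (Lebesgue measure) let $D_0$ be the dense subspace of infinitely differentiable $f\in L^2(\mathbb{R})$ with all derivatives $f^{(m)}\in L^2(\mathbb{R})$ and $t^mf(t),\,t^mf'(t)\in L^2(\mathbb{R})\cap C_0(\mathbb{R})$ for all $m\in\mathbb{N}$. The position operator is $(S_1f)(t)=tf(t)$ and the momentum operator is $(S_\hbar f)(t)=-i\hbar f'(t)$ for $f\in D_0$; both are symmetric on $D_0$ and each has a unique self-adjoint extension (its closure). For an operator $A$ defined on $D_0$, $\|A|_{D_0}\|\in[0,\infty]$ denotes the supremum of $\|Af\|$ over $f\in D_0$ with $\|f\|=1$; the operators $h_1,h_2$ in the infimum are those for which the expressions $(S_1-h_1)|_{D_0}$ and $(S_\hbar-h_2)|_{D_0}$ make sense, i.e. their domains contain $D_0$. 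*)

theory Defs
  imports "HOL-Analysis.Analysis"
begin

section \<open>The Hilbert space of square-integrable functions on the line\<close>

definition square_integrable :: "(real \<Rightarrow> complex) \<Rightarrow> bool" where
  "square_integrable f \<longleftrightarrow>
     f \<in> borel_measurable lborel \<and> integrable lborel (\<lambda>t. (cmod (f t))\<^sup>2)"

definition L2_eq :: "(real \<Rightarrow> complex) \<Rightarrow> (real \<Rightarrow> complex) \<Rightarrow> bool" where
  "L2_eq f g \<longleftrightarrow> square_integrable f \<and> square_integrable g \<and> (AE t in lborel. f t = g t)"

lemma square_integrable_measurable [measurable_dest]:
  "square_integrable f \<Longrightarrow> f \<in> borel_measurable lborel"
  by (simp add: square_integrable_def)

lemma square_integrable_zero: "square_integrable (\<lambda>_. 0)"
  by (simp add: square_integrable_def)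

lemma square_integrable_add:
  assumes "square_integrable f" "square_integrable g"
  shows "square_integrable (\<lambda>t. f t + g t)"
proof -
  have [measurable]: "f \<in> borel_measurable lborel" "g \<in> borel_measurable lborel"
    using assms by (auto simp: square_integrable_def)
  have "integrable lborel (\<lambda>t. (cmod (f t + g t))\<^sup>2)"
  proof (rule Bochner_Integration.integrable_bound)
    show "integrable lborel (\<lambda>t. 2 * (cmod (f t))\<^sup>2 + 2 * (cmod (g t))\<^sup>2)"
      using assms by (auto simp: square_integrable_def)
    have "(cmod (a + b))\<^sup>2 \<le> 2 * (cmod a)\<^sup>2 + 2 * (cmod b)\<^sup>2" for a b
    proof -
      have "(cmod (a + b))\<^sup>2 \<le> (cmod a + cmod b)\<^sup>2"
        by (intro power_mono norm_triangle_ineq) auto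
      also have "\<dots> \<le> 2 * (cmod a)\<^sup>2 + 2 * (cmod b)\<^sup>2"
        using sum_squares_bound[of "cmod a" "cmod b"] by (simp add: power2_sum)
      finally show ?thesis .
    qed
    then show "AE t in lborel. norm ((cmod (f t + g t))\<^sup>2)
        \<le> norm (2 * (cmod (f t))\<^sup>2 + 2 * (cmod (g t))\<^sup>2)"
      by simp
  qed simp
  then show ?thesis
    by (simp add: square_integrable_def)
qed

lemma square_integrable_mult:
  assumes "square_integrable f"
  shows "square_integrable (\<lambda>t. c * f t)"
  using assms by (auto simp: square_integrable_def norm_mult power_mult_distrib)

lemma square_integrable_scaleR:
  assumes "square_integrable f"
  shows "square_integrable (\<lambda>t. c *\<^sub>R f t)"
  using square_integrable_mult[OF assms, of "of_real c"] by (simp add: scaleR_conv_of_real)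

lemma square_integrable_minus:
  assumes "square_integrable f"
  shows "square_integrable (\<lambda>t. - f t)"
  using square_integrable_mult[OF assms, of "-1"] by simp

lemma square_integrable_diff:
  assumes "square_integrable f" "square_integrable g"
  shows "square_integrable (\<lambda>t. f t - g t)"
  using square_integrable_add[OF assms(1) square_integrable_minus[OF assms(2)]] by simp

lemma square_integrable_inner:
  assumes "square_integrable f" "square_integrable g"
  shows "integrable lborel (\<lambda>t. cnj (f t) * g t)"
proof (rule Bochner_Integration.integrable_bound)
  have [measurable]: "f \<in> borel_measurable lborel" "g \<in> borel_measurable lborel"
    using assms by (auto simp: square_integrable_def)
  show "integrable lborel (\<lambda>t. (cmod (f t))\<^sup>2 + (cmod (g t))\<^sup>2)"
    using assms by (auto simp: square_integrable_def)
  show "(\<lambda>t. cnj (f t) * g t) \<in> borel_measurable lborel"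
    by (intro borel_measurable_times borel_measurable_continuous_on[of cnj]
          continuous_intros) auto
  have "cmod (cnj a * b) \<le> (cmod a)\<^sup>2 + (cmod b)\<^sup>2" for a b
  proof -
    have "cmod (cnj a * b) \<le> 2 * cmod a * cmod b"
      by (simp add: norm_mult)
    then show ?thesis
      using sum_squares_bound[of "cmod a" "cmod b"] by linarith
  qed
  then show "AE t in lborel. norm (cnj (f t) * g t) \<le> norm ((cmod (f t))\<^sup>2 + (cmod (g t))\<^sup>2)"
    by simp
qed

quotient_type L2 = "real \<Rightarrow> complex" / partial: L2_eq
  morphisms rep_L2 abs_L2
proof (rule part_equivpI)
  show "\<exists>f. L2_eq f f"
    using square_integrable_zero by (auto simp: L2_eq_def)
  show "symp L2_eq"
    by (auto simp: symp_def L2_eq_def elim: eventually_mono)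
  show "transp L2_eq"
    unfolding transp_def L2_eq_def by (auto elim!: eventually_elim2)
qed

lift_definition scaleC :: "complex \<Rightarrow> L2 \<Rightarrow> L2"  (infixr "*\<^sub>C" 75)
  is "\<lambda>c f t. c * f t"
  by (auto simp: L2_eq_def square_integrable_mult elim: eventually_mono)

lift_definition cinner :: "L2 \<Rightarrow> L2 \<Rightarrow> complex"
  is "\<lambda>f g. \<integral>t. cnj (f t) * g t \<partial>lborel"
proof -
  fix f f' g g' :: "real \<Rightarrow> complex"
  assume *: "L2_eq f f'" "L2_eq g g'"
  have "AE t in lborel. cnj (f t) * g t = cnj (f' t) * g' t"
    using * unfolding L2_eq_def by (auto elim: eventually_elim2)
  then show "(\<integral>t. cnj (f t) * g t \<partial>lborel) = (\<integral>t. cnj (f' t) * g' t \<partial>lborel)"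
    using * unfolding L2_eq_def
    by (intro integral_cong_AE borel_measurable_integrable square_integrable_inner) auto
qed

instantiation L2 :: real_inner
begin

lift_definition zero_L2 :: L2 is "\<lambda>_. 0"
  by (auto simp: L2_eq_def square_integrable_zero)

lift_definition plus_L2 :: "L2 \<Rightarrow> L2 \<Rightarrow> L2" is "\<lambda>f g t. f t + g t"
  by (auto simp: L2_eq_def square_integrable_add elim: eventually_elim2)

lift_definition minus_L2 :: "L2 \<Rightarrow> L2 \<Rightarrow> L2" is "\<lambda>f g t. f t - g t"
  by (auto simp: L2_eq_def square_integrable_diff elim: eventually_elim2)

lift_definition uminus_L2 :: "L2 \<Rightarrow> L2" is "\<lambda>f t. - f t"
  by (auto simp: L2_eq_def square_integrable_minus elim: eventually_mono)

lift_definition scaleR_L2 :: "real \<Rightarrow> L2 \<Rightarrow> L2" is "\<lambda>c f t. c *\<^sub>R f t"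
  by (auto simp: L2_eq_def square_integrable_scaleR elim: eventually_mono)

lift_definition norm_L2 :: "L2 \<Rightarrow> real" is "\<lambda>f. sqrt (\<integral>t. (cmod (f t))\<^sup>2 \<partial>lborel)"
  unfolding L2_eq_def square_integrable_def
  by (intro arg_cong[of _ _ sqrt] integral_cong_AE) (auto elim: eventually_mono)

definition inner_L2 :: "L2 \<Rightarrow> L2 \<Rightarrow> real" where
  "inner_L2 x y = Re (cinner x y)"

definition sgn_L2 :: "L2 \<Rightarrow> L2" where "sgn_L2 x = inverse (norm x) *\<^sub>R x"

definition dist_L2 :: "L2 \<Rightarrow> L2 \<Rightarrow> real" where "dist_L2 x y = norm (x - y)"

definition uniformity_L2 :: "(L2 \<times> L2) filter" where
  "uniformity_L2 = (INF e\<in>{0<..}. principal {(x, y). dist x y < e})"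

definition open_L2 :: "L2 set \<Rightarrow> bool" where
  "open_L2 U = (\<forall>x\<in>U. eventually (\<lambda>(x', y). x' = x \<longrightarrow> y \<in> U) uniformity)"

instance
proof
  fix x y z :: L2 and a b c :: real
  note [simp] = L2_eq_def
  note [intro!] = square_integrable_add square_integrable_diff square_integrable_minus
    square_integrable_scaleR square_integrable_zero
  show "x + y + z = x + (y + z)"
    by transfer (auto simp: add.assoc)
  show "x + y = y + x"
    by transfer (auto simp: add.commute)
  show "0 + x = x"
    by transfer auto
  show "- x + x = 0"
    by transfer auto
  show "x - y = x + - y"
    by transfer auto
  show "a *\<^sub>R (x + y) = a *\<^sub>R x + a *\<^sub>R y"
    by transfer (auto simp: scaleR_right_distrib)
  show "(a + b) *\<^sub>R x = a *\<^sub>R x + b *\<^sub>R x"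
    by transfer (auto simp: scaleR_left_distrib)
  show "a *\<^sub>R b *\<^sub>R x = (a * b) *\<^sub>R x"
    by transfer auto
  show "1 *\<^sub>R x = x"
    by transfer auto
  show "sgn x = inverse (norm x) *\<^sub>R x"
    by (rule sgn_L2_def)
  show "dist x y = norm (x - y)"
    by (rule dist_L2_def)
  show "uniformity = (INF e\<in>{0<..}. principal {(x :: L2, y). dist x y < e})"
    by (rule uniformity_L2_def)
  show "open U = (\<forall>x\<in>U. eventually (\<lambda>(x', y). x' = x \<longrightarrow> y \<in> U) uniformity)" for U :: "L2 set"
    by (rule open_L2_def)
  show inner_norm: "norm x = sqrt (inner x x)"
    unfolding inner_L2_def
    by transfer (simp add: mult.commute[of "cnj _"] complex_norm_square[symmetric]
        integral_complex_of_real del: of_real_power)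
  have inner_x_x: "inner x x = (norm x)\<^sup>2"
    unfolding inner_L2_def
    by transfer (simp add: mult.commute[of "cnj _"] complex_norm_square[symmetric]
        integral_complex_of_real del: of_real_power)
  show "0 \<le> inner x x"
    by (simp add: inner_x_x)
  show "inner x x = 0 \<longleftrightarrow> x = 0"
    unfolding inner_x_x power_eq_0_iff
    by transfer (auto simp: square_integrable_def integral_nonneg_eq_0_iff_AE)
  have "cinner x y = cnj (cinner y x)"
    by transfer (simp add: mult.commute flip: Bochner_Integration.integral_cnj
        del: Bochner_Integration.integral_cnj)
  then show "inner x y = inner y x"
    by (simp add: inner_L2_def)
  have "cinner (x + y) z = cinner x z + cinner y z"
    by transfer (simp add: distrib_right square_integrable_inner)
  then show "inner (x + y) z = inner x z + inner y z"
    by (simp add: inner_L2_def)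
  have "cinner (a *\<^sub>R x) y = a * cinner x y"
    by transfer (simp add: scaleR_conv_of_real mult.assoc)
  then show "inner (a *\<^sub>R x) y = a * inner x y"
    by (simp add: inner_L2_def)
qed

end


section \<open>Unbounded operators\<close>

text \<open>
  An operator is a partial function, so that its domain is part of it and equality of
  operators includes equality of domains; \<open>the (A x)\<close> is the value at \<open>x \<in> dom A\<close>.
\<close>

type_synonym L2_op = "L2 \<rightharpoonup> L2"

definition linear_op :: "L2_op \<Rightarrow> bool" where
  "linear_op A \<longleftrightarrow>
     0 \<in> dom A \<and>
     (\<forall>x\<in>dom A. \<forall>y\<in>dom A. A (x + y) = Some (the (A x) + the (A y))) \<and>
     (\<forall>c. \<forall>x\<in>dom A. A (c *\<^sub>C x) = Some (c *\<^sub>C the (A x)))"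

text \<open>The adjoint is meaningful for densely defined operators only: then \<open>z\<close> below is unique.\<close>

definition adjoint_op :: "L2_op \<Rightarrow> L2_op" where
  "adjoint_op A y =
     (if \<exists>z. \<forall>x\<in>dom A. cinner y (the (A x)) = cinner z x
      then Some (THE z. \<forall>x\<in>dom A. cinner y (the (A x)) = cinner z x)
      else None)"

definition selfadjoint_op :: "L2_op \<Rightarrow> bool" where
  "selfadjoint_op A \<longleftrightarrow> linear_op A \<and> closure (dom A) = UNIV \<and> adjoint_op A = A"

definition diff_op :: "L2_op \<Rightarrow> L2_op \<Rightarrow> L2_op" where
  "diff_op A B x = (if x \<in> dom A \<inter> dom B then Some (the (A x) - the (B x)) else None)"

definition norm_op :: "L2_op \<Rightarrow> ennreal" where
  "norm_op A = (SUP x\<in>{x \<in> dom A. norm x = 1}. ennreal (norm (the (A x))))"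

text \<open>\<open>(A - z)\<^sup>-\<^sup>1\<close>; for a self-adjoint \<open>A\<close> and non-real \<open>z\<close> this is a bounded operator
  defined on the whole space.\<close>

definition resolvent :: "L2_op \<Rightarrow> complex \<Rightarrow> L2 \<Rightarrow> L2" where
  "resolvent A z y = (THE x. x \<in> dom A \<and> the (A x) - z *\<^sub>C x = y)"

text \<open>
  Commutation of (possibly unbounded) self-adjoint operators is understood in the usual strong
  sense: their resolvents (equivalently, their spectral projections) commute. For bounded
  operators this is just \<open>AB = BA\<close>. The pointwise identity \<open>ABx = BAx\<close> on the natural domains
  of the products is not a usable notion in the unbounded case: these domains differ already for
  \<open>A = 0\<close> and unbounded \<open>B\<close>, and conversely both can be \<open>{0}\<close>, which makes the
  identity void, for operators that do not commute in any reasonable sense.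
\<close>

definition commuting_ops :: "L2_op \<Rightarrow> L2_op \<Rightarrow> bool" where
  "commuting_ops A B \<longleftrightarrow>
     (\<forall>z w. Im z \<noteq> 0 \<longrightarrow> Im w \<noteq> 0 \<longrightarrow>
        resolvent A z \<circ> resolvent B w = resolvent B w \<circ> resolvent A z)"


section \<open>Position and momentum\<close>

definition nth_deriv :: "nat \<Rightarrow> (real \<Rightarrow> complex) \<Rightarrow> real \<Rightarrow> complex" where
  "nth_deriv m = ((\<lambda>f t. vector_derivative f (at t)) ^^ m)"

definition smooth :: "(real \<Rightarrow> complex) \<Rightarrow> bool" where
  "smooth f \<longleftrightarrow> (\<forall>m t. nth_deriv m f differentiable (at t))"

definition C0 :: "(real \<Rightarrow> complex) set" where
  "C0 = {f. continuous_on UNIV f \<and> (f \<longlongrightarrow> 0) at_infinity}"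

definition D0_functions :: "(real \<Rightarrow> complex) set" where
  "D0_functions = {f. smooth f \<and>
     (\<forall>m. square_integrable (nth_deriv m f)) \<and>
     (\<forall>m. square_integrable (\<lambda>t. of_real t ^ m * f t) \<and>
          (\<lambda>t. of_real t ^ m * f t) \<in> C0 \<and>
          square_integrable (\<lambda>t. of_real t ^ m * nth_deriv 1 f t) \<and>
          (\<lambda>t. of_real t ^ m * nth_deriv 1 f t) \<in> C0)}"

definition D0 :: "L2 set" where
  "D0 = abs_L2 ` D0_functions"

text \<open>The representative is unique, since functions in \<^term>\<open>D0_functions\<close> are continuous;
  see \<open>D0_rep_abs\<close> below.\<close>

definition D0_rep :: "L2 \<Rightarrow> real \<Rightarrow> complex" where
  "D0_rep x = (THE f. f \<in> D0_functions \<and> abs_L2 f = x)"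

definition position :: L2_op where
  "position x = (if x \<in> D0 then Some (abs_L2 (\<lambda>t. of_real t * D0_rep x t)) else None)"

definition momentum :: "real \<Rightarrow> L2_op" where
  "momentum hbar x =
     (if x \<in> D0 then Some (abs_L2 (\<lambda>t. - \<i> * of_real hbar * nth_deriv 1 (D0_rep x) t)) else None)"

lemma dom_position [simp]: "dom position = D0"
  and dom_momentum [simp]: "dom (momentum hbar) = D0"
  by (auto simp: dom_def position_def momentum_def)

lemma continuous_AE_eq:
  fixes f g :: "real \<Rightarrow> complex"
  assumes "continuous_on UNIV f" "continuous_on UNIV g" "AE t in lborel. f t = g t"
  shows "f = g"
proof -
  have op: "open {t. f t \<noteq> g t}"
    by (intro open_Collect_neq assms)
  moreover have "negligible {t. f t \<noteq> g t}"
  proof -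
    have "{t. f t \<noteq> g t} \<in> null_sets lborel"
      using assms(3) op by (subst AE_iff_null_sets) auto
    then show ?thesis
      by (simp add: negligible_iff_null_sets null_sets_completionI)
  qed
  ultimately have "{t. f t \<noteq> g t} = {}"
    using open_not_negligible by blast
  then show ?thesis
    by auto
qed

lemma D0_functions_square_integrable: "f \<in> D0_functions \<Longrightarrow> square_integrable f"
  unfolding D0_functions_def nth_deriv_def by (auto dest!: spec[of _ 0])

lemma D0_functions_continuous: "f \<in> D0_functions \<Longrightarrow> continuous_on UNIV f"
  unfolding D0_functions_def C0_def by (auto dest!: spec[of _ 0])

lemma D0_rep_abs:
  assumes "f \<in> D0_functions"
  shows "D0_rep (abs_L2 f) = f"
  unfolding D0_rep_def
proof (rule the_equality)
  fix g assume g: "g \<in> D0_functions \<and> abs_L2 g = abs_L2 f"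
  then have "L2_eq g f"
    using assms D0_functions_square_integrable
    by (subst Quotient_rel[OF Quotient_L2, symmetric]) (auto simp: L2_eq_def)
  then show "g = f"
    using g assms by (intro continuous_AE_eq D0_functions_continuous) (auto simp: L2_eq_def)
qed (use assms in auto)

lemma position_abs:
  "f \<in> D0_functions \<Longrightarrow> position (abs_L2 f) = Some (abs_L2 (\<lambda>t. of_real t * f t))"
  by (simp add: position_def D0_def D0_rep_abs)

lemma momentum_abs:
  "f \<in> D0_functions \<Longrightarrow>
     momentum hbar (abs_L2 f) = Some (abs_L2 (\<lambda>t. - \<i> * of_real hbar * nth_deriv 1 f t))"
  by (simp add: momentum_def D0_def D0_rep_abs)


section \<open>Approximation by commuting pairs\<close>

definition commuting_pairs :: "(L2_op \<times> L2_op) set" where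
  "commuting_pairs = {(h1, h2). selfadjoint_op h1 \<and> selfadjoint_op h2 \<and>
     D0 \<subseteq> dom h1 \<and> D0 \<subseteq> dom h2 \<and> commuting_ops h1 h2}"

definition approx_error :: "real \<Rightarrow> L2_op \<Rightarrow> L2_op \<Rightarrow> ennreal" where
  "approx_error hbar h1 h2 =
     norm_op (diff_op position h1 |` D0) + norm_op (diff_op (momentum hbar) h2 |` D0)"

end

(* Suppose hbar > 0. The operator A = S_1 + i S_hbar = t + hbar d/dt is the annihilation operator:
   it has dense range and a nonzero kernel (the Gaussian), so its index is 1, whereas a commuting
   pair gives a normal operator N = h1 + i h2, whose index is 0. If both differences were bounded
   on D0, then A - N would be a relatively compact perturbation, because A has compact resolvent,
   and the indices would agree. Hence for every nonzero hbar the error of every commuting pair is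
   infinite. No Fredholm theory is needed: by normality and compactness N - z is bounded below for
   some real z, and Riesz' argument for the Fredholm alternative then runs directly on D0, with
   approximate solutions of A f = g in place of closures of the operators. *)

theory Submission
  imports Defs "HOL-Complex_Analysis.Great_Picard"
begin

section \<open>An index obstruction\<close>

text \<open>The obstacle is how little is known on \<open>D0\<close>: it lies in the domains of
  \<open>h1\<close> and \<open>h2\<close>, but these operators need not map it into itself, and
  their restrictions to it need not be closed. Products h1 h2 x are therefore avoided. Commutation
  enters only as the reality of <h1 x, h2 x>, obtained from the resolvents. It makes the norms of N
  x and M x equal, where M = h1 - i h2, and gives |N x|^2 = |h1 x|^2 + |h2 x|^2. By this identity,
  and because both differences are bounded, bounds on f and N f yield bounds on t f and f' in L2,
  which is the source of compactness. Density of the range of A is explicit: t f + k f' = g is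
  solved by variation of constants for g = exp(-((t - c)/r)^(2m)) with m >= 2, and these functions
  tend to indicators of intervals. The abstract part works with real inner products: one nonzero
  kernel vector and a dense range are enough. For negative hbar the sign is absorbed into A = S_1 +
  i sgn(hbar) S_hbar.\<close>

lemma underdetermined_system:
  fixes a :: "'j \<Rightarrow> 'i \<Rightarrow> real"
  assumes "finite J" "finite I" "card J < card I"
  shows "\<exists>c. (\<exists>i\<in>I. c i \<noteq> 0) \<and> (\<forall>j\<in>J. (\<Sum>i\<in>I. a j i * c i) = 0)"
  using assms
proof (induction J arbitrary: I a rule: finite_induct)
  case empty
  then obtain i where "i \<in> I" by fastforce
  then show ?case by (intro exI[of _ "\<lambda>_. 1"]) auto
next
  case (insert j J)
  show ?case
  proof (cases "\<forall>i\<in>I. a j i = 0")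
    case True
    then show ?thesis using insert.IH[of I a] insert by auto
  next
    case False
    then obtain p where p: "p \<in> I" "a j p \<noteq> 0" by auto
    \<comment> \<open>Gaussian elimination: equation \<open>j\<close>, whose coefficient at
      \<open>p\<close> is nonzero, is solved for the unknown \<open>p\<close>, and \<open>a'\<close>
      is the reduced system in the remaining unknowns.\<close>
    define a' where "a' l i = a l i - a l p * a j i / a j p" for l i
    have "card J < card (I - {p})" using insert p by auto
    then obtain c where c: "\<exists>i\<in>I - {p}. c i \<noteq> 0"
      and c0: "\<And>l. l \<in> J \<Longrightarrow> (\<Sum>i\<in>I - {p}. a' l i * c i) = 0"
      using insert.IH[of "I - {p}" a'] insert.prems by auto
    define S where "S = (\<Sum>i\<in>I - {p}. a j i * c i)"
    define d where "d = c(p := - S / a j p)"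
    have sum_d: "(\<Sum>i\<in>I. a l i * d i) = (\<Sum>i\<in>I - {p}. a l i * c i) - a l p * S / a j p" for l
      using p insert.prems by (simp add: sum.remove[of I p] d_def)
    have "(\<Sum>i\<in>I. a l i * d i) = 0" if "l \<in> insert j J" for l
    proof (cases "l = j")
      case True
      then show ?thesis using p by (simp add: sum_d S_def)
    next
      case False
      then have "(\<Sum>i\<in>I - {p}. a' l i * c i) = 0" using c0 that by auto
      then show ?thesis
        by (simp add: sum_d S_def a'_def left_diff_distrib sum_subtractf sum_distrib_left
            sum_divide_distrib mult.assoc)
    qed
    moreover have "\<exists>i\<in>I. d i \<noteq> 0" using c by (auto simp: d_def)
    ultimately show ?thesis by blast
  qed
qed

text \<open>Relative to \<open>D\<close>, because an unbounded operator appears as a total function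
  such as \<open>the (h x)\<close>, which is meaningful only on the domain.\<close>

definition linear_on_subspace :: "'a::real_vector set \<Rightarrow> ('a \<Rightarrow> 'b::real_vector) \<Rightarrow> bool" where
  "linear_on_subspace D T \<longleftrightarrow>
     (\<forall>x\<in>D. \<forall>y\<in>D. T (x + y) = T x + T y) \<and> (\<forall>c. \<forall>x\<in>D. T (c *\<^sub>R x) = c *\<^sub>R T x)"

lemma linear_on_subspaceD:
  assumes "linear_on_subspace D T" "subspace D"
  shows "\<And>x y. x \<in> D \<Longrightarrow> y \<in> D \<Longrightarrow> T (x + y) = T x + T y"
    and "\<And>c x. x \<in> D \<Longrightarrow> T (c *\<^sub>R x) = c *\<^sub>R T x"
    and "T 0 = 0"
    and "\<And>x y. x \<in> D \<Longrightarrow> y \<in> D \<Longrightarrow> T (x - y) = T x - T y"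
proof -
  show add: "T (x + y) = T x + T y" if "x \<in> D" "y \<in> D" for x y
    using assms that by (auto simp: linear_on_subspace_def)
  show scale: "T (c *\<^sub>R x) = c *\<^sub>R T x" if "x \<in> D" for c x
    using assms that by (auto simp: linear_on_subspace_def)
  show "T 0 = 0"
    using scale[of 0 0] assms(2) by (simp add: subspace_0)
  show "T (x - y) = T x - T y" if "x \<in> D" "y \<in> D" for x y
    using add[of x "- y"] scale[of y "-1"] that assms(2) by (simp add: subspace_neg)
qed

lemma linear_on_subspace_sum:
  assumes "linear_on_subspace D T" "subspace D" "\<And>i. i \<in> I \<Longrightarrow> f i \<in> D"
  shows "T (\<Sum>i\<in>I. c i *\<^sub>R f i) = (\<Sum>i\<in>I. c i *\<^sub>R T (f i))"
  using assms(3)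
proof (induction I rule: infinite_finite_induct)
  case (insert i I)
  then have "(\<Sum>i\<in>I. c i *\<^sub>R f i) \<in> D"
    by (intro subspace_sum[OF assms(2)] subspace_scale[OF assms(2)]) auto
  then show ?case
    using insert by (simp add: linear_on_subspaceD[OF assms(1,2)] subspace_scale[OF assms(2)])
qed (auto simp: linear_on_subspaceD[OF assms(1,2)])

text \<open>Total boundedness of the balls of the graph norm, phrased as the absence of uniformly
  separated sequences. This form speaks of elements of \<open>D\<close> only, since limits may leave
  \<open>D\<close>.\<close>

definition pre_compact_graph :: "'a::real_normed_vector set \<Rightarrow> ('a \<Rightarrow> 'a) \<Rightarrow> bool" where
  "pre_compact_graph D T \<longleftrightarrow>
     (\<forall>f c e. range f \<subseteq> D \<longrightarrow> (\<forall>n. norm (f n) \<le> c) \<longrightarrow> (\<forall>n. norm (T (f n)) \<le> c) \<longrightarrow> e > 0 \<longrightarrow>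
        (\<exists>m n::nat. m < n \<and> norm (f n - f m) < e))"

lemma pre_compact_graphD:
  assumes "pre_compact_graph D T" "\<And>n. f n \<in> D" "\<And>n. norm (f n) \<le> c" "\<And>n. norm (T (f n)) \<le> c" "e > 0"
  shows "\<exists>m n::nat. m < n \<and> norm (f n - f m) < e"
  using assms unfolding pre_compact_graph_def by blast

text \<open>Approximate eigenvectors for distinct real numbers \<open>z\<^sub>n = 1/(n+1)\<close> would be
  uniformly separated, because those of a normal operator are nearly orthogonal.\<close>

lemma normal_shift_bounded_below:
  fixes N M :: "'a::real_inner \<Rightarrow> 'a"
  assumes D: "subspace D" and N: "linear_on_subspace D N" and M: "linear_on_subspace D M"
    and adj: "\<And>x y. x \<in> D \<Longrightarrow> y \<in> D \<Longrightarrow> inner (N x) y = inner x (M y)"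
    and normal: "\<And>x. x \<in> D \<Longrightarrow> norm (N x) = norm (M x)"
    and comp: "pre_compact_graph D N"
  shows "\<exists>z \<delta>. \<delta> > 0 \<and> (\<forall>x\<in>D. norm (N x - z *\<^sub>R x) \<ge> \<delta> * norm x)"
proof (rule ccontr)
  assume contr: "\<not> ?thesis"
  define z :: "nat \<Rightarrow> real" where "z n = 1 / (real n + 1)" for n
  \<comment> \<open>A quarter of the gap between \<open>z n\<close> and \<open>z (Suc n)\<close>,
    which is 1 / ((n + 1) (n + 2)); two such errors make half a gap.\<close>
  define \<delta> :: "nat \<Rightarrow> real" where "\<delta> n = 1 / (4 * (real n + 1) * (real n + 2))" for n
  have "\<exists>x\<in>D. norm x = 1 \<and> norm (N x - z n *\<^sub>R x) \<le> \<delta> n" for n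
  proof -
    have "\<delta> n > 0" by (simp add: \<delta>_def)
    then obtain x where x: "x \<in> D" "norm (N x - z n *\<^sub>R x) < \<delta> n * norm x"
      using contr by (meson not_le)
    then have x0: "norm x > 0" by (cases "x = 0") (auto simp: linear_on_subspaceD[OF N D])
    let ?y = "inverse (norm x) *\<^sub>R x"
    have "N ?y - z n *\<^sub>R ?y = inverse (norm x) *\<^sub>R (N x - z n *\<^sub>R x)"
      using x by (simp add: linear_on_subspaceD[OF N D] algebra_simps)
    then have "norm (N ?y - z n *\<^sub>R ?y) = inverse (norm x) * norm (N x - z n *\<^sub>R x)"
      by (simp del: scaleR_right_diff_distrib)
    also have "\<dots> \<le> inverse (norm x) * (\<delta> n * norm x)"
      using x by (intro mult_left_mono) auto
    also have "\<dots> = \<delta> n" using x0 by simp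
    finally have "norm (N ?y - z n *\<^sub>R ?y) \<le> \<delta> n" .
    then show ?thesis using x x0 D
      by (intro bexI[of _ ?y]) (auto simp: subspace_scale)
  qed
  then obtain f where f: "\<And>n. f n \<in> D" "\<And>n. norm (f n) = 1"
    and fN: "\<And>n. norm (N (f n) - z n *\<^sub>R f n) \<le> \<delta> n" by metis
  have z01: "0 < z n" "z n \<le> 1" for n by (auto simp: z_def)
  have d1: "\<delta> n \<le> 1" for n
  proof -
    have "1 \<le> 4 * (real n + 1) * (real n + 2)" by (simp add: algebra_simps)
    then show ?thesis unfolding \<delta>_def by (subst divide_le_eq_1_pos) auto
  qed
  have "norm (N (f n)) \<le> 2" for n
    using norm_triangle_ineq[of "N (f n) - z n *\<^sub>R f n" "z n *\<^sub>R f n"] fN[of n] z01[of n] d1[of n] f[of n]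
    by simp
  then obtain m n where mn: "m < n" "norm (f n - f m) < 1"
    using pre_compact_graphD[OF comp, of f 2 1] f by auto
  \<comment> \<open>A real shift keeps the norms equal: the cross terms agree because
    \<open>inner (N x) x = inner x (M x)\<close>.\<close>
  have "(norm (M x - c *\<^sub>R x))\<^sup>2 = (norm (N x - c *\<^sub>R x))\<^sup>2" if "x \<in> D" for x c
    using adj[OF that that] normal[OF that]
    by (simp add: power2_norm_eq_inner inner_diff inner_commute norm_eq_sqrt_inner)
  then have normal': "norm (M x - c *\<^sub>R x) = norm (N x - c *\<^sub>R x)" if "x \<in> D" for x c
    using that by (simp add: power2_eq_iff_nonneg)
  \<comment> \<open>As for eigenvectors of a normal operator: moving \<open>N\<close> across as
    \<open>M\<close> expresses the difference of the eigenvalues, times the inner product, through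
    the two residuals.\<close>
  have "(z m - z n) * inner (f m) (f n)
      = inner (f m) (M (f n) - z n *\<^sub>R f n) - inner (N (f m) - z m *\<^sub>R f m) (f n)"
    using adj[OF f(1) f(1), of m n] by (simp add: inner_diff algebra_simps)
  also have "\<dots> \<le> \<delta> n + \<delta> m"
  proof -
    have "inner (f m) (M (f n) - z n *\<^sub>R f n) \<le> norm (f m) * norm (M (f n) - z n *\<^sub>R f n)"
      by (rule norm_cauchy_schwarz)
    moreover have "- inner (N (f m) - z m *\<^sub>R f m) (f n) \<le> norm (N (f m) - z m *\<^sub>R f m) * norm (f n)"
      using Cauchy_Schwarz_ineq2[of "N (f m) - z m *\<^sub>R f m" "f n"] by linarith
    ultimately show ?thesis using f fN[of n] fN[of m] normal' by simp
  qed
  also have "\<dots> \<le> 2 * \<delta> m"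
  proof -
    have "\<delta> n \<le> \<delta> m" unfolding \<delta>_def using mn by (intro divide_left_mono mult_mono) auto
    then show ?thesis by simp
  qed
  also have "2 * \<delta> m = (z m - z (Suc m)) / 2"
    by (simp add: z_def \<delta>_def divide_simps) (simp add: algebra_simps)
  also have "\<dots> \<le> (z m - z n) / 2"
  proof -
    have "z n \<le> z (Suc m)" unfolding z_def using mn by (intro divide_left_mono) auto
    then show ?thesis by simp
  qed
  finally have "(z m - z n) * (inner (f m) (f n)) \<le> (z m - z n) * (1 / 2)" by simp
  moreover have "z n < z m" unfolding z_def using mn by (intro divide_strict_left_mono) auto
  ultimately have "inner (f m) (f n) \<le> 1 / 2" by simp
  \<comment> \<open>The squared distance of two unit vectors is 2 minus twice their inner
    product.\<close>
  then have "(norm (f n - f m))\<^sup>2 \<ge> 1"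
    using f by (simp add: power2_norm_eq_inner inner_diff inner_commute) (simp add: norm_eq_sqrt_inner)
  moreover have "(norm (f n - f m))\<^sup>2 < 1\<^sup>2" using mn by (intro power_strict_mono) auto
  ultimately show False by simp
qed

text \<open>The step of Riesz' argument for the Fredholm alternative: the equation \<open>A f \<in> V\<close>
  with \<open>V\<close> of dimension \<open>n\<close> has \<open>n + 1\<close> independent approximate solutions since \<open>A\<close>
  has a kernel, so \<open>T f\<close> can be made orthogonal to \<open>V\<close>.\<close>

lemma riesz_step:
  fixes A T :: "'a::real_inner \<Rightarrow> 'a"
  assumes D: "subspace D" and A: "linear_on_subspace D A" and T: "linear_on_subspace D T"
    and bdd: "\<And>x. x \<in> D \<Longrightarrow> norm (A x - T x) \<le> C * norm x"
    and below: "\<And>x. x \<in> D \<Longrightarrow> norm (T x) \<ge> \<delta> * norm x" and \<delta>: "\<delta> > 0"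
    and dense: "\<And>y e. e > 0 \<Longrightarrow> \<exists>x\<in>D. norm (A x - y) < e"
    and ker: "f0 \<in> D" "f0 \<noteq> 0" "A f0 = 0"
    and on: "\<And>i j::nat. i < n \<Longrightarrow> j < n \<Longrightarrow> inner (e i) (e j) = (if i = j then 1 else 0)"
    and \<epsilon>: "\<epsilon> > 0"
  shows "\<exists>f\<in>D. norm (T f) = 1 \<and> (\<forall>i<n. inner (T f) (e i) = 0) \<and>
           (\<exists>v\<in>span (e ` {..<n}). norm (A f - v) \<le> \<epsilon>)"
proof -
  \<comment> \<open>The factor in \<open>norm (A g) \<le> K * norm (T g)\<close>, from the bound on
    \<open>A - T\<close> and from \<open>norm g \<le> norm (T g) / \<delta>\<close>.\<close>
  define K where "K = 1 + \<bar>C\<bar> / \<delta>"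
  have K: "K \<ge> 1" using \<delta> by (simp add: K_def)
  \<comment> \<open>The \<open>n\<close> approximation errors add up to at most
    \<open>n * \<eta>\<close>: at most 1/2, to be absorbed into \<open>norm v\<close>, and at most
    \<open>\<epsilon> / (2 * K)\<close>, for the final estimate. The denominator n + 1 keeps
    \<open>\<eta>\<close> positive for n = 0.\<close>
  define \<eta> where "\<eta> = min (1/2) (\<epsilon> / (2 * K)) / (real n + 1)"
  have \<eta>: "\<eta> > 0" using \<epsilon> K by (simp add: \<eta>_def)
  have "\<forall>i. \<exists>x\<in>D. norm (A x - e i) < \<eta>" using dense \<eta> by blast
  then obtain r where r: "\<And>i. r i \<in> D" "\<And>i. norm (A (r i) - e i) < \<eta>" by metis
  \<comment> \<open>The kernel vector takes the index \<open>n\<close>, so that n + 1 coefficients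
    face the n conditions \<open>inner (T g) (e j) = 0\<close>.\<close>
  define w where "w i = (if i = n then f0 else r i)" for i
  have wD: "w i \<in> D" for i using r ker by (simp add: w_def)
  obtain c where c: "\<exists>i\<in>{..n}. c i \<noteq> 0"
    and c0: "\<And>j. j < n \<Longrightarrow> (\<Sum>i\<le>n. inner (T (w i)) (e j) * c i) = 0"
    using underdetermined_system[of "{..<n}" "{..n}" "\<lambda>j i. inner (T (w i)) (e j)"] by auto
  define g where "g = (\<Sum>i\<le>n. c i *\<^sub>R w i)"
  define v where "v = (\<Sum>i<n. c i *\<^sub>R e i)"
  have gD: "g \<in> D" unfolding g_def by (intro subspace_sum[OF D] subspace_scale[OF D] wD)
  have Tg: "T g = (\<Sum>i\<le>n. c i *\<^sub>R T (w i))"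
    unfolding g_def using linear_on_subspace_sum[OF T D wD] .
  have orth: "inner (T g) (e j) = 0" if "j < n" for j
    unfolding Tg using c0[OF that] by (simp add: inner_sum_left mult.commute)
  have "A g = (\<Sum>i\<le>n. c i *\<^sub>R A (w i))"
    unfolding g_def using linear_on_subspace_sum[OF A D wD] .
  also have "\<dots> = (\<Sum>i<n. c i *\<^sub>R A (r i))"
    using ker by (simp add: lessThan_Suc_atMost[symmetric] w_def)
  finally have "A g - v = (\<Sum>i<n. c i *\<^sub>R (A (r i) - e i))"
    by (simp add: v_def scaleR_right_diff_distrib sum_subtractf)
  also have "norm \<dots> \<le> (\<Sum>i<n. norm v * \<eta>)"
  proof (rule sum_norm_le)
    fix i assume "i \<in> {..<n}"
    then have "c i = inner v (e i)"
      unfolding v_def by (simp add: inner_sum_left on if_distrib[of "(*) _"] cong: if_cong)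
    moreover have "norm (e i) = 1" using on[of i i] \<open>i \<in> _\<close> by (simp add: norm_eq_sqrt_inner)
    ultimately have "\<bar>c i\<bar> \<le> norm v" using Cauchy_Schwarz_ineq2[of v "e i"] by simp
    then show "norm (c i *\<^sub>R (A (r i) - e i)) \<le> norm v * \<eta>"
      using r(2)[of i] by (auto intro!: mult_mono)
  qed
  also have "\<dots> \<le> norm v * (real n * \<eta>)" by simp
  finally have Agv: "norm (A g - v) \<le> norm v * (real n * \<eta>)" .
  have n\<eta>: "real n * \<eta> \<le> min (1/2) (\<epsilon> / (2 * K))"
  proof -
    have "real n / (real n + 1) \<le> 1" by simp
    then have "min (1/2) (\<epsilon> / (2 * K)) * (real n / (real n + 1)) \<le> min (1/2) (\<epsilon> / (2 * K)) * 1"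
      using K \<epsilon> by (intro mult_left_mono) auto
    then show ?thesis by (simp add: \<eta>_def mult.commute)
  qed
  \<comment> \<open>The error is at most half of \<open>norm v\<close> and is absorbed on the
    left.\<close>
  have v2: "norm v \<le> 2 * norm (A g)"
  proof -
    have "norm v \<le> norm (A g) + norm (A g - v)"
      by (metis norm_triangle_sub norm_minus_commute)
    also have "norm (A g - v) \<le> norm v * (1/2)"
      using Agv n\<eta> by (meson min.boundedE mult_left_mono norm_ge_zero order_trans)
    finally show ?thesis by simp
  qed
  \<comment> \<open>If \<open>g\<close> were 0, then \<open>v\<close> would be 0 and, by
    orthonormality, so would all \<open>c i\<close> with i < n; what remains is a multiple of
    \<open>f0\<close> with a nonzero coefficient.\<close>
  have "g \<noteq> 0"
  proof
    assume "g = 0"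
    then have "v = 0" using v2 linear_on_subspaceD(3)[OF A D] by simp
    have ci: "c i = 0" if "i < n" for i
    proof -
      have "c i = inner v (e i)"
        unfolding v_def using that by (simp add: inner_sum_left on if_distrib[of "(*) _"] cong: if_cong)
      then show ?thesis using \<open>v = 0\<close> by simp
    qed
    then have "g = c n *\<^sub>R f0" by (simp add: g_def lessThan_Suc_atMost[symmetric] w_def)
    then show False using \<open>g = 0\<close> ker c ci by (metis atMost_iff le_neq_implies_less scaleR_eq_0_iff)
  qed
  then have Tg0: "norm (T g) > 0"
    using below[OF gD] \<delta> by (smt (verit) mult_pos_pos zero_less_norm_iff)
  have "norm (A g) \<le> norm (T g) + \<bar>C\<bar> * norm g"
  proof -
    have "norm (A g) \<le> norm (T g) + norm (A g - T g)" by (rule norm_triangle_sub)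
    also have "norm (A g - T g) \<le> \<bar>C\<bar> * norm g"
      using bdd[OF gD] by (meson abs_ge_self mult_right_mono norm_ge_zero order_trans)
    finally show ?thesis by simp
  qed
  also have "\<bar>C\<bar> * norm g \<le> \<bar>C\<bar> * (norm (T g) / \<delta>)"
    using below[OF gD] \<delta> by (intro mult_left_mono) (auto simp: field_simps)
  finally have AgT: "norm (A g) \<le> K * norm (T g)"
    by (simp add: K_def algebra_simps)
  let ?s = "inverse (norm (T g))"
  have "norm (A g - v) \<le> norm v * (\<epsilon> / (2 * K))"
    using Agv n\<eta> by (meson min.boundedE mult_left_mono norm_ge_zero order_trans)
  also have "\<dots> \<le> (2 * (K * norm (T g))) * (\<epsilon> / (2 * K))"
    using v2 AgT \<epsilon> K by (intro mult_right_mono) auto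
  also have "\<dots> = \<epsilon> * norm (T g)" using K by simp
  finally have "?s * norm (A g - v) \<le> \<epsilon>" using Tg0 by (simp add: field_simps)
  then have "norm (A (?s *\<^sub>R g) - ?s *\<^sub>R v) \<le> \<epsilon>"
    using gD by (simp add: linear_on_subspaceD[OF A D] flip: scaleR_right_diff_distrib)
  moreover have "v \<in> span (e ` {..<n})"
    unfolding v_def by (intro span_sum span_scale span_base) auto
  then have "?s *\<^sub>R v \<in> span (e ` {..<n})" by (rule span_scale)
  moreover have "norm (T (?s *\<^sub>R g)) = 1" "\<forall>i<n. inner (T (?s *\<^sub>R g)) (e i) = 0"
    using gD Tg0 orth by (auto simp: linear_on_subspaceD[OF T D])
  ultimately show ?thesis using gD subspace_scale[OF D] by blast
qed

text \<open>With a kernel vector one can build f_n such that the T f_n are orthonormal and A f_n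
  lies within 1/4 of the span of the T f_i with i < n. For m < n the inner product of T f_n with A
  (f_n - f_m) is then at most 1/2, whereas with T (f_n - f_m) it equals 1. Since A - T is bounded,
  the f_n are uniformly separated although their graph norms are bounded, which contradicts
  precompactness.\<close>

lemma index_obstruction:
  fixes A N M :: "'a::real_inner \<Rightarrow> 'a"
  assumes D: "subspace D" and A: "linear_on_subspace D A"
    and N: "linear_on_subspace D N" and M: "linear_on_subspace D M"
    and adj: "\<And>x y. x \<in> D \<Longrightarrow> y \<in> D \<Longrightarrow> inner (N x) y = inner x (M y)"
    and normal: "\<And>x. x \<in> D \<Longrightarrow> norm (N x) = norm (M x)"
    and comp: "pre_compact_graph D N"
    and bdd: "\<And>x. x \<in> D \<Longrightarrow> norm (A x - N x) \<le> C * norm x"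
    and dense: "\<And>y e. e > 0 \<Longrightarrow> \<exists>x\<in>D. norm (A x - y) < e"
    and ker: "f0 \<in> D" "A f0 = 0"
  shows "f0 = 0"
proof (rule ccontr)
  assume f0: "f0 \<noteq> 0"
  obtain z \<delta> where \<delta>: "\<delta> > 0" and below: "\<And>x. x \<in> D \<Longrightarrow> norm (N x - z *\<^sub>R x) \<ge> \<delta> * norm x"
    using normal_shift_bounded_below[OF D N M adj normal comp] by blast
  define T where "T x = N x - z *\<^sub>R x" for x
  define K where "K = \<bar>C\<bar> + \<bar>z\<bar> + 1"
  have T: "linear_on_subspace D T"
    using linear_on_subspaceD[OF N D] unfolding linear_on_subspace_def T_def
    by (auto simp: algebra_simps)
  have bdd': "norm (A x - T x) \<le> K * norm x" if "x \<in> D" for x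
  proof -
    have "norm (A x - T x) \<le> norm (A x - N x) + norm (z *\<^sub>R x)"
      using norm_triangle_ineq[of "A x - N x" "z *\<^sub>R x"] by (simp add: T_def algebra_simps)
    also have "norm (A x - N x) \<le> \<bar>C\<bar> * norm x"
      using bdd[OF that] by (meson abs_ge_self mult_right_mono norm_ge_zero order_trans)
    finally show ?thesis using norm_ge_zero[of x] unfolding K_def distrib_right norm_scaleR by linarith
  qed
  define P where "P f n x \<longleftrightarrow> x \<in> D \<and> norm (T x) = 1 \<and> (\<forall>i<n. inner (T x) (T (f i)) = 0) \<and>
      (\<exists>v\<in>span ((\<lambda>i. T (f i)) ` {..<n}). norm (A x - v) \<le> 1/4)" for f :: "nat \<Rightarrow> 'a" and n x
  have "\<exists>f. \<forall>n. P f n (f n)"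
  \<comment> \<open>Course-of-values recursion; the first goal says that \<open>P f n x\<close>
    depends only on the values of \<open>f\<close> below \<open>n\<close>.\<close>
  proof (rule dependent_wellorder_choice)
    fix x :: 'a and f g :: "nat \<Rightarrow> 'a" and n
    assume "\<And>i. i < n \<Longrightarrow> f i = g i"
    then have "(\<lambda>i. T (f i)) ` {..<n} = (\<lambda>i. T (g i)) ` {..<n}" by (intro image_cong) auto
    then show "P f n x = P g n x" using \<open>\<And>i. i < n \<Longrightarrow> f i = g i\<close> by (simp add: P_def)
  next
    fix n f assume *: "\<And>i. i < n \<Longrightarrow> P f i (f i)"
    have on: "inner (T (f i)) (T (f j)) = (if i = j then 1 else 0)" if "i < n" "j < n" for i j
      using *[OF that(1)] *[OF that(2)]
      by (cases i j rule: linorder_cases) (auto simp: P_def inner_commute norm_eq_sqrt_inner)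
    have belowT: "\<delta> * norm x \<le> norm (T x)" if "x \<in> D" for x
      using below[OF that] by (simp add: T_def)
    have "\<exists>x\<in>D. norm (T x) = 1 \<and> (\<forall>i<n. inner (T x) (T (f i)) = 0) \<and>
        (\<exists>v\<in>span ((\<lambda>i. T (f i)) ` {..<n}). norm (A x - v) \<le> 1/4)"
      by (rule riesz_step[OF D A T bdd' belowT \<delta> dense ker(1) f0 ker(2) on]) simp_all
    then show "\<exists>x. P f n x" by (auto simp: P_def)
  qed
  then obtain f where f: "\<And>n. P f n (f n)" by blast
  have fD: "f n \<in> D" and T1: "norm (T (f n)) = 1" for n using f[of n] by (auto simp: P_def)
  have orth: "inner (T (f n)) (T (f m)) = 0" if "m < n" for m n using f[of n] that by (auto simp: P_def)
  \<comment> \<open>\<open>T (f n)\<close> is orthogonal to all \<open>T (f i)\<close> with i < m,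
    hence to their span, which \<open>A (f m)\<close> nearly meets. The case m = n is
    included.\<close>
  have small: "\<bar>inner (T (f n)) (A (f m))\<bar> \<le> 1/4" if "m \<le> n" for m n
  proof -
    obtain v where v: "v \<in> span ((\<lambda>i. T (f i)) ` {..<m})" "norm (A (f m) - v) \<le> 1/4"
      using f[of m] by (auto simp: P_def)
    have "inner (T (f n)) v = 0"
    proof -
      have "orthogonal (T (f n)) y" if "y \<in> (\<lambda>i. T (f i)) ` {..<m}" for y
        using that \<open>m \<le> n\<close> by (auto simp: orthogonal_def intro!: orth)
      then show ?thesis using orthogonal_to_span[OF v(1)] by (simp add: orthogonal_def)
    qed
    then have "\<bar>inner (T (f n)) (A (f m))\<bar> = \<bar>inner (T (f n)) (A (f m) - v)\<bar>"
      by (simp add: inner_diff_right)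
    also have "\<dots> \<le> norm (T (f n)) * norm (A (f m) - v)" by (rule Cauchy_Schwarz_ineq2)
    finally show ?thesis using v T1 by simp
  qed
  have fb: "norm (f n) \<le> 1 / \<delta>" for n
    using below[OF fD[of n]] T1[of n] \<delta> by (simp add: T_def field_simps)
  have "norm (N (f n)) \<le> 1 + \<bar>z\<bar> * (1 / \<delta>)" for n
  proof -
    have "norm (N (f n)) \<le> norm (T (f n)) + norm (z *\<^sub>R f n)"
      using norm_triangle_ineq[of "T (f n)" "z *\<^sub>R f n"] by (simp add: T_def)
    also have "norm (z *\<^sub>R f n) \<le> \<bar>z\<bar> * (1 / \<delta>)" using fb[of n] by (simp add: mult_left_mono del: times_divide_eq_right)
    finally show ?thesis using T1 by simp
  qed
  \<comment> \<open>The threshold that contradicts the separation 1/2 <=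
    \<open>K * norm (f n - f m)\<close> derived below.\<close>
  moreover have "1 / (2 * K) > 0" by (simp add: K_def add_nonneg_pos)
  ultimately obtain m n where mn: "m < n" "norm (f n - f m) < 1 / (2 * K)"
    using pre_compact_graphD[OF comp, of f "max (1 / \<delta>) (1 + \<bar>z\<bar> * (1 / \<delta>))" "1 / (2 * K)"] fD fb
    by (meson max.coboundedI1 max.coboundedI2)
  have d: "f n - f m \<in> D" using fD D by (simp add: subspace_diff)
  have "inner (T (f n)) (A (f n - f m) - T (f n - f m))
      = inner (T (f n)) (A (f n)) - inner (T (f n)) (A (f m)) - 1"
    using orth[OF mn(1)] T1[of n]
    by (simp add: linear_on_subspaceD[OF A D] linear_on_subspaceD[OF T D] fD inner_diff_right norm_eq_sqrt_inner)
  also have "\<dots> \<le> - 1/2" using small[of m n] small[of n n] mn by simp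
  finally have "1/2 \<le> \<bar>inner (T (f n)) (A (f n - f m) - T (f n - f m))\<bar>" by simp
  also have "\<dots> \<le> norm (T (f n)) * norm (A (f n - f m) - T (f n - f m))" by (rule Cauchy_Schwarz_ineq2)
  also have "\<dots> \<le> K * norm (f n - f m)" using bdd'[OF d] T1 by simp
  also have "\<dots> < K * (1 / (2 * K))" using mn by (intro mult_strict_left_mono) (auto simp: K_def)
  finally show False by (simp add: K_def split: if_splits)
qed

section \<open>The Hilbert space of square-integrable functions\<close>

lemma L2_eq_rep [simp]: "L2_eq (rep_L2 x) (rep_L2 x)"
  by (rule Quotient_rep_reflp[OF Quotient_L2])

lemma square_integrable_rep [simp]: "square_integrable (rep_L2 x)"
  using L2_eq_rep by (simp add: L2_eq_def del: L2_eq_rep)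

lemma abs_rep_L2 [simp]: "abs_L2 (rep_L2 x) = x"
  by (rule Quotient_abs_rep[OF Quotient_L2])

lemma L2_eq_refl: "square_integrable f \<Longrightarrow> L2_eq f f"
  by (simp add: L2_eq_def)

lemma norm_abs_L2: "square_integrable f \<Longrightarrow> norm (abs_L2 f) = sqrt (\<integral>t. (cmod (f t))\<^sup>2 \<partial>lborel)"
  by (simp add: norm_L2.abs_eq L2_eq_refl)

lemma abs_L2_add: "square_integrable f \<Longrightarrow> square_integrable g \<Longrightarrow>
    abs_L2 f + abs_L2 g = abs_L2 (\<lambda>t. f t + g t)"
  by (simp add: plus_L2.abs_eq L2_eq_refl)

lemma abs_L2_diff: "square_integrable f \<Longrightarrow> square_integrable g \<Longrightarrow>
    abs_L2 f - abs_L2 g = abs_L2 (\<lambda>t. f t - g t)"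
  by (simp add: minus_L2.abs_eq L2_eq_refl)

lemma abs_L2_scaleC: "square_integrable f \<Longrightarrow> c *\<^sub>C abs_L2 f = abs_L2 (\<lambda>t. c * f t)"
  by (simp add: scaleC.abs_eq L2_eq_refl)

lemma nn_norm_abs_L2:
  assumes "square_integrable f"
  shows "ennreal ((norm (abs_L2 f))\<^sup>2) = (\<integral>\<^sup>+t. ennreal ((cmod (f t))\<^sup>2) \<partial>lborel)"
  using assms by (simp add: norm_abs_L2 square_integrable_def nn_integral_eq_integral)

lemma square_integrableI:
  assumes "f \<in> borel_measurable lborel" "(\<integral>\<^sup>+t. ennreal ((cmod (f t))\<^sup>2) \<partial>lborel) < \<infinity>"
  shows "square_integrable f"
  using assms unfolding square_integrable_def by (auto intro!: integrableI_nonneg)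

section \<open>Complex scalars and the complex inner product\<close>

lemma scaleC_scaleC: "a *\<^sub>C b *\<^sub>C x = (a * b) *\<^sub>C x"
  by transfer (auto simp: L2_eq_def mult.assoc square_integrable_mult)

lemma scaleC_one [simp]: "1 *\<^sub>C x = x"
  by transfer (auto simp: L2_eq_def)

lemma scaleC_add_right: "a *\<^sub>C (x + y) = a *\<^sub>C x + a *\<^sub>C y"
  by transfer (auto simp: L2_eq_def distrib_left square_integrable_mult square_integrable_add)

lemma scaleC_diff_right: "a *\<^sub>C (x - y) = a *\<^sub>C x - a *\<^sub>C y"
  by transfer (auto simp: L2_eq_def right_diff_distrib square_integrable_mult square_integrable_diff)

lemma scaleC_zero_right [simp]: "a *\<^sub>C 0 = 0"
  by (metis scaleC_diff_right diff_self)

lemma scaleR_scaleC: "c *\<^sub>R x = of_real c *\<^sub>C x"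
  by transfer (auto simp: L2_eq_def scaleR_conv_of_real square_integrable_mult)

lemma scaleC_minus_left: "(- a) *\<^sub>C x = - (a *\<^sub>C x)"
  by transfer (auto simp: L2_eq_def square_integrable_mult square_integrable_minus)

lemma norm_scaleC [simp]: "norm (a *\<^sub>C x) = cmod a * norm x"
  by transfer (simp add: norm_mult power_mult_distrib real_sqrt_mult)

lemma cinner_commute: "cinner x y = cnj (cinner y x)"
  by transfer (simp add: mult.commute flip: Bochner_Integration.integral_cnj
        del: Bochner_Integration.integral_cnj)

lemma cinner_add_right: "cinner x (y + z) = cinner x y + cinner x z"
  by transfer (simp add: L2_eq_def distrib_left square_integrable_inner)

lemma cinner_diff_right: "cinner x (y - z) = cinner x y - cinner x z"
  by transfer (simp add: L2_eq_def right_diff_distrib square_integrable_inner)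

lemma cinner_add_left: "cinner (x + y) z = cinner x z + cinner y z"
  by transfer (simp add: L2_eq_def distrib_right square_integrable_inner)

lemma cinner_diff_left: "cinner (x - y) z = cinner x z - cinner y z"
  by transfer (simp add: L2_eq_def left_diff_distrib square_integrable_inner)

lemma cinner_scaleC_right: "cinner x (a *\<^sub>C y) = a * cinner x y"
  by transfer (simp add: mult.left_commute)

lemma cinner_scaleC_left: "cinner (a *\<^sub>C x) y = cnj a * cinner x y"
  by transfer (simp add: mult.assoc)

lemma inner_eq_Re_cinner: "inner x y = Re (cinner x y)"
  by (simp add: inner_L2_def)

lemma Im_cinner: "Im (cinner x y) = inner (\<i> *\<^sub>C x) y"
  by (simp add: inner_eq_Re_cinner cinner_scaleC_left)

lemma cinner_eq_inner: "cinner x y = Complex (inner x y) (inner (\<i> *\<^sub>C x) y)"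
  by (simp add: complex_eq_iff Im_cinner inner_eq_Re_cinner)

lemma cinner_self: "cinner x x = of_real ((norm x)\<^sup>2)"
proof -
  have "Im (cinner x x) = 0" using cinner_commute[of x x] by (simp add: complex_eq_iff)
  then show ?thesis by (simp add: complex_eq_iff power2_norm_eq_inner inner_eq_Re_cinner)
qed

lemma tendsto_cinner:
  assumes "(f \<longlongrightarrow> x) F" "(g \<longlongrightarrow> y) F"
  shows "((\<lambda>n. cinner (f n) (g n)) \<longlongrightarrow> cinner x y) F"
proof -
  have "((\<lambda>n. \<i> *\<^sub>C f n) \<longlongrightarrow> \<i> *\<^sub>C x) F"
    using assms(1) by (simp add: tendsto_iff dist_norm flip: scaleC_diff_right)
  then show ?thesis unfolding cinner_eq_inner
    by (intro tendsto_Complex tendsto_inner assms)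
qed

lemma tendsto_scaleC:
  assumes "(f \<longlongrightarrow> x) F" shows "((\<lambda>n. a *\<^sub>C f n) \<longlongrightarrow> a *\<^sub>C x) F"
proof -
  have "((\<lambda>n. cmod a * norm (f n - x)) \<longlongrightarrow> cmod a * 0) F"
    using assms by (intro tendsto_mult_left) (simp add: LIM_zero_iff tendsto_norm_zero_iff)
  then have "((\<lambda>n. norm (a *\<^sub>C f n - a *\<^sub>C x)) \<longlongrightarrow> 0) F"
    by (simp flip: scaleC_diff_right)
  then show ?thesis by (simp add: LIM_zero_iff tendsto_norm_zero_iff)
qed

text \<open>Rotating \<open>x\<close> by the phase of \<open>cinner x y\<close> makes the inner
  product real and nonnegative, which reduces the bound to the real Cauchy-Schwarz
  inequality.\<close>

lemma cmod_cinner_le: "cmod (cinner x y) \<le> norm x * norm y"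
proof (cases "cinner x y = 0")
  case False
  let ?a = "sgn (cinner x y)"
  have "inner (?a *\<^sub>C x) y = cmod (cinner x y)"
  proof -
    have "cnj (sgn w) * w = of_real (cmod w)" for w
      by (simp add: sgn_div_norm scaleR_conv_of_real divide_simps complex_norm_square[symmetric]
          mult.commute power2_eq_square flip: of_real_mult)
    then show ?thesis by (simp add: inner_eq_Re_cinner cinner_scaleC_left)
  qed
  moreover have "inner (?a *\<^sub>C x) y \<le> norm (?a *\<^sub>C x) * norm y" by (rule norm_cauchy_schwarz)
  ultimately show ?thesis using False by (simp add: norm_sgn)
qed simp

text \<open>The weights \<open>2^n\<close> below replace Minkowski's inequality for infinite sums.\<close>

lemma L2_AE_convergent:
  assumes sq: "\<And>n. square_integrable (f n)"
    and small: "\<And>n. norm (abs_L2 (f (Suc n)) - abs_L2 (f n)) \<le> (1/2) ^ n"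
  shows "AE t in lborel. convergent (\<lambda>n. f n t)"
proof -
  define h where "h n t = f (Suc n) t - f n t" for n t
  have h: "square_integrable (h n)" for n
    unfolding h_def by (intro square_integrable_diff sq)
  have [measurable]: "h n \<in> borel_measurable lborel" for n using h by (simp add: square_integrable_def)
  have nh: "(\<integral>\<^sup>+t. ennreal ((cmod (h n t))\<^sup>2) \<partial>lborel) \<le> ennreal ((1/4) ^ n)" for n
  proof -
    have "(norm (abs_L2 (h n)))\<^sup>2 \<le> ((1/2) ^ n)\<^sup>2"
    proof (intro power_mono)
      have "abs_L2 (f (Suc n)) - abs_L2 (f n) = abs_L2 (h n)"
        unfolding h_def[abs_def] by (rule abs_L2_diff[OF sq sq])
      then show "norm (abs_L2 (h n)) \<le> (1/2) ^ n" using small[of n] by simp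
    qed simp
    also have "\<dots> = (1/4) ^ n" by (simp add: power2_eq_square flip: power_mult_distrib)
    finally show ?thesis using nn_norm_abs_L2[OF h[of n]] by (metis ennreal_leI)
  qed
  have "(\<integral>\<^sup>+t. (\<Sum>n. ennreal (2 ^ n * (cmod (h n t))\<^sup>2)) \<partial>lborel)
      = (\<Sum>n. \<integral>\<^sup>+t. ennreal (2 ^ n * (cmod (h n t))\<^sup>2) \<partial>lborel)"
    by (rule nn_integral_suminf) simp
  also have "\<dots> \<le> (\<Sum>n. ennreal ((1/2) ^ n))"
  proof (rule suminf_le)
    fix n
    have "(\<integral>\<^sup>+t. ennreal (2 ^ n * (cmod (h n t))\<^sup>2) \<partial>lborel)
        = ennreal (2 ^ n) * (\<integral>\<^sup>+t. ennreal ((cmod (h n t))\<^sup>2) \<partial>lborel)"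
      by (subst nn_integral_cmult[symmetric]) (simp_all add: ennreal_mult)
    also have "\<dots> \<le> ennreal (2 ^ n) * ennreal ((1/4) ^ n)"
      using nh by (intro mult_left_mono) auto
    also have "\<dots> = ennreal ((1/2) ^ n)"
      by (simp flip: ennreal_mult power_mult_distrib)
    finally show "(\<integral>\<^sup>+t. ennreal (2 ^ n * (cmod (h n t))\<^sup>2) \<partial>lborel) \<le> ennreal ((1/2) ^ n)" .
  qed auto
  also have "\<dots> < \<infinity>"
    by (subst suminf_ennreal_eq[OF _ geometric_sums[of "1/2::real"]]) auto
  finally have fin: "(\<integral>\<^sup>+t. (\<Sum>n. ennreal (2 ^ n * (cmod (h n t))\<^sup>2)) \<partial>lborel) < \<infinity>" .
  have fin_AE: "AE t in lborel. (\<Sum>n. ennreal (2 ^ n * (cmod (h n t))\<^sup>2)) \<noteq> \<infinity>"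
  proof (rule nn_integral_PInf_AE)
    show "(\<integral>\<^sup>+t. (\<Sum>n. ennreal (2 ^ n * (cmod (h n t))\<^sup>2)) \<partial>lborel) \<noteq> \<infinity>"
      using fin by (rule less_imp_neq)
  qed measurable
  have term_le_suminf: "u n \<le> suminf u" for u :: "nat \<Rightarrow> ennreal" and n
    using sum_le_suminf[OF summableI, of "{n}" u] by simp
  from fin_AE show ?thesis
  proof eventually_elim
    fix t assume fin: "(\<Sum>n. ennreal (2 ^ n * (cmod (h n t))\<^sup>2)) \<noteq> \<infinity>"
    define K where "K = enn2real (\<Sum>n. ennreal (2 ^ n * (cmod (h n t))\<^sup>2))"
    have K: "(\<Sum>n. ennreal (2 ^ n * (cmod (h n t))\<^sup>2)) = ennreal K" "K \<ge> 0"
      using fin by (simp_all only: K_def ennreal_enn2real_if infinity_ennreal_def if_False enn2real_nonneg)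
    \<comment> \<open>Each term of the weighted sum is at most \<open>K\<close>, so the increments
      decay geometrically with ratio sqrt(1/2) and are absolutely summable.\<close>
    have "cmod (h n t) \<le> sqrt K * (sqrt (1/2)) ^ n" for n
    proof -
      have "ennreal (2 ^ n * (cmod (h n t))\<^sup>2) \<le> (\<Sum>n. ennreal (2 ^ n * (cmod (h n t))\<^sup>2))"
        by (rule term_le_suminf)
      then have "2 ^ n * (cmod (h n t))\<^sup>2 \<le> K" unfolding K(1) by (simp only: ennreal_le_iff[OF K(2)])
      then have "(cmod (h n t))\<^sup>2 \<le> K * (1/2) ^ n" by (simp add: power_divide field_simps)
      then have "sqrt ((cmod (h n t))\<^sup>2) \<le> sqrt (K * (1/2) ^ n)" by (rule real_sqrt_le_mono)
      then show ?thesis by (simp add: real_sqrt_mult real_sqrt_power)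
    qed
    moreover have "summable (\<lambda>n. sqrt K * (sqrt (1/2)) ^ n)"
      by (intro summable_mult summable_geometric) (simp add: real_sqrt_divide)
    ultimately have "summable (\<lambda>n. h n t)"
      by (rule summable_comparison_test'[rotated])
    then have "convergent (\<lambda>n. \<Sum>i<n. h i t)" by (simp add: summable_iff_convergent)
    then have "convergent (\<lambda>n. f n t - f 0 t)" 
      using sum_lessThan_telescope[of "\<lambda>n. f n t"] by (simp add: h_def)
    then have "convergent (\<lambda>n. (f n t - f 0 t) + f 0 t)" by (intro convergent_add convergent_const)
    then show "convergent (\<lambda>n. f n t)" by simp
  qed
qed

text \<open>Riesz-Fischer: a subsequence with geometrically small steps converges almost everywhere,
  and Fatou's lemma turns the pointwise limit into a limit in norm.\<close>

instance L2 :: complete_space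
proof
  fix X :: "nat \<Rightarrow> L2" assume X: "Cauchy X"
  have "\<exists>r. strict_mono r \<and> (\<forall>n. dist (X (r (Suc n))) (X (r n)) \<le> (1/2) ^ n)"
  proof -
    have "\<exists>M. \<forall>m\<ge>M. \<forall>n\<ge>M. dist (X m) (X n) < (1/2) ^ k" for k
      using X by (simp add: Cauchy_def)
    then obtain M where M: "\<And>k m n. m \<ge> M k \<Longrightarrow> n \<ge> M k \<Longrightarrow> dist (X m) (X n) < (1/2) ^ k" by metis
    \<comment> \<open>The sum dominates \<open>M k\<close>, and the summand \<open>k\<close> makes
      \<open>r\<close> strictly increasing.\<close>
    define r where "r k = (\<Sum>i\<le>k. M i) + k" for k
    have r: "M k \<le> r k" for k
      unfolding r_def using member_le_sum[of k "{..k}" M] by simp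
    have "strict_mono r" by (simp add: strict_mono_Suc_iff r_def)
    moreover have "dist (X (r (Suc n))) (X (r n)) \<le> (1/2) ^ n" for n
      using M[of n "r (Suc n)" "r n"] r[of n] \<open>strict_mono r\<close>
      by (meson less_imp_le order_trans strict_mono_less_eq le_SucI order_refl)
    ultimately show ?thesis by blast
  qed
  then obtain r where r: "strict_mono r" "\<And>n. norm (X (r (Suc n)) - X (r n)) \<le> (1/2) ^ n"
    by (auto simp: dist_norm)
  define f where "f n = rep_L2 (X (r n))" for n
  have sq: "square_integrable (f n)" and Xf: "abs_L2 (f n) = X (r n)" for n by (auto simp: f_def)
  have [measurable]: "f n \<in> borel_measurable lborel" for n using sq by (simp add: square_integrable_def)
  have conv: "AE t in lborel. convergent (\<lambda>n. f n t)"
    by (rule L2_AE_convergent[OF sq]) (simp add: Xf r)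
  define g where "g t = lim (\<lambda>n. f n t)" for t
  have [measurable]: "g \<in> borel_measurable lborel"
    unfolding g_def by (rule borel_measurable_lim_metric) simp
  have XC: "Cauchy (X \<circ> r)" using X r(1) by (rule Cauchy_subseq_Cauchy)
  have close: "\<exists>N. \<forall>n\<ge>N. (\<integral>\<^sup>+t. ennreal ((cmod (g t - f n t))\<^sup>2) \<partial>lborel) \<le> ennreal (e\<^sup>2)"
    if e: "e > 0" for e :: real
  proof -
    obtain N where N: "\<And>m n. m \<ge> N \<Longrightarrow> n \<ge> N \<Longrightarrow> norm (X (r m) - X (r n)) < e"
    proof -
      have "\<exists>N. \<forall>m\<ge>N. \<forall>n\<ge>N. dist ((X \<circ> r) m) ((X \<circ> r) n) < e"
        using XC e unfolding Cauchy_def by blast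
      then show ?thesis using that by (auto simp: dist_norm)
    qed
    have "(\<integral>\<^sup>+t. ennreal ((cmod (g t - f n t))\<^sup>2) \<partial>lborel) \<le> ennreal (e\<^sup>2)" if n: "n \<ge> N" for n
    proof -
      have "(\<integral>\<^sup>+t. ennreal ((cmod (g t - f n t))\<^sup>2) \<partial>lborel)
          = (\<integral>\<^sup>+t. liminf (\<lambda>m. ennreal ((cmod (f m t - f n t))\<^sup>2)) \<partial>lborel)"
      proof (rule nn_integral_cong_AE)
        show "AE t in lborel. ennreal ((cmod (g t - f n t))\<^sup>2)
            = liminf (\<lambda>m. ennreal ((cmod (f m t - f n t))\<^sup>2))"
          using conv
        proof eventually_elim
          fix t assume "convergent (\<lambda>n. f n t)"
          then have "(\<lambda>m. f m t) \<longlonglongrightarrow> g t" by (simp add: convergent_LIMSEQ_iff g_def)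
          then have "(\<lambda>m. ennreal ((cmod (f m t - f n t))\<^sup>2)) \<longlonglongrightarrow> ennreal ((cmod (g t - f n t))\<^sup>2)"
            by (intro tendsto_intros)
          then show "ennreal ((cmod (g t - f n t))\<^sup>2)
              = liminf (\<lambda>m. ennreal ((cmod (f m t - f n t))\<^sup>2))"
            by (intro lim_imp_Liminf[symmetric]) auto
        qed
      qed
      \<comment> \<open>Fatou's lemma, by which the Cauchy bound in \<open>m\<close> passes to the
        limit \<open>g\<close>.\<close>
      also have "\<dots> \<le> liminf (\<lambda>m. \<integral>\<^sup>+t. ennreal ((cmod (f m t - f n t))\<^sup>2) \<partial>lborel)"
        by (rule nn_integral_liminf) simp
      also have "\<dots> \<le> ennreal (e\<^sup>2)"
      proof (rule Liminf_le)
        show "\<forall>\<^sub>F m in sequentially. (\<integral>\<^sup>+t. ennreal ((cmod (f m t - f n t))\<^sup>2) \<partial>lborel) \<le> ennreal (e\<^sup>2)"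
          using eventually_ge_at_top[of N]
        proof eventually_elim
          fix m assume "m \<ge> N"
          then have "(norm (X (r m) - X (r n)))\<^sup>2 \<le> e\<^sup>2"
            using N[OF _ n, of m] by (intro power_mono) auto
          moreover have "X (r m) - X (r n) = abs_L2 (\<lambda>t. f m t - f n t)"
            unfolding Xf[symmetric] using sq by (simp add: abs_L2_diff)
          ultimately show "(\<integral>\<^sup>+t. ennreal ((cmod (f m t - f n t))\<^sup>2) \<partial>lborel) \<le> ennreal (e\<^sup>2)"
            using nn_norm_abs_L2[OF square_integrable_diff[OF sq sq], of m n] by (metis ennreal_leI)
        qed
      qed simp
      finally show ?thesis .
    qed
    then show ?thesis by blast
  qed
  obtain N where "(\<integral>\<^sup>+t. ennreal ((cmod (g t - f N t))\<^sup>2) \<partial>lborel) \<le> ennreal (1\<^sup>2)"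
    using close[of 1] by auto
  then have "square_integrable (\<lambda>t. g t - f N t)"
    by (intro square_integrableI) (auto intro: le_less_trans)
  from square_integrable_add[OF this sq[of N]] have g: "square_integrable g" by simp
  have "(X \<circ> r) \<longlonglongrightarrow> abs_L2 g"
  proof (rule metric_LIMSEQ_I)
    fix e :: real assume "e > 0"
    then obtain N where N: "\<And>n. n \<ge> N \<Longrightarrow> (\<integral>\<^sup>+t. ennreal ((cmod (g t - f n t))\<^sup>2) \<partial>lborel) \<le> ennreal ((e/2)\<^sup>2)"
      using close[of "e/2"] by auto
    have "dist ((X \<circ> r) n) (abs_L2 g) < e" if "n \<ge> N" for n
    proof -
      have "abs_L2 g - X (r n) = abs_L2 (\<lambda>t. g t - f n t)"
        unfolding Xf[symmetric] using sq g by (simp add: abs_L2_diff)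
      then have "ennreal ((norm (abs_L2 g - X (r n)))\<^sup>2) \<le> ennreal ((e/2)\<^sup>2)"
        using N[OF that] nn_norm_abs_L2[OF square_integrable_diff[OF g sq], of n] by simp
      then have "(norm (abs_L2 g - X (r n)))\<^sup>2 \<le> (e/2)\<^sup>2" by simp
      then have "norm (abs_L2 g - X (r n)) \<le> e/2" using \<open>e > 0\<close> by (simp add: power2_le_iff_abs_le)
      then show ?thesis using \<open>e > 0\<close> by (simp add: dist_norm norm_minus_commute)
    qed
    then show "\<exists>N. \<forall>n\<ge>N. dist ((X \<circ> r) n) (abs_L2 g) < e" by blast
  qed
  then show "convergent X"
    using Cauchy_converges_subseq[OF X r(1)] by (auto simp: convergent_def o_def)
qed

text \<open>The projection theorem: a minimising sequence for the distance from an outside point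
  \<open>x\<close> converges to a nearest point \<open>p\<close>, and \<open>x - p\<close> is
  orthogonal to \<open>S\<close>.\<close>

lemma closed_subspace_orthogonal_exists:
  fixes S :: "'a::{real_inner,complete_space} set"
  assumes "subspace S" "closed S" "S \<noteq> UNIV"
  shows "\<exists>y. y \<noteq> 0 \<and> (\<forall>x\<in>S. inner y x = 0)"
proof -
  obtain x where x: "x \<notin> S" using assms by auto
  have ne: "S \<noteq> {}" using subspace_0[OF assms(1)] by auto
  define d where "d = infdist x S"
  have d0: "d > 0" using infdist_pos_not_in_closed[OF assms(2) ne x] by (simp add: d_def)
  have dle: "d \<le> norm (x - s)" if "s \<in> S" for s
    using infdist_le[OF that, of x] by (simp add: d_def dist_norm)
  have "\<exists>s\<in>S. norm (x - s) < d + inverse (real (Suc n))" for n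
  proof (rule ccontr)
    assume "\<not> ?thesis"
    then have "d + inverse (real (Suc n)) \<le> dist x s" if "s \<in> S" for s
      using that by (auto simp: dist_norm not_less)
    then have "d + inverse (real (Suc n)) \<le> infdist x S"
      using ne by (simp add: infdist_notempty cINF_greatest)
    moreover have "inverse (real (Suc n)) > 0" by simp
    ultimately show False unfolding d_def by linarith
  qed
  then obtain s where s: "\<And>n. s n \<in> S" "\<And>n. norm (x - s n) < d + inverse (real (Suc n))" by metis
  have lim: "(\<lambda>n. d + inverse (real (Suc n))) \<longlonglongrightarrow> d"
    using tendsto_add[OF tendsto_const LIMSEQ_inverse_real_of_nat, of d] by simp
  have par: "(norm (s m - s n))\<^sup>2 \<le> 2 * (norm (x - s m))\<^sup>2 + 2 * (norm (x - s n))\<^sup>2 - 4 * d\<^sup>2" for m n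
  proof -
    \<comment> \<open>The midpoint lies in \<open>S\<close>, so its distance to \<open>x\<close> is
      at least \<open>d\<close>; with the parallelogram law this makes the minimising sequence
      Cauchy.\<close>
    let ?c = "(1/2::real) *\<^sub>R (s m + s n)"
    have "?c \<in> S" using s assms(1) by (simp add: subspace_add subspace_scale del: scaleR_add_right)
    then have "d\<^sup>2 \<le> (norm (x - ?c))\<^sup>2" using dle d0 by (intro power_mono) auto
    moreover have "(norm (s m - s n))\<^sup>2
        = 2 * (norm (x - s m))\<^sup>2 + 2 * (norm (x - s n))\<^sup>2 - 4 * (norm (x - ?c))\<^sup>2"
      by (simp add: power2_norm_eq_inner inner_diff inner_add inner_commute algebra_simps)
    ultimately show ?thesis by simp
  qed
  have "Cauchy s"
  proof (rule metric_CauchyI)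
    fix e :: real assume e: "e > 0"
    have "(\<lambda>n. 4 * (d + inverse (real (Suc n)))\<^sup>2 - 4 * d\<^sup>2) \<longlonglongrightarrow> 4 * d\<^sup>2 - 4 * d\<^sup>2"
      by (intro tendsto_intros lim)
    then have "\<forall>\<^sub>F n in sequentially. 4 * (d + inverse (real (Suc n)))\<^sup>2 - 4 * d\<^sup>2 < e\<^sup>2"
      using e by (intro order_tendstoD(2)) auto
    then obtain N where N: "4 * (d + inverse (real (Suc N)))\<^sup>2 - 4 * d\<^sup>2 < e\<^sup>2"
      by (auto simp: eventually_sequentially)
    have "dist (s m) (s n) < e" if "m \<ge> N" "n \<ge> N" for m n
    proof -
      have "(norm (x - s k))\<^sup>2 \<le> (d + inverse (real (Suc N)))\<^sup>2" if "k \<ge> N" for k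
      proof (intro power_mono)
        have "inverse (real (Suc k)) \<le> inverse (real (Suc N))" using that by (intro le_imp_inverse_le) auto
        then show "norm (x - s k) \<le> d + inverse (real (Suc N))" using s(2)[of k] by linarith
      qed simp
      from this[OF that(1)] this[OF that(2)] have "(norm (s m - s n))\<^sup>2 < e\<^sup>2"
        using par[of m n] N by linarith
      then show ?thesis using e by (simp add: dist_norm power2_less_imp_less)
    qed
    then show "\<exists>M. \<forall>m\<ge>M. \<forall>n\<ge>M. dist (s m) (s n) < e" by blast
  qed
  then obtain p where p: "s \<longlonglongrightarrow> p" by (auto simp: Cauchy_convergent_iff convergent_def)
  have pS: "p \<in> S" using closed_sequentially[OF assms(2) s(1) p] .
  have "(\<lambda>n. norm (x - s n)) \<longlonglongrightarrow> norm (x - p)" by (intro tendsto_intros p)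
  then have "norm (x - p) \<le> d" using s(2)
    by (intro LIMSEQ_le[OF _ lim]) (auto intro!: exI[of _ 0] less_imp_le)
  then have nd: "norm (x - p) = d" using dle[OF pS] by simp
  have "inner (x - p) w = 0" if w: "w \<in> S" for w
  proof (cases "w = 0")
    case False
    then have w0: "inner w w > 0" by simp
    \<comment> \<open>The parameter at which the distance from \<open>x - p\<close> to the line
      through \<open>w\<close> is least.\<close>
    let ?t = "inner (x - p) w / inner w w"
    have "p + ?t *\<^sub>R w \<in> S" using pS w assms(1) by (simp add: subspace_add subspace_scale)
    then have "d\<^sup>2 \<le> (norm (x - (p + ?t *\<^sub>R w)))\<^sup>2" using dle d0 by (intro power_mono) auto
    also have "\<dots> = (norm (x - p - ?t *\<^sub>R w))\<^sup>2" by (simp add: diff_diff_eq)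
    also have "\<dots> = d\<^sup>2 - 2 * ?t * inner (x - p) w + ?t * ?t * inner w w"
      unfolding nd[symmetric] power2_norm_eq_inner inner_diff_left[of "x - p"] inner_diff_right[of _ "x - p"]
      by (simp add: inner_commute[of w "x - p"])
    also have "\<dots> = d\<^sup>2 - (inner (x - p) w)\<^sup>2 / inner w w"
      using w0 by (simp add: power2_eq_square)
    finally have "(inner (x - p) w)\<^sup>2 / inner w w \<le> 0" by simp
    then show ?thesis using w0 by (simp add: divide_le_0_iff)
  qed simp
  then show ?thesis using nd d0 by (intro exI[of _ "x - p"]) auto
qed

section \<open>Commuting self-adjoint operators\<close>

lemma dense_cinner_eq_zero:
  assumes "closure S = UNIV" "\<And>x. x \<in> S \<Longrightarrow> cinner z x = 0"
  shows "z = 0"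
proof -
  obtain f where f: "\<And>n. f n \<in> S" "f \<longlonglongrightarrow> z"
    using assms(1) closure_sequential[of z S] by auto
  have "(\<lambda>n. cinner z (f n)) \<longlonglongrightarrow> cinner z z" by (intro tendsto_cinner f tendsto_const)
  then have "(\<lambda>n. 0) \<longlonglongrightarrow> cinner z z" using assms(2)[OF f(1)] by simp
  then have "cinner z z = 0" by (simp add: LIMSEQ_const_iff)
  then show ?thesis by (simp add: cinner_self)
qed

section \<open>Domain, graph and resolvents of a single self-adjoint operator\<close>

locale selfadjoint =
  fixes h :: L2_op
  assumes sa: "selfadjoint_op h"
begin

abbreviation ap :: "L2 \<Rightarrow> L2" where "ap x \<equiv> the (h x)"

lemma dense: "closure (dom h) = UNIV"
  using sa by (simp add: selfadjoint_op_def)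

lemma zero_dom: "0 \<in> dom h"
  using sa by (simp add: selfadjoint_op_def linear_op_def)

lemma
  assumes "x \<in> dom h" "y \<in> dom h"
  shows add_dom: "x + y \<in> dom h" and ap_add: "ap (x + y) = ap x + ap y"
proof -
  have "h (x + y) = Some (ap x + ap y)"
    using sa assms unfolding selfadjoint_op_def linear_op_def by blast
  then show "x + y \<in> dom h" "ap (x + y) = ap x + ap y" by auto
qed

lemma
  assumes "x \<in> dom h"
  shows scale_dom: "c *\<^sub>C x \<in> dom h" and ap_scale: "ap (c *\<^sub>C x) = c *\<^sub>C ap x"
proof -
  have "h (c *\<^sub>C x) = Some (c *\<^sub>C ap x)"
    using sa assms unfolding selfadjoint_op_def linear_op_def by blast
  then show "c *\<^sub>C x \<in> dom h" "ap (c *\<^sub>C x) = c *\<^sub>C ap x" by auto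
qed

lemma
  assumes "x \<in> dom h" "y \<in> dom h"
  shows diff_dom: "x - y \<in> dom h" and ap_diff: "ap (x - y) = ap x - ap y"
proof -
  have *: "x - y = x + (- 1) *\<^sub>C y" by (simp add: scaleC_minus_left)
  show "x - y \<in> dom h" unfolding * by (intro add_dom scale_dom assms)
  show "ap (x - y) = ap x - ap y"
    unfolding * ap_add[OF assms(1) scale_dom[OF assms(2)]] ap_scale[OF assms(2)]
    by (simp add: scaleC_minus_left)
qed

lemma adjoint_unique:
  assumes "\<forall>x\<in>dom h. cinner y (ap x) = cinner z x" "\<forall>x\<in>dom h. cinner y (ap x) = cinner z' x"
  shows "z = z'"
proof -
  have "z - z' = 0"
    by (rule dense_cinner_eq_zero[OF dense]) (use assms in \<open>simp add: cinner_diff_left\<close>)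
  then show ?thesis by simp
qed

text \<open>The inclusion of the adjoint in \<open>h\<close>, which a merely symmetric operator
  lacks. Density of the domain makes the description in \<open>adjoint_op\<close> unique.\<close>

lemma domI:
  assumes "\<And>x. x \<in> dom h \<Longrightarrow> cinner y (ap x) = cinner z x"
  shows "y \<in> dom h" "ap y = z"
proof -
  have "(THE z. \<forall>x\<in>dom h. cinner y (ap x) = cinner z x) = z"
    using assms adjoint_unique[of y] by (intro the_equality) auto
  then have "adjoint_op h y = Some z"
    using assms unfolding adjoint_op_def by auto
  then have "h y = Some z" using sa by (simp add: selfadjoint_op_def)
  then show "y \<in> dom h" "ap y = z" by auto
qed

text \<open>The opposite inclusion, of \<open>h\<close> in its adjoint.\<close>

lemma symmetric:
  assumes "x \<in> dom h" "y \<in> dom h"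
  shows "cinner (ap x) y = cinner x (ap y)"
proof -
  have "adjoint_op h = h" using sa by (simp add: selfadjoint_op_def)
  then have "adjoint_op h x \<noteq> None" using assms by (auto simp: dom_def)
  then obtain z where z: "\<forall>y\<in>dom h. cinner x (ap y) = cinner z y"
    unfolding adjoint_op_def by (auto split: if_splits)
  then have "ap x = z" using domI[of x z] by auto
  then show ?thesis using z assms by simp
qed

text \<open>The symmetry relation survives limits in its first argument, and \<open>domI\<close>
  then identifies the limit.\<close>

lemma closed_graph:
  assumes "\<And>n. f n \<in> dom h" "f \<longlonglongrightarrow> x" "(\<lambda>n. ap (f n)) \<longlonglongrightarrow> y"
  shows "x \<in> dom h" "ap x = y"
proof -
  have *: "cinner x (ap w) = cinner y w" if "w \<in> dom h" for w
  proof -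
    have "(\<lambda>n. cinner (f n) (ap w)) \<longlonglongrightarrow> cinner x (ap w)"
      by (intro tendsto_cinner assms tendsto_const)
    moreover have "(\<lambda>n. cinner (f n) (ap w)) \<longlonglongrightarrow> cinner y w"
      unfolding symmetric[OF assms(1) that, symmetric] by (intro tendsto_cinner assms tendsto_const)
    ultimately show ?thesis by (rule LIMSEQ_unique)
  qed
  show "x \<in> dom h" "ap x = y" using domI[OF *] by blast+
qed

text \<open>Since <x, h x> is real, only \<open>z\<close> contributes to the imaginary part of <x,
  (h - z) x>; the rest is Cauchy-Schwarz.\<close>

lemma shift_bounded_below:
  assumes "x \<in> dom h"
  shows "\<bar>Im z\<bar> * norm x \<le> norm (ap x - z *\<^sub>C x)"
proof (cases "x = 0")
  case False
  have "cnj (cinner x (ap x)) = cinner x (ap x)"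
    using symmetric[OF assms assms] by (simp flip: cinner_commute)
  then have "Im (cinner x (ap x)) = 0" by (simp add: complex_eq_iff)
  then have "Im (cinner x (ap x - z *\<^sub>C x)) = - Im z * (norm x)\<^sup>2"
    by (simp add: cinner_diff_right cinner_scaleC_right cinner_self)
  then have "\<bar>Im z\<bar> * (norm x)\<^sup>2 = \<bar>Im (cinner x (ap x - z *\<^sub>C x))\<bar>" by (simp add: abs_mult)
  also have "\<dots> \<le> norm x * norm (ap x - z *\<^sub>C x)"
    using abs_Im_le_cmod cmod_cinner_le by (meson order_trans)
  finally show ?thesis using False by (simp add: power2_eq_square mult.assoc[symmetric])
qed simp

text \<open>The range of h - z is closed by the lower bound and the closed graph. A vector
  orthogonal to it is, by \<open>domI\<close>, an eigenvector of \<open>h\<close> for the conjugate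
  of \<open>z\<close>, hence 0 by the same lower bound.\<close>

lemma surj_shift:
  assumes z: "Im z \<noteq> 0"
  shows "\<exists>x\<in>dom h. ap x - z *\<^sub>C x = y"
proof -
  define S where "S = (\<lambda>x. ap x - z *\<^sub>C x) ` dom h"
  have "subspace S"
    unfolding subspace_def
  proof (intro conjI allI ballI)
    have "ap 0 = 0" using ap_diff[OF zero_dom zero_dom] by simp
    then show "0 \<in> S" unfolding S_def using zero_dom by force
  next
    fix u v assume "u \<in> S" "v \<in> S"
    then obtain x y where "x \<in> dom h" "y \<in> dom h" "u = ap x - z *\<^sub>C x" "v = ap y - z *\<^sub>C y"
      by (auto simp: S_def)
    then show "u + v \<in> S" unfolding S_def
      by (intro image_eqI[of _ _ "x + y"]) (auto simp: ap_add scaleC_add_right add_dom)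
  next
    fix c :: real and u assume "u \<in> S"
    then obtain x where "x \<in> dom h" "u = ap x - z *\<^sub>C x" by (auto simp: S_def)
    then show "c *\<^sub>R u \<in> S" unfolding S_def scaleR_scaleC
      by (intro image_eqI[of _ _ "of_real c *\<^sub>C x"])
         (simp_all add: ap_scale scaleC_diff_right scaleC_scaleC mult.commute scale_dom)
  qed
  moreover have "closed S"
    unfolding closed_sequential_limits
  proof (intro allI impI, elim conjE)
    fix u l assume u: "\<forall>n. u n \<in> S" and l: "u \<longlonglongrightarrow> l"
    then obtain x where x: "\<And>n. x n \<in> dom h" "\<And>n. u n = ap (x n) - z *\<^sub>C x n"
      unfolding S_def image_iff by metis
    have le: "\<bar>Im z\<bar> * norm (x m - x n) \<le> norm (u m - u n)" for m n
    proof -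
      have "u m - u n = ap (x m - x n) - z *\<^sub>C (x m - x n)"
        using x by (simp add: ap_diff scaleC_diff_right)
      then show ?thesis using shift_bounded_below[OF diff_dom[OF x(1) x(1)]] by simp
    qed
    have "Cauchy x"
    proof (rule metric_CauchyI)
      fix e :: real assume "e > 0"
      then have "\<bar>Im z\<bar> * e > 0" using z by simp
      then obtain N where N: "\<And>m n. m \<ge> N \<Longrightarrow> n \<ge> N \<Longrightarrow> norm (u m - u n) < \<bar>Im z\<bar> * e"
        using LIMSEQ_imp_Cauchy[OF l] unfolding Cauchy_def dist_norm by meson
      have "norm (x m - x n) < e" if "m \<ge> N" "n \<ge> N" for m n
      proof -
        have "\<bar>Im z\<bar> * norm (x m - x n) < \<bar>Im z\<bar> * e" using le[of m n] N[OF that] by linarith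
        then show ?thesis using z by simp
      qed
      then show "\<exists>M. \<forall>m\<ge>M. \<forall>n\<ge>M. dist (x m) (x n) < e" by (auto simp: dist_norm)
    qed
    then obtain p where p: "x \<longlonglongrightarrow> p" by (auto simp: Cauchy_convergent_iff convergent_def)
    have "(\<lambda>n. u n + z *\<^sub>C x n) \<longlonglongrightarrow> l + z *\<^sub>C p" by (intro tendsto_add l tendsto_scaleC p)
    then have "(\<lambda>n. ap (x n)) \<longlonglongrightarrow> l + z *\<^sub>C p" by (simp add: x(2))
    from closed_graph[OF x(1) p this] have "p \<in> dom h" "ap p - z *\<^sub>C p = l" by auto
    then show "l \<in> S" by (auto simp: S_def)
  qed
  moreover have "w = 0" if w: "\<forall>v\<in>S. inner w v = 0" for w
  proof -
    have *: "cinner w (ap x) = cinner (cnj z *\<^sub>C w) x" if x: "x \<in> dom h" for x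
    proof -
      have "inner w (ap x - z *\<^sub>C x) = 0" using w x by (auto simp: S_def)
      \<comment> \<open>Testing with the multiple of \<open>x\<close> by the imaginary unit upgrades
        real orthogonality to complex orthogonality.\<close>
      moreover have "inner w (ap (\<i> *\<^sub>C x) - z *\<^sub>C (\<i> *\<^sub>C x)) = 0"
        using w scale_dom[OF x] by (auto simp: S_def)
      then have "inner w (\<i> *\<^sub>C (ap x - z *\<^sub>C x)) = 0"
        by (simp add: ap_scale[OF x] scaleC_diff_right scaleC_scaleC mult.commute)
      ultimately have "cinner w (ap x - z *\<^sub>C x) = 0"
        by (simp add: inner_eq_Re_cinner cinner_scaleC_right complex_eq_iff)
      then show ?thesis by (simp add: cinner_diff_right cinner_scaleC_right cinner_scaleC_left)
    qed
    from domI[OF *] have "w \<in> dom h" "ap w = cnj z *\<^sub>C w" by auto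
    then have "\<bar>Im z\<bar> * norm w \<le> 0" using shift_bounded_below[of w "cnj z"] by simp
    then show ?thesis using z by (simp add: mult_le_0_iff)
  qed
  ultimately have "S = UNIV" using closed_subspace_orthogonal_exists[of S] by blast
  then have "y \<in> S" by simp
  then show ?thesis by (auto simp: S_def)
qed

lemma resolvent_eqI:
  assumes "Im z \<noteq> 0" "x \<in> dom h" "ap x - z *\<^sub>C x = y"
  shows "resolvent h z y = x"
  unfolding resolvent_def
proof (rule the_equality)
  fix x' assume x': "x' \<in> dom h \<and> ap x' - z *\<^sub>C x' = y"
  then have "ap (x' - x) - z *\<^sub>C (x' - x) = 0"
    using assms by (simp add: ap_diff scaleC_diff_right algebra_simps)
  then have "\<bar>Im z\<bar> * norm (x' - x) \<le> 0"
    using shift_bounded_below[OF diff_dom[of x' x], of z] x' assms by simp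
  then show "x' = x" using assms(1) by (simp add: mult_le_0_iff)
qed (use assms in auto)

lemma
  assumes "Im z \<noteq> 0"
  shows resolvent_dom: "resolvent h z y \<in> dom h"
    and ap_resolvent: "ap (resolvent h z y) = y + z *\<^sub>C resolvent h z y"
proof -
  obtain x where "x \<in> dom h" "ap x - z *\<^sub>C x = y" using surj_shift[OF assms] by blast
  then show "resolvent h z y \<in> dom h" "ap (resolvent h z y) = y + z *\<^sub>C resolvent h z y"
    using resolvent_eqI[OF assms] by force+
qed

lemma norm_resolvent_le:
  assumes "Im z \<noteq> 0"
  shows "\<bar>Im z\<bar> * norm (resolvent h z y) \<le> norm y"
  using shift_bounded_below[OF resolvent_dom[OF assms], of z y] by (simp add: ap_resolvent[OF assms])

lemma resolvent_diff:
  assumes "Im z \<noteq> 0"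
  shows "resolvent h z (x - y) = resolvent h z x - resolvent h z y"
  using assms
  by (intro resolvent_eqI) (auto simp: resolvent_dom diff_dom ap_diff ap_resolvent scaleC_diff_right)

lemma resolvent_scale:
  assumes "Im z \<noteq> 0"
  shows "resolvent h z (c *\<^sub>C x) = c *\<^sub>C resolvent h z x"
  using assms
  by (intro resolvent_eqI)
     (auto simp: resolvent_dom scale_dom ap_scale ap_resolvent scaleC_scaleC scaleC_add_right mult.commute)

lemma resolvent_ap:
  assumes "Im z \<noteq> 0" "x \<in> dom h"
  shows "resolvent h z (ap x) = x + z *\<^sub>C resolvent h z x"
proof -
  have "resolvent h z (ap x - z *\<^sub>C x) = x" using assms by (intro resolvent_eqI) auto
  then show ?thesis using assms by (simp add: resolvent_diff resolvent_scale algebra_simps)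
qed

lemma resolvent_adjoint:
  assumes "Im z \<noteq> 0"
  shows "cinner (resolvent h z x) y = cinner x (resolvent h (cnj z) y)"
proof -
  let ?a = "resolvent h z x" and ?b = "resolvent h (cnj z) y"
  have z': "Im (cnj z) \<noteq> 0" using assms by simp
  have "cinner ?a (ap ?b) = cinner (ap ?a) ?b"
    using symmetric resolvent_dom[OF assms] resolvent_dom[OF z'] by simp
  then show ?thesis
    unfolding ap_resolvent[OF assms] ap_resolvent[OF z']
    by (simp add: cinner_add_left cinner_add_right cinner_scaleC_left cinner_scaleC_right)
qed

text \<open>For large r the operator h - i s r is dominated by - i s r, whose inverse times r is i s
  because s^2 = 1. The operators r (h - i s r)^(-1) have norm at most 1, so convergence on the dense
  domain suffices.\<close>

lemma tendsto_resolvent: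
  fixes s :: real
  assumes s: "\<bar>s\<bar> = 1"
  shows "((\<lambda>r::real. of_real r *\<^sub>C resolvent h (\<i> * of_real (s * r)) y) \<longlongrightarrow> (\<i> * of_real s) *\<^sub>C y) at_top"
proof (rule tendstoI)
  fix e :: real assume e: "e > 0"
  have "y \<in> closure (dom h)" using dense by simp
  then obtain x where x: "x \<in> dom h" "norm (y - x) < e / 4"
    using e unfolding closure_approachable dist_norm
    by (metis norm_minus_commute zero_less_divide_iff zero_less_numeral)
  have "((\<lambda>r. norm (ap x) / r) \<longlongrightarrow> 0) at_top"
    by (intro tendsto_divide_0[OF tendsto_const] filterlim_at_top_imp_at_infinity filterlim_ident)
  then have "\<forall>\<^sub>F r in at_top. norm (ap x) / r < e / 2" using e by (intro order_tendstoD(2)) auto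
  then show "\<forall>\<^sub>F r::real in at_top.
      dist (of_real r *\<^sub>C resolvent h (\<i> * of_real (s * r)) y) ((\<i> * of_real s) *\<^sub>C y) < e"
    using eventually_gt_at_top[of 0]
  proof eventually_elim
    fix r :: real assume r: "norm (ap x) / r < e / 2" "r > 0"
    let ?R = "resolvent h (\<i> * of_real (s * r))"
    have I: "Im (\<i> * complex_of_real (s * r)) \<noteq> 0" using r s by auto
    have R: "r * norm (?R v) \<le> norm v" for v
      using norm_resolvent_le[OF I, of v] r s by (simp add: abs_mult)
    have ss: "complex_of_real s * complex_of_real s = 1"
      using s by (metis abs_mult_self_eq mult_1 of_real_1 of_real_mult)
    have "(\<i> * of_real s) *\<^sub>C ?R (ap x)
        = (\<i> * of_real s) *\<^sub>C x + (\<i> * of_real s * (\<i> * of_real (s * r))) *\<^sub>C ?R x"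
      unfolding resolvent_ap[OF I x(1)] by (simp only: scaleC_add_right scaleC_scaleC)
    also have "\<i> * of_real s * (\<i> * of_real (s * r)) = - complex_of_real r"
      using ss by (simp add: algebra_simps)
    finally have "(\<i> * of_real s) *\<^sub>C ?R (ap x) = (\<i> * of_real s) *\<^sub>C x - of_real r *\<^sub>C ?R x"
      by (simp add: scaleC_minus_left)
    then have "of_real r *\<^sub>C ?R y - (\<i> * of_real s) *\<^sub>C y
        = of_real r *\<^sub>C ?R (y - x) - (\<i> * of_real s) *\<^sub>C (y - x) - (\<i> * of_real s) *\<^sub>C ?R (ap x)"
      unfolding resolvent_diff[OF I] by (simp add: scaleC_diff_right)
    then have "norm (of_real r *\<^sub>C ?R y - (\<i> * of_real s) *\<^sub>C y)
        \<le> norm (of_real r *\<^sub>C ?R (y - x)) + norm ((\<i> * of_real s) *\<^sub>C (y - x))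
          + norm ((\<i> * of_real s) *\<^sub>C ?R (ap x))"
      using norm_triangle_ineq4[of "of_real r *\<^sub>C ?R (y - x) - (\<i> * of_real s) *\<^sub>C (y - x)"
          "(\<i> * of_real s) *\<^sub>C ?R (ap x)"]
        norm_triangle_ineq4[of "of_real r *\<^sub>C ?R (y - x)" "(\<i> * of_real s) *\<^sub>C (y - x)"]
      by simp
    also have "\<dots> = r * norm (?R (y - x)) + norm (y - x) + norm (?R (ap x))"
      using s r by (simp add: norm_mult)
    also have "r * norm (?R (y - x)) \<le> norm (y - x)" by (rule R)
    also have "norm (?R (ap x)) \<le> norm (ap x) / r"
      using R[of "ap x"] r by (simp add: field_simps)
    finally show "dist (of_real r *\<^sub>C ?R y) ((\<i> * of_real s) *\<^sub>C y) < e"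
      unfolding dist_norm using x(2) r by linarith
  qed
qed

end

text \<open>Writing \<open>x\<close> as a resolvent of \<open>h2\<close> applied to some
  \<open>u\<close>, commutation of the resolvents displays \<open>resolvent h1 z x\<close> as a
  value of a resolvent of \<open>h2\<close>, which lies in the domain of \<open>h2\<close>.\<close>

lemma resolvent_commute_ap:
  assumes "selfadjoint h1" "selfadjoint h2" "commuting_ops h1 h2" "Im z \<noteq> 0" "x \<in> dom h2"
  shows "resolvent h1 z x \<in> dom h2" "the (h2 (resolvent h1 z x)) = resolvent h1 z (the (h2 x))"
proof -
  interpret h1: selfadjoint h1 by fact
  interpret h2: selfadjoint h2 by fact
  have I: "Im \<i> \<noteq> 0" by simp
  define u where "u = the (h2 x) - \<i> *\<^sub>C x"
  have x: "resolvent h2 \<i> u = x" using assms(5) by (intro h2.resolvent_eqI) (auto simp: u_def)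
  have "resolvent h1 z \<circ> resolvent h2 \<i> = resolvent h2 \<i> \<circ> resolvent h1 z"
    using assms(3,4) I unfolding commuting_ops_def by blast
  then have comm: "resolvent h1 z x = resolvent h2 \<i> (resolvent h1 z u)"
    using x by (metis comp_apply)
  show "resolvent h1 z x \<in> dom h2"
    unfolding comm by (rule h2.resolvent_dom) simp
  have "the (h2 (resolvent h1 z x)) = resolvent h1 z u + \<i> *\<^sub>C resolvent h1 z x"
    using h2.ap_resolvent[OF I, of "resolvent h1 z u"] comm by simp
  also have "\<dots> = resolvent h1 z (the (h2 x))"
    unfolding u_def using assms(4) by (simp add: h1.resolvent_diff h1.resolvent_scale)
  finally show "the (h2 (resolvent h1 z x)) = resolvent h1 z (the (h2 x))" .
qed

text \<open>Replace \<open>h1\<close> by the bounded operators \<open>- i r h1 (h1 - i r)\<^sup>-\<^sup>1\<close>, whose adjoints also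
  converge strongly to \<open>h1\<close> on its domain as \<open>r\<close> tends to infinity.\<close>

lemma commuting_ops_cinner_real:
  assumes "selfadjoint h1" "selfadjoint h2" "commuting_ops h1 h2" "x \<in> dom h1" "x \<in> dom h2"
  shows "cinner (the (h1 x)) (the (h2 x)) = cinner (the (h2 x)) (the (h1 x))"
proof -
  interpret h1: selfadjoint h1 by fact
  interpret h2: selfadjoint h2 by fact
  let ?h1x = "the (h1 x)" and ?h2x = "the (h2 x)"
  let ?R = "\<lambda>r::real. resolvent h1 (\<i> * of_real r)"
  \<comment> \<open>The resolvent of \<open>h1\<close> keeps \<open>x\<close> in the domain of
    \<open>h2\<close>, so symmetry of \<open>h2\<close> yields the identity with \<open>x\<close> in
    place of \<open>h1 x\<close>; expanding the resolvent at \<open>h1 x\<close> by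
    \<open>resolvent_ap\<close> reduces to that case.\<close>
  have key: "cinner (?R r ?h1x) ?h2x = cinner ?h2x (resolvent h1 (cnj (\<i> * of_real r)) ?h1x)"
    if "r > 0" for r
  proof -
    let ?z = "\<i> * complex_of_real r"
    have I: "Im ?z \<noteq> 0" "Im (cnj ?z) \<noteq> 0" using that by auto
    have "cinner (?R r x) ?h2x = cinner (?R r ?h2x) x"
      using h2.symmetric[OF resolvent_commute_ap(1)[OF assms(1-3) I(1) assms(5)] assms(5)]
        resolvent_commute_ap(2)[OF assms(1-3) I(1) assms(5)] by simp
    also have "\<dots> = cinner ?h2x (resolvent h1 (cnj ?z) x)"
      by (rule h1.resolvent_adjoint[OF I(1)])
    finally have 1: "cinner (?R r x) ?h2x = cinner ?h2x (resolvent h1 (cnj ?z) x)" .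
    have "cinner x ?h2x = cinner ?h2x x" using h2.symmetric[OF assms(5) assms(5)] by simp
    then show ?thesis
      using 1 unfolding h1.resolvent_ap[OF I(1) assms(4)] h1.resolvent_ap[OF I(2) assms(4)]
      by (simp add: cinner_add_left cinner_add_right cinner_scaleC_left cinner_scaleC_right)
  qed
  have l: "((\<lambda>r. cinner (of_real r *\<^sub>C resolvent h1 (\<i> * of_real (s * r)) ?h1x) ?h2x)
      \<longlongrightarrow> cinner ((\<i> * of_real s) *\<^sub>C ?h1x) ?h2x) at_top" if "\<bar>s\<bar> = 1" for s
    using that by (intro tendsto_cinner h1.tendsto_resolvent tendsto_const)
  have adj: "cinner (of_real r *\<^sub>C ?R r ?h1x) ?h2x
      = cnj (cinner (of_real r *\<^sub>C resolvent h1 (\<i> * of_real (- 1 * r)) ?h1x) ?h2x)" if "r > 0" for r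
    using key[OF that] cinner_commute[of ?h2x] by (simp add: cinner_scaleC_left)
  \<comment> \<open>The same expression has two limits, one for the sign s = -1 after conjugation
    and one for s = 1; their equality is the reality of the inner product.\<close>
  have "((\<lambda>r. cinner (of_real r *\<^sub>C ?R r ?h1x) ?h2x)
      \<longlongrightarrow> cnj (cinner ((\<i> * of_real (- 1)) *\<^sub>C ?h1x) ?h2x)) at_top"
  proof (rule tendsto_cong[THEN iffD2, OF _ tendsto_cnj[OF l]])
    show "\<forall>\<^sub>F r in at_top. cinner (of_real r *\<^sub>C ?R r ?h1x) ?h2x
      = cnj (cinner (of_real r *\<^sub>C resolvent h1 (\<i> * of_real (- 1 * r)) ?h1x) ?h2x)"
      using eventually_gt_at_top[of 0] by (rule eventually_mono) (rule adj)
  qed simp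
  moreover have "((\<lambda>r. cinner (of_real r *\<^sub>C ?R r ?h1x) ?h2x)
      \<longlongrightarrow> cinner ((\<i> * of_real 1) *\<^sub>C ?h1x) ?h2x) at_top"
    using l[of 1] by simp
  ultimately have "cnj (cinner ((\<i> * of_real (- 1)) *\<^sub>C ?h1x) ?h2x) = cinner ((\<i> * of_real 1) *\<^sub>C ?h1x) ?h2x"
    by (rule tendsto_unique[rotated]) simp
  then have "cnj (cinner ?h1x ?h2x) = cinner ?h1x ?h2x"
    by (simp add: cinner_scaleC_left)
  then show ?thesis by (metis cinner_commute)
qed

section \<open>Functions in the common domain\<close>

lemma nth_deriv_0 [simp]: "nth_deriv 0 f = f"
  by (simp add: nth_deriv_def)

lemma nth_deriv_Suc: "nth_deriv (Suc m) f = (\<lambda>t. vector_derivative (nth_deriv m f) (at t))"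
  by (simp add: nth_deriv_def)

lemma nth_deriv_1: "nth_deriv 1 f = (\<lambda>t. vector_derivative f (at t))"
  by (simp add: nth_deriv_def)

lemma smoothD: "smooth f \<Longrightarrow> (nth_deriv m f has_vector_derivative nth_deriv (Suc m) f t) (at t)"
  by (simp add: smooth_def nth_deriv_Suc vector_derivative_works)

lemma nth_deriv_add:
  assumes "smooth f" "smooth g"
  shows "nth_deriv m (\<lambda>t. f t + g t) = (\<lambda>t. nth_deriv m f t + nth_deriv m g t)"
proof (induction m)
  case (Suc m)
  show ?case
    unfolding nth_deriv_Suc[of m "\<lambda>t. f t + g t"] Suc
    by (intro ext vector_derivative_at has_vector_derivative_add smoothD assms)
qed simp

lemma nth_deriv_cmult:
  assumes "smooth f"
  shows "nth_deriv m (\<lambda>t. c * f t) = (\<lambda>t. c * nth_deriv m f t)"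
proof (induction m)
  case (Suc m)
  show ?case
    unfolding nth_deriv_Suc[of m "\<lambda>t. c * f t"] Suc
    by (intro ext vector_derivative_at has_vector_derivative_mult_right smoothD assms)
qed simp

lemma smooth_add: "smooth f \<Longrightarrow> smooth g \<Longrightarrow> smooth (\<lambda>t. f t + g t)"
  by (simp add: smooth_def nth_deriv_add differentiable_add)

lemma smooth_cmult: "smooth f \<Longrightarrow> smooth (\<lambda>t. c * f t)"
  by (simp add: smooth_def nth_deriv_cmult differentiable_mult)

lemma C0_add: "f \<in> C0 \<Longrightarrow> g \<in> C0 \<Longrightarrow> (\<lambda>t. f t + g t) \<in> C0"
  unfolding C0_def by (auto intro!: continuous_intros tendsto_add_zero)

lemma C0_cmult: "f \<in> C0 \<Longrightarrow> (\<lambda>t. c * f t) \<in> C0"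
  unfolding C0_def by (auto intro!: continuous_intros tendsto_mult_right_zero)

lemma D0_functions_add:
  assumes "f \<in> D0_functions" "g \<in> D0_functions"
  shows "(\<lambda>t. f t + g t) \<in> D0_functions"
  using assms unfolding D0_functions_def
  by (auto simp: nth_deriv_add smooth_add distrib_left intro!: square_integrable_add C0_add)

lemma D0_functions_cmult:
  assumes "f \<in> D0_functions"
  shows "(\<lambda>t. c * f t) \<in> D0_functions"
  using assms unfolding D0_functions_def
  by (auto simp: nth_deriv_cmult smooth_cmult mult.left_commute[of _ c]
      intro!: square_integrable_mult C0_cmult)

lemma D0_functions_smooth: "f \<in> D0_functions \<Longrightarrow> smooth f"
  by (simp add: D0_functions_def)

lemma D0_functions_deriv:
  assumes "f \<in> D0_functions"
  shows "(f has_vector_derivative nth_deriv 1 f t) (at t)"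
    and "square_integrable (nth_deriv 1 f)" "continuous_on UNIV (nth_deriv 1 f)"
    and "square_integrable (\<lambda>t. of_real t * f t)"
proof -
  show "(f has_vector_derivative nth_deriv 1 f t) (at t)"
    using smoothD[OF D0_functions_smooth[OF assms], of 0 t] by simp
  show "square_integrable (nth_deriv 1 f)" using assms by (simp add: D0_functions_def)
  have "\<forall>m. (\<lambda>t. of_real t ^ m * nth_deriv 1 f t) \<in> C0" using assms by (simp add: D0_functions_def)
  from spec[OF this, of 0] show "continuous_on UNIV (nth_deriv 1 f)" by (simp add: C0_def)
  have "\<forall>m. square_integrable (\<lambda>t. of_real t ^ m * f t)" using assms by (simp add: D0_functions_def)
  from spec[OF this, of 1] show "square_integrable (\<lambda>t. of_real t * f t)" by simp
qed

section \<open>Decay criteria for membership in the common domain\<close>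

lemma integrable_inverse_square: "integrable lborel (\<lambda>t::real. 1 / (1 + t\<^sup>2))"
proof -
  have "set_integrable lborel (einterval (-\<infinity>) \<infinity>) (\<lambda>t::real. 1 / (1 + t\<^sup>2))"
  proof (rule interval_integral_FTC_nonneg(1)[where F = arctan and A = "- pi/2" and B = "pi/2"])
    show "((arctan \<circ> real_of_ereal) \<longlongrightarrow> - pi/2) (at_right (-\<infinity>))"
      by (simp add: ereal_tendsto_simps tendsto_arctan_at_bot)
    show "((arctan \<circ> real_of_ereal) \<longlongrightarrow> pi/2) (at_left \<infinity>)"
      by (simp add: ereal_tendsto_simps tendsto_arctan_at_top)
  qed (auto intro!: derivative_eq_intros continuous_intros simp: field_simps add_nonneg_eq_0_iff)
  then show ?thesis by (simp add: set_integrable_def einterval_iff)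
qed

text \<open>Adding the squares of the two bounds gives |f|^2 <= 2 K^2 / (1 + t^2), an integrable
  majorant; the second bound alone gives |f| <= K / |t| at infinity.\<close>

lemma decay_square_integrable:
  fixes f :: "real \<Rightarrow> complex"
  assumes "continuous_on UNIV f" "\<And>t. cmod (f t) \<le> K" "\<And>t. cmod (of_real t * f t) \<le> K"
  shows "square_integrable f" "f \<in> C0"
proof -
  have K: "0 \<le> K" using assms(2)[of 0] by (meson norm_ge_zero order_trans)
  have [measurable]: "f \<in> borel_measurable lborel"
    using assms(1) by (simp add: borel_measurable_continuous_onI)
  have bound: "(cmod (f t))\<^sup>2 \<le> 2 * K\<^sup>2 * (1 / (1 + t\<^sup>2))" for t
  proof -
    have "(cmod (f t))\<^sup>2 \<le> K\<^sup>2" using assms(2) by (intro power_mono) auto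
    moreover have "(\<bar>t\<bar> * cmod (f t))\<^sup>2 \<le> K\<^sup>2" using assms(3)[of t] by (intro power_mono) (auto simp: norm_mult)
    ultimately have "(cmod (f t))\<^sup>2 * (1 + t\<^sup>2) \<le> 2 * K\<^sup>2"
      by (simp add: algebra_simps power_mult_distrib)
    moreover have "1 + t\<^sup>2 > 0" by (simp add: add_pos_nonneg)
    ultimately show ?thesis by (simp add: field_simps)
  qed
  have "integrable lborel (\<lambda>t. (cmod (f t))\<^sup>2)"
    by (rule Bochner_Integration.integrable_bound[OF integrable_mult_right[OF integrable_inverse_square, of "2 * K\<^sup>2"]])
       (use bound in auto)
  then show "square_integrable f" by (simp add: square_integrable_def)
  have "(f \<longlongrightarrow> 0) at_infinity"
  proof (rule tendstoI)
    fix e :: real assume e: "e > 0"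
    have "dist (f t) 0 < e" if t: "norm t \<ge> K / e + 1" for t
    proof -
      have t0: "\<bar>t\<bar> > 0" using t K e by (smt (verit) divide_nonneg_pos real_norm_def)
      have "\<bar>t\<bar> * cmod (f t) \<le> K" using assms(3)[of t] by (simp add: norm_mult)
      also have "K < \<bar>t\<bar> * e" using t e by (simp add: field_simps)
      finally show ?thesis using t0 by simp
    qed
    then show "\<forall>\<^sub>F t in at_infinity. dist (f t) 0 < e" by (auto simp: eventually_at_infinity)
  qed
  then show "f \<in> C0" using assms(1) by (simp add: C0_def)
qed

text \<open>Boundedness of both f and t f already gives the decay criterion, and closure of the
  family under derivatives and multiplication by t carries it over to every function that
  \<open>D0_functions\<close> constrains.\<close>

lemma schwartz_family_subset_D0_functions:
  fixes F :: "(real \<Rightarrow> complex) set"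
  assumes deriv: "\<And>f. f \<in> F \<Longrightarrow> \<exists>f'\<in>F. \<forall>t. (f has_vector_derivative f' t) (at t)"
    and mult: "\<And>f. f \<in> F \<Longrightarrow> (\<lambda>t. of_real t * f t) \<in> F"
    and bdd: "\<And>f. f \<in> F \<Longrightarrow> \<exists>K. \<forall>t. cmod (f t) \<le> K"
  shows "F \<subseteq> D0_functions"
proof
  have cont: "continuous_on UNIV f" if "f \<in> F" for f
    using deriv[OF that] by (meson continuous_on_eq_continuous_at has_vector_derivative_continuous open_UNIV)
  have decay: "square_integrable f" "f \<in> C0" if f: "f \<in> F" for f
  proof -
    obtain K1 K2 where "\<And>t. cmod (f t) \<le> K1" "\<And>t. cmod (of_real t * f t) \<le> K2"
      using bdd[OF f] bdd[OF mult[OF f]] by auto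
    then have "\<And>t. cmod (f t) \<le> max K1 K2" "\<And>t. cmod (of_real t * f t) \<le> max K1 K2"
      by (meson max.coboundedI1 max.coboundedI2)+
    from decay_square_integrable[OF cont[OF f] this] show "square_integrable f" "f \<in> C0" by auto
  qed
  have deriv_in: "(\<lambda>t. vector_derivative f (at t)) \<in> F" if "f \<in> F" for f
  proof -
    obtain f' where f': "f' \<in> F" "\<And>t. (f has_vector_derivative f' t) (at t)" using deriv \<open>f \<in> F\<close> by blast
    then have "(\<lambda>t. vector_derivative f (at t)) = f'" by (auto intro: vector_derivative_at)
    then show ?thesis using f' by simp
  qed
  have nth: "nth_deriv m f \<in> F" if "f \<in> F" for f m
    by (induction m) (auto simp: nth_deriv_Suc that intro: deriv_in)
  have pow: "(\<lambda>t. of_real t ^ m * f t) \<in> F" if "f \<in> F" for f m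
  proof (induction m)
    case (Suc m)
    from mult[OF this] show ?case by (simp add: mult.assoc)
  qed (use that in simp)
  fix f assume f: "f \<in> F"
  have "nth_deriv m f differentiable at t" for m t
    using deriv[OF nth[OF f, of m]] differentiableI_vector by blast
  then show "f \<in> D0_functions"
    unfolding D0_functions_def smooth_def using decay pow nth f by auto
qed

section \<open>Gaussian estimates and the equation t f + k f' = g\<close>

lemma one_plus_square_le_exp:
  fixes b t :: real assumes "b > 0"
  shows "1 + t\<^sup>2 \<le> (1 + 1 / b) * exp (b * t\<^sup>2)"
proof -
  have 1: "1 \<le> exp (b * t\<^sup>2)" using assms by simp
  have "b * t\<^sup>2 \<le> exp (b * t\<^sup>2)" using exp_ge_add_one_self[of "b * t\<^sup>2"] by linarith
  then have "t\<^sup>2 \<le> (1 / b) * exp (b * t\<^sup>2)" using assms by (simp add: field_simps)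
  then show ?thesis using 1 unfolding distrib_right by linarith
qed

text \<open>Each step of the induction spends half of the exponent on the new factor t, which is why
  \<open>a\<close> is generalised.\<close>

lemma poly_gaussian_bounded:
  fixes p :: "real poly"
  assumes "a > 0"
  shows "\<exists>K. \<forall>t. \<bar>poly p t\<bar> * exp (- a * t\<^sup>2) \<le> K"
  using assms
proof (induction p arbitrary: a)
  case 0
  then show ?case by auto
next
  case (pCons c p)
  then obtain K where K: "\<And>t. \<bar>poly p t\<bar> * exp (- (a/2) * t\<^sup>2) \<le> K" by (metis half_gt_zero)
  define L where "L = 1 + 1 / (a/2)"
  have lin: "\<bar>t\<bar> * exp (- (a/2) * t\<^sup>2) \<le> L" for t
  proof -
    have "2 * \<bar>t\<bar> \<le> 1 + t\<^sup>2" using zero_le_power2[of "\<bar>t\<bar> - 1"] by (simp add: power2_diff)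
    then have "\<bar>t\<bar> \<le> 1 + t\<^sup>2" by linarith
    also have "\<dots> \<le> L * exp ((a/2) * t\<^sup>2)" unfolding L_def using pCons.prems by (intro one_plus_square_le_exp) simp
    finally have "\<bar>t\<bar> * exp (- (a/2) * t\<^sup>2) \<le> L * exp ((a/2) * t\<^sup>2) * exp (- (a/2) * t\<^sup>2)"
      by (intro mult_right_mono) auto
    also have "\<dots> = L" by (simp flip: exp_add)
    finally show ?thesis .
  qed
  have "\<bar>poly (pCons c p) t\<bar> * exp (- a * t\<^sup>2) \<le> \<bar>c\<bar> + L * K" for t
  proof -
    have e: "exp (- a * t\<^sup>2) = exp (- (a/2) * t\<^sup>2) * exp (- (a/2) * t\<^sup>2)" by (simp flip: exp_add)
    have "\<bar>poly (pCons c p) t\<bar> * exp (- a * t\<^sup>2) \<le> (\<bar>c\<bar> + \<bar>t\<bar> * \<bar>poly p t\<bar>) * exp (- a * t\<^sup>2)"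
      by (intro mult_right_mono) (auto simp flip: abs_mult)
    also have "\<dots> = \<bar>c\<bar> * exp (- a * t\<^sup>2)
        + (\<bar>t\<bar> * exp (- (a/2) * t\<^sup>2)) * (\<bar>poly p t\<bar> * exp (- (a/2) * t\<^sup>2))"
      by (simp only: e algebra_simps)
    also have "\<dots> \<le> \<bar>c\<bar> * 1 + L * K"
      using K[of t] lin[of t] pCons.prems lin[of 0]
      by (intro add_mono mult_mono) (auto intro: order_trans)
    finally show ?thesis by simp
  qed
  then show ?case by blast
qed

text \<open>Variation of constants: t + k d/dt annihilates E = exp(-t^2 / (2k)), and k E F' = g.
  Membership in \<open>D0_functions\<close> comes from the family p E F + q g with polynomials p and
  q: it is closed under derivatives because E', E F' and g' are again polynomial multiples of E or
  g, and it is bounded because polynomials times E are.\<close>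

lemma gaussian_primitive_in_D0_functions:
  fixes k :: real and F g :: "real \<Rightarrow> real"
  assumes k: "k > 0"
    and F: "\<And>t. (F has_real_derivative exp (t\<^sup>2 / (2 * k)) * g t / k) (at t)" "\<And>t. \<bar>F t\<bar> \<le> K"
    and g: "\<And>t. (g has_real_derivative poly \<rho> t * g t) (at t)" "\<And>t. \<bar>g t\<bar> \<le> K * exp (- t\<^sup>2 / (2 * k))"
  defines "f \<equiv> \<lambda>t. complex_of_real (exp (- t\<^sup>2 / (2 * k)) * F t)"
  shows "f \<in> D0_functions" "of_real t * f t + of_real k * nth_deriv 1 f t = of_real (g t)"
proof -
  define E where "E t = exp (- t\<^sup>2 / (2 * k))" for t
  define G where "G p q t = complex_of_real (poly p t * (E t * F t) + poly q t * g t)" for p q t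
  have E': "(E has_real_derivative - (t / k) * E t) (at t)" for t
    unfolding E_def using k by (auto intro!: derivative_eq_intros simp: power2_eq_square)
  have EF': "((\<lambda>t. E t * F t) has_real_derivative - (t / k) * (E t * F t) + g t / k) (at t)" for t
  proof -
    have "E t * exp (t\<^sup>2 / (2 * k)) = 1" by (simp add: E_def flip: exp_add)
    moreover have "exp (t\<^sup>2 / (2 * k)) * g t / k * E t = (E t * exp (t\<^sup>2 / (2 * k))) * (g t / k)" by simp
    ultimately have "exp (t\<^sup>2 / (2 * k)) * g t / k * E t = g t / k" by (simp only: mult_1_left)
    then show ?thesis
      by (intro DERIV_cong[OF DERIV_mult[OF E' F(1)]]) (simp only: mult.assoc)
  qed
  have G': "(G p q has_vector_derivative
      G (pderiv p - smult (1/k) ([:0, 1:] * p)) (smult (1/k) p + pderiv q + q * \<rho>) t) (at t)" for p q t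
  proof -
    have "((\<lambda>t. poly p t * (E t * F t) + poly q t * g t) has_real_derivative
        poly (pderiv p - smult (1/k) ([:0, 1:] * p)) t * (E t * F t)
        + poly (smult (1/k) p + pderiv q + q * \<rho>) t * g t) (at t)"
      by (rule DERIV_cong[OF DERIV_add[OF DERIV_mult[OF poly_DERIV EF'] DERIV_mult[OF poly_DERIV g(1)]]])
         (simp add: algebra_simps)
    then show ?thesis unfolding G_def
      by (intro has_vector_derivative_of_real) (simp add: has_real_derivative_iff_has_vector_derivative)
  qed
  have K0: "K \<ge> 0" using F(2)[of 0] by linarith
  have bdd: "\<exists>L. \<forall>t. cmod (G p q t) \<le> L" for p q
  proof -
    have k': "1 / (2 * k) > 0" using k by simp
    obtain L1 L2 where L: "\<And>t. \<bar>poly p t\<bar> * E t \<le> L1" "\<And>t. \<bar>poly q t\<bar> * E t \<le> L2"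
      using poly_gaussian_bounded[OF k', of p] poly_gaussian_bounded[OF k', of q] by (auto simp: E_def)
    have "cmod (G p q t) \<le> L1 * K + L2 * K" for t
    proof -
      have E0: "E t \<ge> 0" by (simp add: E_def)
      have "cmod (G p q t) \<le> \<bar>poly p t * (E t * F t)\<bar> + \<bar>poly q t * g t\<bar>"
        unfolding G_def norm_of_real by (rule abs_triangle_ineq)
      also have "\<bar>poly p t * (E t * F t)\<bar> = (\<bar>poly p t\<bar> * E t) * \<bar>F t\<bar>" using E0 by (simp add: abs_mult)
      also have "\<dots> \<le> L1 * K"
      proof (intro mult_mono L(1) F(2))
        show "0 \<le> L1" by (rule order_trans[OF _ L(1)[of t]]) (use E0 in simp)
      qed simp
      also have "\<bar>poly q t * g t\<bar> \<le> \<bar>poly q t\<bar> * (K * E t)"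
        unfolding abs_mult E_def by (intro mult_left_mono g(2)) simp
      also have "\<dots> = (\<bar>poly q t\<bar> * E t) * K" by simp
      also have "\<dots> \<le> L2 * K" using L(2)[of t] K0 by (intro mult_right_mono)
      finally show ?thesis by simp
    qed
    then show ?thesis by blast
  qed
  have "range (\<lambda>(p, q). G p q) \<subseteq> D0_functions"
  proof (rule schwartz_family_subset_D0_functions)
    fix h assume "h \<in> range (\<lambda>(p, q). G p q)"
    then obtain p q where h: "h = G p q" by auto
    show "\<exists>h'\<in>range (\<lambda>(p, q). G p q). \<forall>t. (h has_vector_derivative h' t) (at t)"
      unfolding h using G'[of p q] by blast
    have "(\<lambda>t. of_real t * h t) = G ([:0, 1:] * p) ([:0, 1:] * q)"
      by (auto simp: h G_def algebra_simps)
    then show "(\<lambda>t. of_real t * h t) \<in> range (\<lambda>(p, q). G p q)" by auto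
    show "\<exists>K. \<forall>t. cmod (h t) \<le> K" unfolding h by (rule bdd)
  qed
  moreover have f: "f = G 1 0" by (auto simp: f_def G_def E_def)
  ultimately show "f \<in> D0_functions" by auto
  have "nth_deriv 1 f t = G (pderiv 1 - smult (1/k) ([:0, 1:] * 1)) (smult (1/k) 1 + pderiv 0 + 0 * \<rho>) t"
    unfolding nth_deriv_1 f by (rule vector_derivative_at[OF G'])
  then show "of_real t * f t + of_real k * nth_deriv 1 f t = of_real (g t)"
    using k unfolding f by (simp add: G_def field_simps)
qed

text \<open>The majorant has the bounded primitive c arctan; subtracting it from F gives a
  nonincreasing function and adding it a nondecreasing one, which confines F.\<close>

lemma bounded_primitive_exists:
  fixes u :: "real \<Rightarrow> real"
  assumes "continuous_on UNIV u" "\<And>t. \<bar>u t\<bar> \<le> c / (1 + t\<^sup>2)"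
  shows "\<exists>F K. (\<forall>t. (F has_real_derivative u t) (at t)) \<and> (\<forall>t. \<bar>F t\<bar> \<le> K)"
proof -
  have c: "c \<ge> 0" using assms(2)[of 0] by simp
  have "isCont u t" for t using assms(1) by (simp add: continuous_on_eq_continuous_at)
  then obtain F where "\<forall>t. (F has_vector_derivative u t) (at t)"
    using einterval_antiderivative[of "-\<infinity>" "\<infinity>" u] by auto
  then have F: "(F has_real_derivative u t) (at t)" for t
    by (simp add: has_real_derivative_iff_has_vector_derivative)
  have arc: "((\<lambda>t. c * arctan t) has_real_derivative c / (1 + t\<^sup>2)) (at t)" for t
    by (auto intro!: derivative_eq_intros simp: field_simps)
  have mono1: "F s - c * arctan s \<ge> F t - c * arctan t" and mono2: "F s + c * arctan s \<le> F t + c * arctan t"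
    if "s \<le> t" for s t
  proof -
    have "((\<lambda>t. F t - c * arctan t) has_real_derivative u t - c / (1 + t\<^sup>2)) (at t)" for t
      by (intro DERIV_diff F arc)
    then show "F s - c * arctan s \<ge> F t - c * arctan t"
      using assms(2) by (intro DERIV_nonpos_imp_nonincreasing[OF that]) (smt (verit))
    have "((\<lambda>t. F t + c * arctan t) has_real_derivative u t + c / (1 + t\<^sup>2)) (at t)" for t
      by (intro DERIV_add F arc)
    then show "F s + c * arctan s \<le> F t + c * arctan t"
      using assms(2) by (intro DERIV_nonneg_imp_nondecreasing[OF that]) (smt (verit))
  qed
  have "\<bar>F t\<bar> \<le> \<bar>F 0\<bar> + c * (pi/2)" for t
  proof -
    have "c * arctan t \<le> c * (pi/2)" "c * (- (pi/2)) \<le> c * arctan t"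
      using arctan[of t] c by (intro mult_left_mono; simp)+
    then show ?thesis
      using mono1[of 0 t] mono2[of 0 t] mono1[of t 0] mono2[of t 0] by (cases "t \<ge> 0") auto
  qed
  then show ?thesis using F by blast
qed

text \<open>The required rate exp(-t^2 / k) is the square of the kernel Gaussian exp(-t^2 / (2k)):
  after division by that Gaussian enough decay is left for a bounded primitive.\<close>

lemma annihilation_equation_solvable:
  fixes k :: real and g :: "real \<Rightarrow> real"
  assumes k: "k > 0"
    and g: "\<And>t. (g has_real_derivative poly \<rho> t * g t) (at t)" "\<And>t. \<bar>g t\<bar> \<le> K * exp (- t\<^sup>2 / k)"
  shows "\<exists>f\<in>D0_functions. \<forall>t. of_real t * f t + of_real k * nth_deriv 1 f t = complex_of_real (g t)"
proof -
  have K0: "K \<ge> 0" using g(2)[of 0] by simp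
  define u where "u t = exp (t\<^sup>2 / (2 * k)) * g t / k" for t
  have "continuous_on UNIV g"
    using g(1) by (meson DERIV_isCont continuous_at_imp_continuous_on)
  then have cont: "continuous_on UNIV u" unfolding u_def using k by (auto intro!: continuous_intros)
  define b where "b = 1 / (2 * k)"
  have b: "b > 0" using k by (simp add: b_def)
  have "\<bar>u t\<bar> \<le> (K * (1 + 1 / b) / k) / (1 + t\<^sup>2)" for t
  proof -
    have "\<bar>u t\<bar> = exp (b * t\<^sup>2) * \<bar>g t\<bar> / k" using k by (simp add: u_def abs_mult b_def)
    also have "\<dots> \<le> exp (b * t\<^sup>2) * (K * exp (- t\<^sup>2 / k)) / k"
      using g(2)[of t] k by (intro divide_right_mono mult_left_mono) auto
    also have "\<dots> = K * (exp (b * t\<^sup>2) * exp (- t\<^sup>2 / k)) / k" by simp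
    also have "exp (b * t\<^sup>2) * exp (- t\<^sup>2 / k) = 1 / exp (b * t\<^sup>2)"
    proof -
      have "b * t\<^sup>2 + - t\<^sup>2 / k = - (b * t\<^sup>2)" using k by (simp add: b_def field_simps)
      then show ?thesis by (simp only: exp_add[symmetric] exp_minus inverse_eq_divide)
    qed
    also have "K * (1 / exp (b * t\<^sup>2)) / k \<le> K * ((1 + 1 / b) / (1 + t\<^sup>2)) / k"
    proof (intro divide_right_mono mult_left_mono)
      have "0 < 1 + t\<^sup>2" by (simp add: add_pos_nonneg)
      then show "1 / exp (b * t\<^sup>2) \<le> (1 + 1 / b) / (1 + t\<^sup>2)"
        using one_plus_square_le_exp[OF b, of t] by (intro mult_imp_div_pos_le) (simp_all add: pos_le_divide_eq)
    qed (use K0 k in auto)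
    finally show ?thesis by (simp add: mult.commute)
  qed
  then obtain F K' where F: "\<And>t. (F has_real_derivative u t) (at t)" "\<And>t. \<bar>F t\<bar> \<le> K'"
    using bounded_primitive_exists[OF cont] by blast
  have g': "\<bar>g t\<bar> \<le> max K K' * exp (- t\<^sup>2 / (2 * k))" for t
  proof -
    have "t\<^sup>2 / (2 * k) \<le> t\<^sup>2 / k" using k by (intro divide_left_mono) auto
    then have "K * exp (- t\<^sup>2 / k) \<le> max K K' * exp (- t\<^sup>2 / (2 * k))"
      using K0 by (intro mult_mono) auto
    then show ?thesis using g(2)[of t] by linarith
  qed
  have F': "\<bar>F t\<bar> \<le> max K K'" for t using F(2)[of t] by (simp add: max.coboundedI2)
  note sol = gaussian_primitive_in_D0_functions[OF k F(1)[unfolded u_def] F' g(1) g']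
  show ?thesis by (intro bexI[OF _ sol(1)] allI sol(2))
qed

lemma annihilated_gaussian:
  fixes k :: real
  assumes k: "k > 0"
  shows "\<exists>f\<in>D0_functions. abs_L2 f \<noteq> 0 \<and> (\<forall>t. of_real t * f t + of_real k * nth_deriv 1 f t = 0)"
proof -
  define f where "f t = complex_of_real (exp (- t\<^sup>2 / (2 * k)) * 1)" for t
  have "f \<in> D0_functions" "\<And>t. of_real t * f t + of_real k * nth_deriv 1 f t = 0"
    \<comment> \<open>The homogeneous case: constant primitive F = 1 and right-hand side g =
      0.\<close>
    using gaussian_primitive_in_D0_functions[OF k, of "\<lambda>_. 1" "\<lambda>_. 0" 1 0] by (auto simp: f_def[abs_def])
  moreover have "abs_L2 f \<noteq> 0"
  proof
    assume "abs_L2 f = 0"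
    then have "L2_eq f (\<lambda>_. 0)"
      using Quotient_rel[OF Quotient_L2, of f "\<lambda>_. 0"] L2_eq_refl square_integrable_zero
        D0_functions_square_integrable[OF \<open>f \<in> D0_functions\<close>] by (simp add: zero_L2_def)
    then have "f = (\<lambda>_. 0)"
      using D0_functions_continuous[OF \<open>f \<in> D0_functions\<close>]
      by (intro continuous_AE_eq) (auto simp: L2_eq_def)
    from fun_cong[OF this, of 0] show False by (simp add: f_def)
  qed
  ultimately show ?thesis by blast
qed

section \<open>Density of the range of the annihilation operator\<close>

lemma L2_dominated_convergence:
  fixes f :: "nat \<Rightarrow> real \<Rightarrow> complex" and w :: "real \<Rightarrow> real"
  assumes [measurable]: "\<And>n. f n \<in> borel_measurable lborel" "g \<in> borel_measurable lborel"
    and w: "integrable lborel (\<lambda>t. (w t)\<^sup>2)"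
    and bound: "\<And>n t. cmod (f n t) \<le> w t"
    and lim: "AE t in lborel. (\<lambda>n. f n t) \<longlonglongrightarrow> g t"
  shows "square_integrable (f n)" "square_integrable g" "(\<lambda>n. abs_L2 (f n)) \<longlonglongrightarrow> abs_L2 g"
proof -
  have w0: "0 \<le> w t" for t using bound[of 0 t] by (meson norm_ge_zero order_trans)
  have sq: "(cmod (f n t))\<^sup>2 \<le> (w t)\<^sup>2" for n t using bound by (intro power_mono) auto
  show f: "square_integrable (f n)" for n
    unfolding square_integrable_def
    by (intro conjI Bochner_Integration.integrable_bound[OF w]) (use sq in auto)
  have gw: "AE t in lborel. cmod (g t) \<le> w t"
    using lim by eventually_elim (rule tendsto_upperbound[OF tendsto_norm], auto simp: bound)
  show g: "square_integrable g"
    unfolding square_integrable_def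
  proof (intro conjI Bochner_Integration.integrable_bound[OF w])
    show "AE t in lborel. norm ((cmod (g t))\<^sup>2) \<le> norm ((w t)\<^sup>2)"
      using gw by eventually_elim (simp add: power_mono)
  qed measurable
  have "(\<lambda>n. \<integral>t. (cmod (f n t - g t))\<^sup>2 \<partial>lborel) \<longlonglongrightarrow> (\<integral>t. 0 \<partial>(lborel :: real measure))"
  proof (rule integral_dominated_convergence[where w = "\<lambda>t. 4 * (w t)\<^sup>2"])
    show "AE t in lborel. (\<lambda>n. (cmod (f n t - g t))\<^sup>2) \<longlonglongrightarrow> 0"
      using lim
    proof eventually_elim
      fix t assume "(\<lambda>n. f n t) \<longlonglongrightarrow> g t"
      then have "(\<lambda>n. (cmod (f n t - g t))\<^sup>2) \<longlonglongrightarrow> (cmod (g t - g t))\<^sup>2" by (intro tendsto_intros)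
      then show "(\<lambda>n. (cmod (f n t - g t))\<^sup>2) \<longlonglongrightarrow> 0" by simp
    qed
    fix n
    show "AE t in lborel. norm ((cmod (f n t - g t))\<^sup>2) \<le> 4 * (w t)\<^sup>2"
      using gw
    proof eventually_elim
      fix t assume "cmod (g t) \<le> w t"
      then have "cmod (f n t - g t) \<le> 2 * w t"
        using norm_triangle_ineq4[of "f n t" "g t"] bound[of n t] by linarith
      then have "(cmod (f n t - g t))\<^sup>2 \<le> (2 * w t)\<^sup>2" by (intro power_mono) auto
      then show "norm ((cmod (f n t - g t))\<^sup>2) \<le> 4 * (w t)\<^sup>2" by (simp add: power_mult_distrib)
    qed
  qed (use w in auto)
  then have "(\<lambda>n. sqrt (\<integral>t. (cmod (f n t - g t))\<^sup>2 \<partial>lborel)) \<longlonglongrightarrow> sqrt 0"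
    by (intro tendsto_real_sqrt) simp
  then have "(\<lambda>n. norm (abs_L2 (f n) - abs_L2 g)) \<longlonglongrightarrow> 0"
    using f g by (simp add: abs_L2_diff norm_abs_L2 square_integrable_diff)
  then show "(\<lambda>n. abs_L2 (f n)) \<longlonglongrightarrow> abs_L2 g"
    by (simp add: LIM_zero_iff tendsto_norm_zero_iff)
qed

lemma square_integrable_indicator:
  assumes "S \<in> sets borel" "bounded S"
  shows "square_integrable (indicator S)"
proof -
  have "emeasure lborel S < \<infinity>" using assms(2) by (rule emeasure_bounded_finite)
  then have "integrable lborel (indicator S :: real \<Rightarrow> real)"
    using assms(1) by (intro integrable_real_indicator) auto
  moreover have "(cmod (indicator S t))\<^sup>2 = (indicator S t :: real)" for t
    by (simp add: indicator_def)
  ultimately show ?thesis using assms(1) by (simp add: square_integrable_def)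
qed

text \<open>Dynkin's theorem: open intervals form an intersection-stable generator of the Borel
  sets. Truncation to (-N, N) keeps complements and countable unions square-integrable; the unions
  converge by domination.\<close>

lemma closed_subspace_contains_indicators:
  fixes V :: "L2 set"
  assumes closed: "closed V"
    and add: "\<And>x y. x \<in> V \<Longrightarrow> y \<in> V \<Longrightarrow> x + y \<in> V"
    and scale: "\<And>c x. x \<in> V \<Longrightarrow> c *\<^sub>C x \<in> V"
    and interval: "\<And>a b. abs_L2 (indicator {a<..<b}) \<in> V"
    and S: "S \<in> sets borel"
  shows "abs_L2 (indicator (S \<inter> {-N<..<N})) \<in> V"
proof -
  let ?G = "range (\<lambda>(a, b). {a<..<b::real})"
  let ?I = "{-N<..<N::real}"
  have sets: "sets borel = sigma_sets UNIV ?G"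
  proof -
    have "(\<lambda>(a, b). box a b) = (\<lambda>(a, b). {a<..<b::real})" by (auto simp: fun_eq_iff box_real)
    moreover have "sets borel = sigma_sets UNIV (range (\<lambda>(a, b). box a b :: real set))"
      by (subst borel_eq_box) simp
    ultimately show ?thesis by (simp only:)
  qed
  have sq: "square_integrable (indicator (A \<inter> ?I))" if "A \<in> sets borel" for A
    using that by (intro square_integrable_indicator) (auto intro: bounded_subset[of ?I])
  have diff: "x - y \<in> V" if "x \<in> V" "y \<in> V" for x y
    using add[OF that(1) scale[OF that(2), of "-1"]] by (simp add: scaleC_minus_left)
  have "Int_stable ?G"
  proof (rule Int_stableI_image)
    fix p q :: "real \<times> real"
    show "\<exists>r\<in>UNIV. (case p of (a, b) \<Rightarrow> {a<..<b}) \<inter> (case q of (a, b) \<Rightarrow> {a<..<b}) = (case r of (a, b) \<Rightarrow> {a<..<b})"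
      by (intro bexI[of _ "(max (fst p) (fst q), min (snd p) (snd q))"]) (auto split: prod.splits)
  qed
  moreover have "?G \<subseteq> Pow UNIV" by simp
  moreover have "S \<in> sigma_sets UNIV ?G" using S by (simp add: sets)
  ultimately show ?thesis
  proof (induction rule: sigma_sets_induct_disjoint)
    case (basic A)
    then obtain a b where A: "A = {a<..<b}" by auto
    have "A \<inter> ?I = {max a (-N)<..<min b N}" by (auto simp: A)
    then show ?case using interval by simp
  next
    case empty
    have "{} \<inter> ?I = {0<..<0}" by simp
    then show ?case using interval[of 0 0] by metis
  next
    case (compl A)
    then have A: "A \<in> sets borel" by (simp add: sets)
    have "abs_L2 (indicator ?I) - abs_L2 (indicator (A \<inter> ?I))
        = abs_L2 (\<lambda>t. indicator ?I t - indicator (A \<inter> ?I) t)"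
      using sq[OF A] sq[of UNIV] by (simp add: abs_L2_diff)
    also have "(\<lambda>t. indicator ?I t - indicator (A \<inter> ?I) t)
        = (indicator ((UNIV - A) \<inter> ?I) :: real \<Rightarrow> complex)"
      by (auto simp: indicator_def)
    finally show ?case using diff[OF interval compl(2)] by metis
  next
    case (union A)
    then have A: "A i \<in> sets borel" for i by (auto simp: sets)
    have fin: "abs_L2 (indicator ((\<Union>i<m. A i) \<inter> ?I)) \<in> V" for m :: nat
    proof (induction m)
      case 0
      have "(\<Union>i<0. A i) \<inter> ?I = {0<..<0}" by simp
      then show ?case using interval[of 0 0] by metis
    next
      case (Suc m)
      have "A i \<inter> A m = {}" if "i < m" for i
        using disjoint_family_onD[OF union(1), of i m] that by simp
      then have "((\<Union>i<m. A i) \<inter> ?I) \<inter> (A m \<inter> ?I) = {}" by auto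
      moreover have "(\<Union>i<Suc m. A i) \<inter> ?I = ((\<Union>i<m. A i) \<inter> ?I) \<union> (A m \<inter> ?I)"
        by (simp add: lessThan_Suc Int_Un_distrib2 Un_commute)
      ultimately have "(\<lambda>t. indicator ((\<Union>i<m. A i) \<inter> ?I) t + indicator (A m \<inter> ?I) t)
          = (indicator ((\<Union>i<Suc m. A i) \<inter> ?I) :: real \<Rightarrow> complex)"
        by (simp only: indicator_add)
      moreover have "(\<Union>i<m. A i) \<in> sets borel" using A by auto
      ultimately show ?case
        using add[OF Suc union(3)[of m]] sq[OF A[of m]] sq[of "\<Union>i<m. A i"] by (simp add: abs_L2_add)
    qed
    have "(\<lambda>m. abs_L2 (indicator ((\<Union>i<m. A i) \<inter> ?I))) \<longlonglongrightarrow> abs_L2 (indicator ((\<Union>i. A i) \<inter> ?I))"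
    proof (rule L2_dominated_convergence(3)[where w = "indicator ?I"])
      show "integrable lborel (\<lambda>t. (indicator ?I t :: real)\<^sup>2)"
      proof -
        have "(\<lambda>t. (indicator ?I t :: real)\<^sup>2) = (\<lambda>t. (cmod (indicator ?I t))\<^sup>2)"
          by (auto simp: indicator_def fun_eq_iff)
        then show ?thesis using sq[of UNIV] by (simp add: square_integrable_def)
      qed
      show "AE t in lborel. (\<lambda>m. indicator ((\<Union>i<m. A i) \<inter> ?I) t :: complex)
          \<longlonglongrightarrow> indicator ((\<Union>i. A i) \<inter> ?I) t"
      proof (intro AE_I2 tendsto_eventually)
        fix t
        show "\<forall>\<^sub>F m in sequentially. (indicator ((\<Union>i<m. A i) \<inter> ?I) t :: complex)
            = indicator ((\<Union>i. A i) \<inter> ?I) t"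
        proof (cases "\<exists>i. t \<in> A i")
          case True
          then obtain i where "t \<in> A i" by auto
          show ?thesis
            using eventually_gt_at_top[of i]
          proof eventually_elim
            fix m assume "i < m"
            then have "t \<in> (\<Union>i<m. A i)" using \<open>t \<in> A i\<close> by blast
            then show "(indicator ((\<Union>i<m. A i) \<inter> ?I) t :: complex) = indicator ((\<Union>i. A i) \<inter> ?I) t"
              by (auto simp: indicator_def)
          qed
        qed (simp add: indicator_def)
      qed
    qed (use A in \<open>auto simp: indicator_def\<close>)
    then show ?case by (rule closed_sequentially[OF closed fin])
  qed
qed

text \<open>Any element is a dominated limit of simple functions. These are cut off to (-i, i), so
  that each is a finite combination of the bounded indicators treated above.\<close>

lemma closed_subspace_L2_UNIV:
  fixes V :: "L2 set"
  assumes closed: "closed V"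
    and add: "\<And>x y. x \<in> V \<Longrightarrow> y \<in> V \<Longrightarrow> x + y \<in> V"
    and scale: "\<And>c x. x \<in> V \<Longrightarrow> c *\<^sub>C x \<in> V"
    and interval: "\<And>a b. abs_L2 (indicator {a<..<b}) \<in> V"
  shows "x \<in> V"
proof -
  note ind = closed_subspace_contains_indicators[OF closed add scale interval]
  define f where "f = rep_L2 x"
  have f: "square_integrable f" and [measurable]: "f \<in> borel_measurable lborel"
    using square_integrable_rep[of x] by (simp_all add: f_def square_integrable_def)
  obtain s where s: "\<And>i. simple_function lborel (s i)" "\<And>t. (\<lambda>i. s i t) \<longlonglongrightarrow> f t"
    "\<And>i t. cmod (s i t) \<le> 2 * cmod (f t)"
    using borel_measurable_implies_sequence_metric[of f lborel 0] by (auto simp: dist_norm)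
  have sm [measurable]: "s i \<in> borel_measurable lborel" for i
    using s(1) by (rule borel_measurable_simple_function)
  define r where "r i t = s i t * indicator {-real i<..<real i} t" for i t
  have rV: "abs_L2 (r i) \<in> V" for i
  proof -
    let ?I = "{-real i<..<real i}"
    let ?B = "\<lambda>y. s i -` {y}"
    have B: "?B y \<in> sets borel" for y using measurable_sets[OF sm[of i], of "{y}"] by simp
    have finite: "finite (range (s i))" using s(1)[of i] by (simp add: simple_function_def)
    have sqB: "square_integrable (\<lambda>t. y * indicator (?B y \<inter> ?I) t)" for y
      using B by (intro square_integrable_mult square_integrable_indicator) (auto intro: bounded_subset[of ?I])
    have "square_integrable (\<lambda>t. \<Sum>y\<in>Y. y * indicator (?B y \<inter> ?I) t)
        \<and> abs_L2 (\<lambda>t. \<Sum>y\<in>Y. y * indicator (?B y \<inter> ?I) t) \<in> V" if "finite Y" for Y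
      using that
    proof (induction Y rule: finite_induct)
      case empty
      have "abs_L2 (indicator {0<..<0}) \<in> V" by (rule interval)
      moreover have "indicator {0<..<0::real} = (\<lambda>_. 0 :: complex)" by auto
      ultimately show ?case by (simp add: square_integrable_zero)
    next
      case (insert y Y)
      have "y *\<^sub>C abs_L2 (indicator (?B y \<inter> ?I)) \<in> V" by (intro scale ind B)
      then have "abs_L2 (\<lambda>t. y * indicator (?B y \<inter> ?I) t) \<in> V"
        using B[of y] by (subst abs_L2_scaleC[symmetric])
          (auto intro!: square_integrable_indicator intro: bounded_subset[of ?I])
      then show ?case
        unfolding sum.insert[OF insert(1,2)]
      proof (intro conjI square_integrable_add)
        show "abs_L2 (\<lambda>t. y * indicator (?B y \<inter> ?I) t + (\<Sum>y\<in>Y. y * indicator (?B y \<inter> ?I) t)) \<in> V"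
          unfolding abs_L2_add[OF sqB[of y] conjunct1[OF insert.IH], symmetric]
          using add[OF \<open>abs_L2 (\<lambda>t. y * _ t) \<in> V\<close> conjunct2[OF insert.IH]] .
      qed (use sqB[of y] conjunct1[OF insert.IH] in \<open>simp_all only:\<close>)
    qed
    moreover have "r i = (\<lambda>t. \<Sum>y\<in>range (s i). y * indicator (?B y \<inter> ?I) t)"
    proof
      fix t
      have "(\<Sum>y\<in>range (s i). y * indicator (?B y \<inter> ?I) t)
          = (\<Sum>y\<in>range (s i). if y = s i t then s i t * indicator ?I t else 0)"
        by (intro sum.cong) (auto simp: indicator_def)
      then show "r i t = (\<Sum>y\<in>range (s i). y * indicator (?B y \<inter> ?I) t)"
        using finite by (simp add: r_def)
    qed
    ultimately show ?thesis using finite by simp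
  qed
  have "(\<lambda>i. abs_L2 (r i)) \<longlonglongrightarrow> abs_L2 f"
  proof (rule L2_dominated_convergence(3)[where w = "\<lambda>t. 2 * cmod (f t)"])
    show "integrable lborel (\<lambda>t. (2 * cmod (f t))\<^sup>2)"
      using f by (simp add: square_integrable_def power_mult_distrib)
    show "AE t in lborel. (\<lambda>i. r i t) \<longlonglongrightarrow> f t"
    proof (rule AE_I2)
      fix t
      have "\<forall>\<^sub>F i in sequentially. r i t = s i t"
      proof -
        obtain n :: nat where n: "\<bar>t\<bar> < real n" using reals_Archimedean2 by blast
        show ?thesis
          using eventually_ge_at_top[of n]
        proof eventually_elim
          fix i assume "n \<le> i"
          then have "\<bar>t\<bar> < real i" using n by simp
          then show "r i t = s i t" by (auto simp: r_def indicator_def)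
        qed
      qed
      then show "(\<lambda>i. r i t) \<longlonglongrightarrow> f t"
        using s(2)[of t] by (simp add: tendsto_cong)
    qed
    show "cmod (r i t) \<le> 2 * cmod (f t)" for i t
      using s(3)[of i t] by (simp add: r_def indicator_def)
  qed (simp_all add: r_def[abs_def])
  then have "abs_L2 f \<in> V" by (rule closed_sequentially[OF closed rV])
  then show ?thesis by (simp add: f_def)
qed

section \<open>Flat-topped functions that approximate interval indicators\<close>

lemma super_gaussian_bound:
  fixes k u :: real
  assumes "m \<ge> 2"
  shows "\<alpha> * u\<^sup>2 - u ^ (2 * m) \<le> \<alpha>\<^sup>2 / 4 + 1"
proof -
  \<comment> \<open>Reduction to the quartic case, in which completing the square produces
    \<open>\<alpha>\<^sup>2 / 4\<close>.\<close>
  have "u ^ 4 \<le> u ^ (2 * m) + 1"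
  proof (cases "\<bar>u\<bar> \<ge> 1")
    case True
    then have "\<bar>u\<bar> ^ 4 \<le> \<bar>u\<bar> ^ (2 * m)" using assms by (intro power_increasing) auto
    then show ?thesis by (simp add: power_even_abs)
  next
    case False
    then have "\<bar>u\<bar> ^ 4 \<le> 1" by (intro power_le_one) auto
    then have "u ^ 4 \<le> 1" by (simp add: power_even_abs)
    moreover have "0 \<le> u ^ (2 * m)" by (simp add: power_mult)
    ultimately show ?thesis by linarith
  qed
  moreover have "\<alpha> * u\<^sup>2 - u ^ 4 \<le> \<alpha>\<^sup>2 / 4"
    using zero_le_power2[of "u\<^sup>2 - \<alpha> / 2"] by (simp add: power2_diff power_divide power_mult[symmetric] mult.commute)
  ultimately show ?thesis by linarith
qed

text \<open>A majorant independent of \<open>m\<close>, as dominated convergence requires.\<close>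

lemma exp_even_power_le:
  fixes u :: real
  assumes "m \<ge> 2"
  shows "exp (- (u ^ (2 * m))) \<le> exp 2 / (1 + u\<^sup>2)"
proof -
  have p: "1 + u\<^sup>2 > 0" by (simp add: add_pos_nonneg)
  have "1 * u\<^sup>2 - u ^ (2 * m) \<le> 1\<^sup>2 / 4 + 1" by (rule super_gaussian_bound[OF assms])
  then have "exp (- (u ^ (2 * m))) \<le> exp (2 - u\<^sup>2)" by simp
  also have "\<dots> = exp 2 / exp (u\<^sup>2)" by (simp add: exp_diff)
  also have "\<dots> \<le> exp 2 / (1 + u\<^sup>2)"
    using p exp_ge_add_one_self[of "u\<^sup>2"] by (intro divide_left_mono) auto
  finally show ?thesis .
qed

text \<open>Even powers tend to 0 inside the unit interval and to infinity outside. The shift n + 2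
  keeps the exponent at least 4, where the uniform majorant is available.\<close>

lemma tendsto_exp_even_power:
  fixes u :: real
  assumes "\<bar>u\<bar> \<noteq> 1"
  shows "(\<lambda>n. exp (- (u ^ (2 * (n + 2))))) \<longlonglongrightarrow> (if \<bar>u\<bar> < 1 then 1 else 0)"
proof (cases "\<bar>u\<bar> < 1")
  case True
  then have "u\<^sup>2 < 1" by (simp add: abs_square_less_1)
  then have "(\<lambda>n. (u\<^sup>2) ^ n) \<longlonglongrightarrow> 0" by (intro LIMSEQ_power_zero) simp
  then have "(\<lambda>n. exp (- ((u\<^sup>2) ^ (n + 2)))) \<longlonglongrightarrow> exp (- 0)"
    by (intro tendsto_intros) (rule LIMSEQ_ignore_initial_segment)
  then show ?thesis using True by (simp only: power_mult) simp
next
  case False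
  then have "1 < \<bar>u\<bar>" using assms by simp
  then have "1 < u\<^sup>2" by (metis one_less_power pos2 power2_abs)
  then have "filterlim (\<lambda>n. (u\<^sup>2) ^ n) at_top sequentially" 
  proof (intro filterlim_at_infinity_imp_filterlim_at_top filterlim_realpow_sequentially_gt1)
    show "\<forall>\<^sub>F n in sequentially. 0 < (u\<^sup>2) ^ n"
      using less_trans[OF zero_less_one \<open>1 < u\<^sup>2\<close>] by (intro always_eventually allI) (rule zero_less_power)
  qed simp
  then have "filterlim (\<lambda>n. (u\<^sup>2) ^ (n + 2)) at_top sequentially"
    by (rule filterlim_compose) (rule filterlim_add_const_nat_at_top)
  then have "(\<lambda>n. exp (- ((u\<^sup>2) ^ (n + 2)))) \<longlonglongrightarrow> 0"
    by (intro filterlim_compose[OF exp_at_bot]) (simp add: filterlim_uminus_at_top)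
  then show ?thesis using False by (simp only: power_mult) simp
qed

text \<open>A decay of order at least 4 in the exponent beats exp(-t^2 / k) for every k, centre and
  width, and the logarithmic derivative is a polynomial.\<close>

lemma annihilation_equation_solvable_exp_poly:
  fixes k r c :: real
  assumes k: "k > 0" and r: "r > 0" and m: "m \<ge> 2"
  shows "\<exists>f\<in>D0_functions. \<forall>t. of_real t * f t + of_real k * nth_deriv 1 f t
           = complex_of_real (exp (- (((t - c) / r) ^ (2 * m))))"
proof -
  define p where "p = [:- c / r, 1 / r:] ^ (2 * m)"
  have p: "poly p t = ((t - c) / r) ^ (2 * m)" for t
  proof -
    have "poly [:- c / r, 1 / r:] t = (t - c) / r" by (simp add: diff_divide_distrib)
    then show ?thesis by (simp only: p_def poly_power)
  qed
  define g where "g t = exp (- poly p t)" for t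
  have g': "(g has_real_derivative poly (- pderiv p) t * g t) (at t)" for t
    unfolding g_def by (auto intro!: derivative_eq_intros poly_DERIV)
  \<comment> \<open>With t = c + r u one has t^2 / k <= 2 c^2 / k + \<open>\<alpha>\<close> u^2;
    \<open>K\<close> then collects the constants of the quadratic-versus-even-power bound.\<close>
  define \<alpha> where "\<alpha> = 2 * r\<^sup>2 / k"
  define K where "K = exp (2 * c\<^sup>2 / k + (\<alpha>\<^sup>2 / 4 + 1))"
  have "\<bar>g t\<bar> \<le> K * exp (- t\<^sup>2 / k)" for t
  proof -
    define u where "u = (t - c) / r"
    have t: "t = c + r * u" using r by (simp add: u_def)
    have "t\<^sup>2 \<le> 2 * c\<^sup>2 + 2 * r\<^sup>2 * u\<^sup>2"
      using zero_le_power2[of "c - r * u"] by (simp add: t power2_sum power2_diff power_mult_distrib)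
    then have "t\<^sup>2 / k \<le> (2 * c\<^sup>2 + 2 * r\<^sup>2 * u\<^sup>2) / k" using k by (intro divide_right_mono) auto
    also have "\<dots> = 2 * c\<^sup>2 / k + \<alpha> * u\<^sup>2" by (simp add: \<alpha>_def add_divide_distrib)
    finally have "- (u ^ (2 * m)) \<le> 2 * c\<^sup>2 / k + (\<alpha>\<^sup>2 / 4 + 1) + - t\<^sup>2 / k"
      using super_gaussian_bound[OF m, of \<alpha> u] by simp
    then have "exp (- (u ^ (2 * m))) \<le> exp (2 * c\<^sup>2 / k + (\<alpha>\<^sup>2 / 4 + 1) + - t\<^sup>2 / k)" by simp
    also have "\<dots> = K * exp (- t\<^sup>2 / k)" unfolding K_def by (simp only: exp_add)
    finally show ?thesis by (simp add: g_def p u_def)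
  qed
  from annihilation_equation_solvable[OF k g' this] show ?thesis by (simp add: g_def p)
qed

lemma square_integrable_exp2_inverse:
  assumes r: "r > 0"
  shows "integrable lborel (\<lambda>t. (exp 2 / (1 + ((t - c) / r)\<^sup>2))\<^sup>2 :: real)"
proof -
  define w where "w t = complex_of_real (1 / (1 + ((t - c) / r)\<^sup>2))" for t
  have p: "1 + u\<^sup>2 > 0" for u :: real by (simp add: add_pos_nonneg)
  have w1: "cmod (w t) \<le> 1 + \<bar>c\<bar> + r" for t
  proof -
    have "1 / (1 + ((t - c) / r)\<^sup>2) \<le> 1" by (subst divide_le_eq_1_pos[OF p]) simp
    moreover have "\<bar>1 / (1 + ((t - c) / r)\<^sup>2)\<bar> = 1 / (1 + ((t - c) / r)\<^sup>2)"
      using p[of "(t - c) / r"] by (intro abs_of_pos divide_pos_pos) auto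
    ultimately show ?thesis using r unfolding w_def norm_of_real by linarith
  qed
  have w2: "cmod (of_real t * w t) \<le> 1 + \<bar>c\<bar> + r" for t
  proof -
    define u where "u = (t - c) / r"
    have t: "t = c + r * u" using r by (simp add: u_def)
    have "2 * \<bar>u\<bar> \<le> 1 + u\<^sup>2" using zero_le_power2[of "\<bar>u\<bar> - 1"] by (simp add: power2_diff)
    then have u: "\<bar>u\<bar> \<le> 1 + u\<^sup>2" by linarith
    have "\<bar>t\<bar> \<le> \<bar>c\<bar> * 1 + r * \<bar>u\<bar>" unfolding t using r by (metis abs_mult abs_of_pos abs_triangle_ineq mult_1_right)
    also have "\<dots> \<le> \<bar>c\<bar> * (1 + u\<^sup>2) + r * (1 + u\<^sup>2)"
      using u r by (intro add_mono mult_left_mono) auto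
    also have "\<dots> \<le> (1 + \<bar>c\<bar> + r) * (1 + u\<^sup>2)" using p[of u] by (simp add: algebra_simps)
    finally have "\<bar>t\<bar> / (1 + u\<^sup>2) \<le> 1 + \<bar>c\<bar> + r" using p[of u] by (simp add: pos_divide_le_eq)
    moreover have "cmod (of_real t * w t) = \<bar>t\<bar> / (1 + u\<^sup>2)"
      using p[of u] by (simp add: w_def u_def norm_mult norm_divide abs_of_pos del: of_real_divide of_real_add of_real_power)
    ultimately show ?thesis by simp
  qed
  have "continuous_on UNIV w" unfolding w_def using p r
    by (intro continuous_intros) (auto simp: less_imp_neq[OF p, symmetric])
  from decay_square_integrable(1)[OF this w1 w2] have "square_integrable w" .
  then have "integrable lborel (\<lambda>t. (exp 2)\<^sup>2 * (cmod (w t))\<^sup>2)"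
    by (simp add: square_integrable_def)
  moreover have "(exp 2)\<^sup>2 * (cmod (w t))\<^sup>2 = (exp 2 / (1 + ((t - c) / r)\<^sup>2))\<^sup>2" for t
    unfolding w_def norm_of_real by (simp add: power_divide)
  ultimately show ?thesis by simp
qed

text \<open>The closure of the range is a closed complex subspace, so it suffices that it contains
  the interval indicators; these are limits of flat-topped right-hand sides for which the equation
  is solvable.\<close>

lemma annihilation_range_dense:
  fixes k :: real
  assumes k: "k > 0" and e: "e > 0"
  shows "\<exists>f\<in>D0_functions. norm (abs_L2 (\<lambda>t. of_real t * f t + of_real k * nth_deriv 1 f t) - y) < e"
proof -
  define W where "W f t = of_real t * f t + of_real k * nth_deriv 1 f t" for f and t :: real
  have sqW: "square_integrable (W f)" if "f \<in> D0_functions" for f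
    unfolding W_def[abs_def] using D0_functions_deriv[OF that]
    by (intro square_integrable_add square_integrable_mult) auto
  have Wadd: "W (\<lambda>t. f t + g t) = (\<lambda>t. W f t + W g t)" if "f \<in> D0_functions" "g \<in> D0_functions" for f g
    using that by (simp add: W_def[abs_def] nth_deriv_add D0_functions_smooth algebra_simps)
  have Wscale: "W (\<lambda>t. c * f t) = (\<lambda>t. c * W f t)" if "f \<in> D0_functions" for c f
    using that by (simp add: W_def[abs_def] nth_deriv_cmult D0_functions_smooth algebra_simps)
  define R where "R = (\<lambda>f. abs_L2 (W f)) ` D0_functions"
  have Radd: "x + y \<in> R" if xy: "x \<in> R" "y \<in> R" for x y
  proof -
    obtain f g where fg: "f \<in> D0_functions" "g \<in> D0_functions" "x = abs_L2 (W f)" "y = abs_L2 (W g)"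
      using xy unfolding R_def by blast
    then have "x + y = abs_L2 (W (\<lambda>t. f t + g t))" by (simp add: abs_L2_add sqW Wadd)
    then show ?thesis unfolding R_def using fg D0_functions_add by blast
  qed
  have Rscale: "c *\<^sub>C x \<in> R" if x: "x \<in> R" for c x
  proof -
    obtain f where f: "f \<in> D0_functions" "x = abs_L2 (W f)" using x unfolding R_def by blast
    then have "c *\<^sub>C x = abs_L2 (W (\<lambda>t. c * f t))" by (simp add: abs_L2_scaleC sqW Wscale)
    then show ?thesis unfolding R_def using f D0_functions_cmult by blast
  qed
  have interval: "abs_L2 (indicator {a<..<b}) \<in> closure R" for a b
  proof (cases "a < b")
    case True
    define c r where "c = (a + b) / 2" and "r = (b - a) / 2"
    have r: "r > 0" using True by (simp add: r_def)
    define g where "g n t = complex_of_real (exp (- (((t - c) / r) ^ (2 * (n + 2)))))" for n :: nat and t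
    have gR: "abs_L2 (g n) \<in> R" for n
    proof -
      obtain f where "f \<in> D0_functions" "\<And>t. W f t = g n t"
        using annihilation_equation_solvable_exp_poly[OF k r, of "n + 2" c] by (auto simp: W_def g_def)
      moreover from this have "W f = g n" by auto
      ultimately show ?thesis unfolding R_def by (metis image_eqI)
    qed
    have "(\<lambda>n. abs_L2 (g n)) \<longlonglongrightarrow> abs_L2 (indicator {a<..<b})"
    proof (rule L2_dominated_convergence(3)[where w = "\<lambda>t. exp 2 / (1 + ((t - c) / r)\<^sup>2)"])
      show "g n \<in> borel_measurable lborel" for n unfolding g_def by measurable
      show "integrable lborel (\<lambda>t. (exp 2 / (1 + ((t - c) / r)\<^sup>2))\<^sup>2)"
        by (rule square_integrable_exp2_inverse[OF r])
      show "cmod (g n t) \<le> exp 2 / (1 + ((t - c) / r)\<^sup>2)" for n t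
        using exp_even_power_le[of "n + 2" "(t - c) / r"] unfolding g_def norm_of_real by simp
      show "AE t in lborel. (\<lambda>n. g n t) \<longlonglongrightarrow> indicator {a<..<b} t"
        \<comment> \<open>The endpoints correspond to |u| = 1, where the limit would be exp(-1);
          they form a null set.\<close>
        using AE_lborel_singleton[of a] AE_lborel_singleton[of b]
      proof eventually_elim
        fix t assume t: "t \<noteq> a" "t \<noteq> b"
        define u where "u = (t - c) / r"
        have t_eq: "t = c + r * u" and a_eq: "a = c + r * (- 1)" and b_eq: "b = c + r * 1"
          using r by (simp_all add: u_def c_def r_def field_simps)
        have "\<bar>u\<bar> \<noteq> 1" using t r by (auto simp: t_eq a_eq b_eq abs_if split: if_splits)
        from tendsto_exp_even_power[OF this]
        have "(\<lambda>n. g n t) \<longlonglongrightarrow> complex_of_real (if \<bar>u\<bar> < 1 then 1 else 0)"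
          unfolding g_def u_def by (rule tendsto_of_real)
        moreover have "\<bar>u\<bar> < 1 \<longleftrightarrow> t \<in> {a<..<b}"
        proof -
          have "a < t \<longleftrightarrow> - 1 < u" unfolding t_eq a_eq using r by (simp only: add_less_cancel_left mult_less_cancel_left_pos)
          moreover have "t < b \<longleftrightarrow> u < 1" unfolding t_eq b_eq using r by (simp only: add_less_cancel_left mult_less_cancel_left_pos)
          ultimately show ?thesis by auto
        qed
        then have "complex_of_real (if \<bar>u\<bar> < 1 then 1 else 0) = indicator {a<..<b} t" by (simp add: indicator_def)
        ultimately show "(\<lambda>n. g n t) \<longlonglongrightarrow> indicator {a<..<b} t" by (simp only:)
      qed
    qed simp
    then show ?thesis
      unfolding closure_sequential using gR by (intro exI[of _ "\<lambda>n. abs_L2 (g n)"]) simp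
  next
    case False
    have "(\<lambda>_. 0) \<in> D0_functions"
      using schwartz_family_subset_D0_functions[of "{\<lambda>_. 0}"] by auto
    moreover from Wscale[OF this, of 0] have "W (\<lambda>_. 0) = (\<lambda>_. 0)" by simp
    moreover have "indicator {a<..<b} = (\<lambda>_. 0 :: complex)" using False by auto
    ultimately have "abs_L2 (indicator {a<..<b}) \<in> R" unfolding R_def by (metis image_eqI)
    then show ?thesis using closure_subset by blast
  qed
  have "y \<in> closure R"
  proof (rule closed_subspace_L2_UNIV[OF closed_closure _ _ interval])
    show "x + y \<in> closure R" if xy: "x \<in> closure R" "y \<in> closure R" for x y
    proof -
      obtain u v where "\<And>n. u n \<in> R" "u \<longlonglongrightarrow> x" "\<And>n. v n \<in> R" "v \<longlonglongrightarrow> y"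
        using xy unfolding closure_sequential by blast
      then show ?thesis unfolding closure_sequential
        by (intro exI[of _ "\<lambda>n. u n + v n"]) (auto intro: tendsto_add Radd)
    qed
    show "c *\<^sub>C x \<in> closure R" if x: "x \<in> closure R" for c x
    proof -
      obtain u where "\<And>n. u n \<in> R" "u \<longlonglongrightarrow> x" using x unfolding closure_sequential by blast
      then show ?thesis unfolding closure_sequential
        by (intro exI[of _ "\<lambda>n. c *\<^sub>C u n"]) (auto intro: tendsto_scaleC Rscale)
    qed
  qed
  then obtain x where "x \<in> R" "dist x y < e" using e unfolding closure_approachable by blast
  then show ?thesis unfolding R_def dist_norm W_def[abs_def] by blast
qed

section \<open>Compactness\<close>

lemma integral_cmod_square_le:
  assumes "continuous_on UNIV f" "square_integrable f"
  shows "integral {a..b} (\<lambda>t. (cmod (f t))\<^sup>2) \<le> (norm (abs_L2 f))\<^sup>2"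
proof -
  have int: "integrable lborel (\<lambda>t. (cmod (f t))\<^sup>2)" using assms(2) by (simp add: square_integrable_def)
  then have set_int: "set_integrable lborel {a..b} (\<lambda>t. (cmod (f t))\<^sup>2)"
    unfolding set_integrable_def by (intro integrable_mult_indicator) auto
  have "integral {a..b} (\<lambda>t. (cmod (f t))\<^sup>2) = (LINT t:{a..b}|lborel. (cmod (f t))\<^sup>2)"
    using set_borel_integral_eq_integral(2)[OF set_int] by simp
  also have "\<dots> \<le> (\<integral>t. (cmod (f t))\<^sup>2 \<partial>lborel)"
    unfolding set_lebesgue_integral_def using set_int int
    by (intro integral_mono) (auto simp: set_integrable_def indicator_def)
  also have "\<dots> = (norm (abs_L2 f))\<^sup>2"
    by (simp add: norm_abs_L2[OF assms(2)] Bochner_Integration.integral_nonneg)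
  finally show ?thesis .
qed

text \<open>Integrates the pointwise inequality |g| <= a |g|^2 + 1/a for g = f' in place of
  Cauchy-Schwarz for integrals, which gives c^2 + 1 instead of c.\<close>

lemma D0_functions_hoelder:
  assumes f: "f \<in> D0_functions" and c: "norm (abs_L2 (nth_deriv 1 f)) \<le> c"
  shows "cmod (f t - f s) \<le> sqrt \<bar>t - s\<bar> * (c\<^sup>2 + 1)"
proof -
  have *: "cmod (f t - f s) \<le> sqrt (t - s) * (c\<^sup>2 + 1)" if st: "s < t" for s t
  proof -
    \<comment> \<open>Balances the two integrated terms: a c^2 from the derivative against (t - s) /
      a = a from the constant.\<close>
    define a where "a = sqrt (t - s)"
    have a: "a > 0" "a\<^sup>2 = t - s" using st by (auto simp: a_def)
    let ?g = "nth_deriv 1 f"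
    have cont: "continuous_on UNIV ?g" by (rule D0_functions_deriv(3)[OF f])
    have gi: "(?g has_integral (f t - f s)) {s..t}"
      using st
      by (intro fundamental_theorem_of_calculus)
         (simp, rule has_vector_derivative_at_within[OF D0_functions_deriv(1)[OF f]])
    have sq: "(\<lambda>x. (cmod (?g x))\<^sup>2) integrable_on {s..t}"
      by (intro integrable_continuous_interval continuous_intros continuous_on_subset[OF cont]) simp
    then have bi: "(\<lambda>x. a * (cmod (?g x))\<^sup>2 + 1 / a) integrable_on {s..t}"
      by (intro integrable_add integrable_on_mult_right integrable_const_ivl)
    have "cmod (integral {s..t} ?g) \<le> integral {s..t} (\<lambda>x. a * (cmod (?g x))\<^sup>2 + 1 / a)"
    proof (rule integral_norm_bound_integral)
      fix x
      have "2 * (a * cmod (?g x)) \<le> (a * cmod (?g x))\<^sup>2 + 1"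
        using zero_le_power2[of "a * cmod (?g x) - 1"] by (simp add: power2_diff)
      moreover have "0 \<le> (a * cmod (?g x))\<^sup>2 + 1" by simp
      ultimately have "a * cmod (?g x) \<le> (a * cmod (?g x))\<^sup>2 + 1" by linarith
      also have "\<dots> = a * (a * (cmod (?g x))\<^sup>2 + 1 / a)"
        using a by (simp add: power2_eq_square distrib_left)
      finally show "cmod (?g x) \<le> a * (cmod (?g x))\<^sup>2 + 1 / a" using a by simp
    qed (use gi bi in auto)
    also have "\<dots> = a * integral {s..t} (\<lambda>x. (cmod (?g x))\<^sup>2) + (t - s) / a"
      using sq st by (subst Henstock_Kurzweil_Integration.integral_add)
        (auto intro: integrable_on_mult_right simp del: One_nat_def)
    also have "\<dots> \<le> a * c\<^sup>2 + a"
    proof (intro add_mono mult_left_mono)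
      have "integral {s..t} (\<lambda>x. (cmod (?g x))\<^sup>2) \<le> (norm (abs_L2 ?g))\<^sup>2"
        by (rule integral_cmod_square_le[OF cont D0_functions_deriv(2)[OF f]])
      also have "\<dots> \<le> c\<^sup>2" using c by (intro power_mono) auto
      finally show "integral {s..t} (\<lambda>x. (cmod (?g x))\<^sup>2) \<le> c\<^sup>2" .
      show "(t - s) / a \<le> a" using a by (simp add: a(2)[symmetric] power2_eq_square)
    qed (use a in simp)
    finally show ?thesis unfolding integral_unique[OF gi] by (simp add: a_def algebra_simps)
  qed
  show ?thesis
    using *[of s t] *[of t s] by (cases s t rule: linorder_cases) (auto simp: norm_minus_commute)
qed

text \<open>On an interval of length 1 the function varies by at most c^2 + 1, so a larger value
  would keep |f| above c there and make the L2 norm exceed c.\<close>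

lemma D0_functions_bounded:
  assumes f: "f \<in> D0_functions" and c: "norm (abs_L2 (nth_deriv 1 f)) \<le> c" "norm (abs_L2 f) \<le> c"
  shows "cmod (f t) \<le> c\<^sup>2 + 1 + c"
proof (rule ccontr)
  define H where "H = c\<^sup>2 + 1"
  assume "\<not> ?thesis"
  then have gt: "cmod (f t) - H > c" by (simp add: H_def)
  have c0: "c \<ge> 0" using c(2) by (meson norm_ge_zero order_trans)
  have cont: "continuous_on UNIV f" by (rule D0_functions_continuous[OF f])
  have "integral {t..t+1} (\<lambda>s. (cmod (f t) - H)\<^sup>2) \<le> integral {t..t+1} (\<lambda>s. (cmod (f s))\<^sup>2)"
  proof (rule integral_le)
    show "(\<lambda>s. (cmod (f s))\<^sup>2) integrable_on {t..t + 1}"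
      by (intro integrable_continuous_interval continuous_intros continuous_on_subset[OF cont]) simp
    fix s assume s: "s \<in> {t..t+1}"
    have "sqrt \<bar>s - t\<bar> * H \<le> 1 * H"
      unfolding H_def using s by (intro mult_right_mono) auto
    then have "cmod (f s - f t) \<le> H"
      using D0_functions_hoelder[OF f c(1), of s t] by (simp add: H_def)
    then have "cmod (f t) - H \<le> cmod (f s)"
      using norm_triangle_ineq3[of "f s" "f t"] by linarith
    then show "(cmod (f t) - H)\<^sup>2 \<le> (cmod (f s))\<^sup>2"
      using gt c0 by (intro power_mono) auto
  qed (rule integrable_const_ivl)
  also have "\<dots> \<le> (norm (abs_L2 f))\<^sup>2"
    by (rule integral_cmod_square_le[OF cont D0_functions_square_integrable[OF f]])
  also have "\<dots> \<le> c\<^sup>2" using c by (intro power_mono) auto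
  finally have "(cmod (f t) - H)\<^sup>2 \<le> c\<^sup>2" by simp
  then have "\<bar>cmod (f t) - H\<bar> \<le> \<bar>c\<bar>" by (simp add: abs_le_square_iff)
  then show False using gt c0 by linarith
qed

text \<open>Outside the interval |h| <= |t h| / R, which controls the tail.\<close>

lemma norm_L2_le_of_small_on_interval:
  assumes h: "square_integrable h" and th: "square_integrable (\<lambda>t. of_real t * h t)"
    and small: "\<And>t. t \<in> {-R..R} \<Longrightarrow> cmod (h t) \<le> \<eta>" and R: "R > 0"
  shows "(norm (abs_L2 h))\<^sup>2 \<le> 2 * R * \<eta>\<^sup>2 + (norm (abs_L2 (\<lambda>t. of_real t * h t)))\<^sup>2 / R\<^sup>2"
proof -
  have n: "(norm (abs_L2 g))\<^sup>2 = (\<integral>t. (cmod (g t))\<^sup>2 \<partial>lborel)" if "square_integrable g" for g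
    by (simp add: norm_abs_L2[OF that] Bochner_Integration.integral_nonneg)
  have i1: "integrable lborel (\<lambda>t. \<eta>\<^sup>2 * indicator {-R..R} t :: real)"
    using R by (intro integrable_mult_right integrable_real_indicator) auto
  have i2: "integrable lborel (\<lambda>t. (cmod (of_real t * h t))\<^sup>2 / R\<^sup>2)"
    using th by (intro integrable_divide) (simp add: square_integrable_def)
  have "(\<integral>t. (cmod (h t))\<^sup>2 \<partial>lborel)
      \<le> (\<integral>t. \<eta>\<^sup>2 * indicator {-R..R} t + (cmod (of_real t * h t))\<^sup>2 / R\<^sup>2 \<partial>lborel)"
  proof (rule integral_mono)
    show "integrable lborel (\<lambda>t. (cmod (h t))\<^sup>2)" using h by (simp add: square_integrable_def)
    fix t
    show "(cmod (h t))\<^sup>2 \<le> \<eta>\<^sup>2 * indicator {-R..R} t + (cmod (of_real t * h t))\<^sup>2 / R\<^sup>2"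
    proof (cases "t \<in> {-R..R}")
      case True
      then have "(cmod (h t))\<^sup>2 \<le> \<eta>\<^sup>2" using small by (intro power_mono) auto
      moreover have "0 \<le> (cmod (of_real t * h t))\<^sup>2 / R\<^sup>2" by simp
      ultimately have "(cmod (h t))\<^sup>2 + 0 \<le> \<eta>\<^sup>2 + (cmod (of_real t * h t))\<^sup>2 / R\<^sup>2" by (rule add_mono)
      then show ?thesis using True by (simp add: indicator_def)
    next
      case False
      then have "R * cmod (h t) \<le> \<bar>t\<bar> * cmod (h t)" using R by (intro mult_right_mono) auto
      then have "(R * cmod (h t))\<^sup>2 \<le> (cmod (of_real t * h t))\<^sup>2"
        using R by (intro power_mono) (auto simp: norm_mult)
      then have "(cmod (h t))\<^sup>2 \<le> (cmod (of_real t * h t))\<^sup>2 / R\<^sup>2"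
        using R by (simp add: pos_le_divide_eq power_mult_distrib mult.commute)
      then show ?thesis using False by (auto simp: indicator_def)
    qed
  qed (intro Bochner_Integration.integrable_add i1 i2)
  also have "\<dots> = 2 * R * \<eta>\<^sup>2 + (\<integral>t. (cmod (of_real t * h t))\<^sup>2 \<partial>lborel) / R\<^sup>2"
    using R by (subst Bochner_Integration.integral_add[OF i1 i2]) simp
  finally show ?thesis by (simp only: n[OF h] n[OF th])
qed

text \<open>The bound on f' gives equicontinuity, hence uniform convergence of a subsequence on
  [-R, R] by Arzela-Ascoli; the bound on t f makes the tails uniformly small.\<close>

lemma D0_functions_precompact:
  fixes f :: "nat \<Rightarrow> real \<Rightarrow> complex"
  assumes f: "\<And>n. f n \<in> D0_functions"
    and c: "\<And>n. norm (abs_L2 (f n)) \<le> c" "\<And>n. norm (abs_L2 (\<lambda>t. of_real t * f n t)) \<le> c"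
      "\<And>n. norm (abs_L2 (nth_deriv 1 (f n))) \<le> c"
    and e: "e > 0"
  shows "\<exists>m n. m < n \<and> norm (abs_L2 (f n) - abs_L2 (f m)) < e"
proof -
  have c0: "c \<ge> 0" using c(1)[of 0] by (meson norm_ge_zero order_trans)
  \<comment> \<open>The difference has t h of norm at most 2c, so the tail contributes (2c / R)^2 <=
    e^2 / 4; c + 1 keeps \<open>R\<close> positive when c = 0.\<close>
  define R where "R = 4 * (c + 1) / e"
  have R: "R > 0" using c0 e by (simp add: R_def)
  \<comment> \<open>Chosen so that the interval contributes e^2 / 4 as well, which leaves a total of
    e^2 / 2.\<close>
  define \<eta> where "\<eta> = sqrt (e\<^sup>2 / (8 * R))"
  have \<eta>: "\<eta> > 0" "2 * R * \<eta>\<^sup>2 = e\<^sup>2 / 4" using R e by (auto simp: \<eta>_def)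
  obtain g k where k: "strict_mono (k :: nat \<Rightarrow> nat)"
    and lim: "\<And>d. 0 < d \<Longrightarrow> \<exists>N. \<forall>n x. n \<ge> N \<and> x \<in> {-R..R} \<longrightarrow> cmod (f (k n) x - g x) < d"
  proof (rule Arzela_Ascoli[of "{-R..R}" f "c\<^sup>2 + 1 + c"])
    show "cmod (f n x) \<le> c\<^sup>2 + 1 + c" for n x by (rule D0_functions_bounded[OF f c(3) c(1)])
    show "\<exists>d>0. \<forall>n y. y \<in> {-R..R} \<and> norm (x - y) < d \<longrightarrow> cmod (f n x - f n y) < d'"
      if d': "d' > 0" for x d'
    proof (intro exI conjI allI impI)
      have H: "c\<^sup>2 + 1 > 0" by (simp add: add_nonneg_pos)
      show "0 < (d' / (c\<^sup>2 + 1))\<^sup>2" using d' H by simp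
      fix n y assume y: "y \<in> {-R..R} \<and> norm (x - y) < (d' / (c\<^sup>2 + 1))\<^sup>2"
      then have "sqrt \<bar>x - y\<bar> < sqrt ((d' / (c\<^sup>2 + 1))\<^sup>2)" by (intro real_sqrt_less_mono) simp
      then have "sqrt \<bar>x - y\<bar> < d' / (c\<^sup>2 + 1)" using d' H by simp
      then have "sqrt \<bar>x - y\<bar> * (c\<^sup>2 + 1) < d'" using H by (simp add: pos_less_divide_eq)
      then show "cmod (f n x - f n y) < d'"
        using D0_functions_hoelder[OF f c(3), of n x y] by linarith
    qed
  qed (auto intro: that)
  obtain N where N: "\<And>n x. n \<ge> N \<Longrightarrow> x \<in> {-R..R} \<Longrightarrow> cmod (f (k n) x - g x) < \<eta> / 2"
    using lim[of "\<eta> / 2"] \<eta> by auto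
  let ?m = "k N" and ?n = "k (Suc N)"
  define h where "h t = f ?n t - f ?m t" for t
  have small: "cmod (h t) \<le> \<eta>" if "t \<in> {-R..R}" for t
    using N[of N t] N[of "Suc N" t] that norm_triangle_ineq4[of "f ?n t - g t" "f ?m t - g t"]
    by (simp add: h_def)
  note sq = D0_functions_square_integrable[OF f] and sqt = D0_functions_deriv(4)[OF f]
  have th: "(\<lambda>t. of_real t * h t) = (\<lambda>t. of_real t * f ?n t - of_real t * f ?m t)"
    by (simp add: h_def algebra_simps)
  have sqh: "square_integrable h" "square_integrable (\<lambda>t. of_real t * h t)"
    unfolding th unfolding h_def by (intro square_integrable_diff sq sqt)+
  have "norm (abs_L2 (\<lambda>t. of_real t * h t)) \<le> 2 * c"
    unfolding th abs_L2_diff[OF sqt sqt, symmetric]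
    using norm_triangle_ineq4 c(2)[of ?n] c(2)[of ?m] by (smt (verit))
  then have "(norm (abs_L2 (\<lambda>t. of_real t * h t)))\<^sup>2 / R\<^sup>2 \<le> (2 * c)\<^sup>2 / R\<^sup>2"
    by (intro divide_right_mono power_mono) auto
  also have "\<dots> = (e / 2 * (c / (c + 1)))\<^sup>2"
  proof -
    have "4 * c + 4 \<noteq> 0" "2 * c + 2 \<noteq> 0" using c0 by linarith+
    then have "2 * c / R = e / 2 * (c / (c + 1))"
      using e by (simp add: R_def) (simp add: frac_eq_eq algebra_simps)
    then show ?thesis by (simp only: power_divide[symmetric])
  qed
  also have "\<dots> \<le> (e / 2 * 1)\<^sup>2"
    using c0 e by (intro power_mono mult_left_mono) auto
  finally have "(norm (abs_L2 h))\<^sup>2 \<le> e\<^sup>2 / 4 + (e / 2 * 1)\<^sup>2"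
    using norm_L2_le_of_small_on_interval[OF sqh small R] \<eta>(2) by linarith
  also have "\<dots> < e\<^sup>2" using e by (simp add: power_divide)
  finally have "norm (abs_L2 h) < e" using e by (simp add: power2_less_imp_less)
  moreover have "abs_L2 h = abs_L2 (f ?n) - abs_L2 (f ?m)"
    unfolding abs_L2_diff[OF sq sq] by (simp add: h_def[abs_def])
  moreover have "?m < ?n" using k by (simp add: strict_mono_less)
  ultimately show ?thesis by auto
qed

section \<open>Perturbations of position and momentum\<close>

lemma subspace_D0: "subspace D0"
  unfolding subspace_def
proof (intro conjI ballI allI)
  have "(\<lambda>_. 0) \<in> D0_functions"
    using schwartz_family_subset_D0_functions[of "{\<lambda>_. 0}"] by auto
  then show "0 \<in> D0" unfolding D0_def zero_L2_def by (rule imageI)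
next
  fix x y assume "x \<in> D0" "y \<in> D0"
  then obtain f g where "f \<in> D0_functions" "g \<in> D0_functions" "x = abs_L2 f" "y = abs_L2 g"
    unfolding D0_def by blast
  then show "x + y \<in> D0"
    unfolding D0_def by (auto simp: abs_L2_add D0_functions_square_integrable intro: D0_functions_add)
next
  fix c :: real and x assume "x \<in> D0"
  then obtain f where "f \<in> D0_functions" "x = abs_L2 f" unfolding D0_def by blast
  then show "c *\<^sub>R x \<in> D0"
    unfolding D0_def scaleR_scaleC by (auto simp: abs_L2_scaleC D0_functions_square_integrable intro: D0_functions_cmult)
qed

text \<open>Covers position, momentum and the annihilation operator alike.\<close>

lemma linear_on_D0I:
  assumes T: "\<And>f. f \<in> D0_functions \<Longrightarrow> T (abs_L2 f) = abs_L2 (\<lambda>t. a t * f t + b * nth_deriv 1 f t)"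
    and sq: "\<And>f. f \<in> D0_functions \<Longrightarrow> square_integrable (\<lambda>t. a t * f t)"
  shows "linear_on_subspace D0 T"
proof -
  have sq': "square_integrable (\<lambda>t. a t * f t + b * nth_deriv 1 f t)" if "f \<in> D0_functions" for f
    by (intro square_integrable_add square_integrable_mult sq D0_functions_deriv(2) that)
  show ?thesis
    unfolding linear_on_subspace_def
  proof (intro conjI ballI allI)
    fix x y assume "x \<in> D0" "y \<in> D0"
    then obtain f g where fg: "f \<in> D0_functions" "g \<in> D0_functions" "x = abs_L2 f" "y = abs_L2 g"
      unfolding D0_def by blast
    have "T (x + y) = T (abs_L2 (\<lambda>t. f t + g t))"
      using fg by (simp add: abs_L2_add D0_functions_square_integrable)
    also have "\<dots> = abs_L2 (\<lambda>t. (a t * f t + b * nth_deriv 1 f t) + (a t * g t + b * nth_deriv 1 g t))"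
      unfolding T[OF D0_functions_add[OF fg(1,2)]]
        nth_deriv_add[OF D0_functions_smooth[OF fg(1)] D0_functions_smooth[OF fg(2)]]
      by (simp add: algebra_simps)
    also have "\<dots> = T x + T y"
      unfolding fg(3,4) T[OF fg(1)] T[OF fg(2)] by (rule abs_L2_add[OF sq'[OF fg(1)] sq'[OF fg(2)], symmetric])
    finally show "T (x + y) = T x + T y" .
  next
    fix c :: real and x assume "x \<in> D0"
    then obtain f where f: "f \<in> D0_functions" "x = abs_L2 f" unfolding D0_def by blast
    have "T (c *\<^sub>R x) = T (abs_L2 (\<lambda>t. of_real c * f t))"
      using f by (simp add: scaleR_scaleC abs_L2_scaleC D0_functions_square_integrable)
    also have "\<dots> = abs_L2 (\<lambda>t. of_real c * (a t * f t + b * nth_deriv 1 f t))"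
      unfolding T[OF D0_functions_cmult[OF f(1)]] nth_deriv_cmult[OF D0_functions_smooth[OF f(1)]]
      by (simp add: algebra_simps)
    also have "\<dots> = c *\<^sub>R T x"
      unfolding f(2) T[OF f(1)] scaleR_scaleC by (rule abs_L2_scaleC[OF sq'[OF f(1)], symmetric])
    finally show "T (c *\<^sub>R x) = c *\<^sub>R T x" .
  qed
qed

lemma linear_on_subspace_position: "linear_on_subspace D0 (\<lambda>x. the (position x))"
  by (rule linear_on_D0I[where a = of_real and b = 0])
     (simp_all add: position_abs D0_functions_deriv(4))

lemma linear_on_subspace_momentum: "linear_on_subspace D0 (\<lambda>x. the (momentum hbar x))"
  by (rule linear_on_D0I[where a = "\<lambda>_. 0" and b = "- \<i> * of_real hbar"])
     (simp_all add: momentum_abs square_integrable_zero)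

text \<open>Homogeneity of both operators carries the finite supremum over unit vectors to an
  inequality on all of \<open>D0\<close>.\<close>

lemma norm_op_diff_bound:
  assumes S: "dom S = D0" "linear_on_subspace D0 (\<lambda>x. the (S x))"
    and h: "selfadjoint h" "D0 \<subseteq> dom h"
    and fin: "norm_op (diff_op S h |` D0) \<noteq> top"
  shows "\<exists>C\<ge>0. \<forall>x\<in>D0. norm (the (S x) - the (h x)) \<le> C * norm x"
proof -
  interpret selfadjoint h by fact
  define C where "C = enn2real (norm_op (diff_op S h |` D0))"
  have C: "ennreal C = norm_op (diff_op S h |` D0)"
    using fin by (simp add: C_def ennreal_enn2real_if)
  have val: "(diff_op S h |` D0) x = Some (the (S x) - ap x)" if "x \<in> D0" for x
    using that S h by (auto simp: diff_op_def restrict_map_def)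
  have unit: "norm (the (S x) - ap x) \<le> C" if x: "x \<in> D0" "norm x = 1" for x
  proof -
    have "ennreal (norm (the ((diff_op S h |` D0) x))) \<le> norm_op (diff_op S h |` D0)"
      unfolding norm_op_def using val[OF x(1)] x by (intro SUP_upper) auto
    then have "ennreal (norm (the (S x) - ap x)) \<le> ennreal C" by (simp add: C val[OF x(1)])
    then show ?thesis by (simp add: C_def)
  qed
  have "norm (the (S x) - ap x) \<le> C * norm x" if x: "x \<in> D0" for x
  proof (cases "x = 0")
    case True
    then show ?thesis
      using linear_on_subspaceD(3)[OF S(2) subspace_D0] ap_diff[OF zero_dom zero_dom] by simp
  next
    case False
    let ?c = "inverse (norm x)"
    have cx: "?c *\<^sub>R x \<in> D0" using x by (simp add: subspace_D0 subspace_scale)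
    have "norm (the (S (?c *\<^sub>R x)) - ap (?c *\<^sub>R x)) \<le> C" using False by (intro unit cx) simp
    also have "the (S (?c *\<^sub>R x)) - ap (?c *\<^sub>R x) = ?c *\<^sub>R (the (S x) - ap x)"
    proof -
      have "ap (?c *\<^sub>R x) = ?c *\<^sub>R ap x"
        unfolding scaleR_scaleC by (rule ap_scale[OF subsetD[OF h(2) x]])
      then show ?thesis
        using linear_on_subspaceD(2)[OF S(2) subspace_D0 x, of ?c] by (simp only: scaleR_diff_right)
    qed
    also have "norm (?c *\<^sub>R (the (S x) - ap x)) = norm (the (S x) - ap x) / norm x"
      by (simp only: norm_scaleR abs_inverse abs_norm_cancel divide_inverse mult.commute)
    finally show ?thesis using False by (simp add: pos_divide_le_eq)
  qed
  moreover have "C \<ge> 0" by (simp add: C_def)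
  ultimately show ?thesis by blast
qed

text \<open>When the complex inner product is real, \<open>a\<close> and the multiple of
  \<open>b\<close> by the imaginary unit are orthogonal in the real sense, and Pythagoras
  applies.\<close>

lemma norm_add_i_scaleC:
  fixes s :: real
  assumes "Im (cinner a b) = 0" "\<bar>s\<bar> = 1"
  shows "(norm (a + (\<i> * of_real s) *\<^sub>C b))\<^sup>2 = (norm a)\<^sup>2 + (norm b)\<^sup>2"
proof -
  have "inner a ((\<i> * of_real s) *\<^sub>C b) = 0"
    using assms(1) by (simp add: inner_eq_Re_cinner cinner_scaleC_right)
  then have "(norm (a + (\<i> * of_real s) *\<^sub>C b))\<^sup>2 = (norm a)\<^sup>2 + (norm ((\<i> * of_real s) *\<^sub>C b))\<^sup>2"
    by (simp add: norm_add_Pythagorean orthogonal_def)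
  then show ?thesis using assms(2) by (simp add: norm_mult)
qed

lemma approx_error_infinite:
  assumes hbar: "hbar \<noteq> 0" and pair: "(h1, h2) \<in> commuting_pairs"
  shows "approx_error hbar h1 h2 = top"
proof (rule ccontr)
  assume "approx_error hbar h1 h2 \<noteq> top"
  then have fin1: "norm_op (diff_op position h1 |` D0) \<noteq> top"
    and fin2: "norm_op (diff_op (momentum hbar) h2 |` D0) \<noteq> top"
    by (auto simp: approx_error_def)
  have sa: "selfadjoint h1" "selfadjoint h2" and dom: "D0 \<subseteq> dom h1" "D0 \<subseteq> dom h2"
    and comm: "commuting_ops h1 h2"
    using pair by (auto simp: commuting_pairs_def selfadjoint_def)
  interpret h1: selfadjoint h1 by fact
  interpret h2: selfadjoint h2 by fact
  \<comment> \<open>The sign \<open>s\<close> makes \<open>A\<close> equal to t + k d/dt with k > 0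
    for either sign of \<open>hbar\<close>, so that the Gaussian in its kernel is
    square-integrable.\<close>
  define k s where "k = \<bar>hbar\<bar>" and "s = sgn hbar"
  have k: "k > 0" and s: "\<bar>s\<bar> = 1" and sk: "s * hbar = k"
    using hbar by (simp_all add: k_def s_def abs_sgn_eq sgn_mult_abs[symmetric] flip: abs_sgn)
     (simp_all add: abs_if sgn_if)
  have nis: "norm (\<i> * complex_of_real s) = 1" using s by (simp add: norm_mult)
  define Q P where "Q x = the (position x)" and "P x = the (momentum hbar x)" for x
  obtain C1 where C1: "C1 \<ge> 0" "\<And>x. x \<in> D0 \<Longrightarrow> norm (Q x - h1.ap x) \<le> C1 * norm x"
    using norm_op_diff_bound[OF dom_position linear_on_subspace_position sa(1) dom(1) fin1]
    unfolding Q_def by blast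
  obtain C2 where C2: "C2 \<ge> 0" "\<And>x. x \<in> D0 \<Longrightarrow> norm (P x - h2.ap x) \<le> C2 * norm x"
    using norm_op_diff_bound[OF dom_momentum linear_on_subspace_momentum sa(2) dom(2) fin2]
    unfolding P_def by blast
  define A where "A x = Q x + (\<i> * of_real s) *\<^sub>C P x" for x
  define N where "N x = h1.ap x + (\<i> * of_real s) *\<^sub>C h2.ap x" for x
  define M where "M x = h1.ap x + (\<i> * of_real (- s)) *\<^sub>C h2.ap x" for x
  have A_abs: "A (abs_L2 f) = abs_L2 (\<lambda>t. of_real t * f t + of_real k * nth_deriv 1 f t)"
    if f: "f \<in> D0_functions" for f
  proof -
    note sq = D0_functions_deriv(2,4)[OF f]
    have "\<i> * complex_of_real s * (- \<i> * complex_of_real hbar) = of_real k"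
      by (simp add: algebra_simps flip: sk)
    then have eq: "\<i> * complex_of_real s * (- \<i> * complex_of_real hbar * z) = of_real k * z" for z
      by (metis mult.assoc)
    show ?thesis
      unfolding A_def Q_def P_def position_abs[OF f] momentum_abs[OF f] option.sel
        abs_L2_scaleC[OF square_integrable_mult[OF sq(1)]] eq
      by (rule abs_L2_add[OF sq(2) square_integrable_mult[OF sq(1)]])
  qed
  have linA: "linear_on_subspace D0 A"
    by (rule linear_on_D0I[OF A_abs]) (simp_all add: D0_functions_deriv(4))
  have lin: "linear_on_subspace D0 (\<lambda>x. h1.ap x + c *\<^sub>C h2.ap x)" for c
    unfolding linear_on_subspace_def scaleR_scaleC using dom
    by (auto simp: subsetD h1.ap_add h2.ap_add h1.ap_scale h2.ap_scale scaleC_add_right scaleC_scaleC mult.commute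
      simp del: domIff)
  have adj: "inner (N x) y = inner x (M y)" if "x \<in> D0" "y \<in> D0" for x y
  proof -
    have "cinner (h1.ap x) y = cinner x (h1.ap y)" "cinner (h2.ap x) y = cinner x (h2.ap y)"
      using that dom by (auto intro!: h1.symmetric h2.symmetric simp del: domIff)
    then show ?thesis
      by (simp add: N_def M_def inner_eq_Re_cinner cinner_add_left cinner_add_right
          cinner_scaleC_left cinner_scaleC_right)
  qed
  have Im0: "Im (cinner (h1.ap x) (h2.ap x)) = 0" if "x \<in> D0" for x
  proof -
    have "cinner (h1.ap x) (h2.ap x) = cinner (h2.ap x) (h1.ap x)"
      using that dom by (intro commuting_ops_cinner_real[OF sa comm]) (auto simp del: domIff)
    then have "cnj (cinner (h1.ap x) (h2.ap x)) = cinner (h1.ap x) (h2.ap x)"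
      by (metis cinner_commute)
    then show ?thesis by (simp add: complex_eq_iff)
  qed
  have N2: "(norm (N x))\<^sup>2 = (norm (h1.ap x))\<^sup>2 + (norm (h2.ap x))\<^sup>2"
    and M2: "(norm (M x))\<^sup>2 = (norm (h1.ap x))\<^sup>2 + (norm (h2.ap x))\<^sup>2" if "x \<in> D0" for x
    unfolding N_def M_def using s by (intro norm_add_i_scaleC Im0 that; simp)+
  have normal: "norm (N x) = norm (M x)" if "x \<in> D0" for x
  proof -
    have "(norm (N x))\<^sup>2 = (norm (M x))\<^sup>2" using N2[OF that] M2[OF that] by simp
    then show ?thesis by (simp add: power2_eq_iff_nonneg)
  qed
  \<comment> \<open>This passes a bound on \<open>N x\<close> to both components, and through the
    bounded differences to position and momentum.\<close>
  have hN: "norm (h1.ap x) \<le> norm (N x)" "norm (h2.ap x) \<le> norm (N x)" if "x \<in> D0" for x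
  proof -
    have "(norm (h1.ap x))\<^sup>2 \<le> (norm (N x))\<^sup>2" "(norm (h2.ap x))\<^sup>2 \<le> (norm (N x))\<^sup>2"
      using N2[OF that] by simp_all
    then show "norm (h1.ap x) \<le> norm (N x)" "norm (h2.ap x) \<le> norm (N x)"
      by (simp_all only: power2_le_imp_le norm_ge_zero)
  qed
  have bdd: "norm (A x - N x) \<le> (C1 + C2) * norm x" if "x \<in> D0" for x
  proof -
    have "A x - N x = (Q x - h1.ap x) + (\<i> * of_real s) *\<^sub>C (P x - h2.ap x)"
      by (simp add: A_def N_def scaleC_diff_right)
    then have "norm (A x - N x) \<le> norm (Q x - h1.ap x) + norm ((\<i> * of_real s) *\<^sub>C (P x - h2.ap x))"
      by (simp only: norm_triangle_ineq)
    also have "\<dots> = norm (Q x - h1.ap x) + norm (P x - h2.ap x)" by (simp only: norm_scaleC nis mult_1)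
    also have "\<dots> \<le> (C1 + C2) * norm x" using C1(2)[OF that] C2(2)[OF that] by (simp add: distrib_right)
    finally show ?thesis .
  qed
  have comp: "pre_compact_graph D0 N"
    unfolding pre_compact_graph_def
  proof (intro allI impI)
    fix f :: "nat \<Rightarrow> L2" and c e :: real
    assume f: "range f \<subseteq> D0" "\<forall>n. norm (f n) \<le> c" "\<forall>n. norm (N (f n)) \<le> c" and e: "e > 0"
    have fD: "f n \<in> D0" for n using f(1) by auto
    then have "\<forall>n. \<exists>g. g \<in> D0_functions \<and> f n = abs_L2 g" unfolding D0_def by blast
    then obtain g where g: "\<And>n. g n \<in> D0_functions" "\<And>n. f n = abs_L2 (g n)" by metis
    \<comment> \<open>One constant for f, for t f through \<open>Q\<close>, and for f' through
      \<open>P\<close> after division by \<open>k\<close>.\<close>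
    define c' where "c' = max c (max (c + C1 * c) ((c + C2 * c) / k))"
    have "norm (abs_L2 (g n)) \<le> c'" for n using f(2) g by (simp add: c'_def le_max_iff_disj)
    moreover have "norm (abs_L2 (\<lambda>t. of_real t * g n t)) \<le> c'" for n
    proof -
      have "norm (Q (f n)) \<le> norm (h1.ap (f n)) + norm (Q (f n) - h1.ap (f n))" by (rule norm_triangle_sub)
      also have "\<dots> \<le> norm (N (f n)) + C1 * norm (f n)" by (intro add_mono hN C1 fD)
      also have "\<dots> \<le> c + C1 * c" using f C1(1) by (intro add_mono mult_left_mono) auto
      also have "\<dots> \<le> c'" by (simp add: c'_def)
      finally show ?thesis by (simp add: Q_def g(2) position_abs[OF g(1)])
    qed
    moreover have "norm (abs_L2 (nth_deriv 1 (g n))) \<le> c'" for n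
    proof -
      have "P (f n) = (- \<i> * of_real hbar) *\<^sub>C abs_L2 (nth_deriv 1 (g n))"
        unfolding P_def g(2) momentum_abs[OF g(1)] option.sel
        by (rule abs_L2_scaleC[OF D0_functions_deriv(2)[OF g(1)], symmetric])
      then have "norm (P (f n)) = k * norm (abs_L2 (nth_deriv 1 (g n)))"
        by (simp add: norm_mult k_def del: One_nat_def)
      moreover have "norm (P (f n)) \<le> c + C2 * c"
      proof -
        have "norm (P (f n)) \<le> norm (h2.ap (f n)) + norm (P (f n) - h2.ap (f n))" by (rule norm_triangle_sub)
        also have "\<dots> \<le> norm (N (f n)) + C2 * norm (f n)" by (intro add_mono hN C2 fD)
        also have "\<dots> \<le> c + C2 * c" using f C2(1) by (intro add_mono mult_left_mono) auto
        finally show ?thesis .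
      qed
      ultimately have "norm (abs_L2 (nth_deriv 1 (g n))) \<le> (c + C2 * c) / k"
        using k by (simp add: pos_le_divide_eq mult.commute del: One_nat_def)
      also have "\<dots> \<le> c'" by (simp add: c'_def)
      finally show ?thesis .
    qed
    ultimately show "\<exists>m n. m < n \<and> norm (f n - f m) < e"
      unfolding g(2) by (rule D0_functions_precompact[OF g(1) _ _ _ e])
  qed
  have dense: "\<exists>x\<in>D0. norm (A x - y) < e" if e: "e > 0" for y e
  proof -
    obtain f where f: "f \<in> D0_functions"
      "norm (abs_L2 (\<lambda>t. of_real t * f t + of_real k * nth_deriv 1 f t) - y) < e"
      using annihilation_range_dense[OF k e] by blast
    then show ?thesis unfolding D0_def by (intro bexI[of _ "abs_L2 f"]) (simp_all only: A_abs imageI)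
  qed
  obtain f where f: "f \<in> D0_functions" "abs_L2 f \<noteq> 0"
    "\<And>t. of_real t * f t + of_real k * nth_deriv 1 f t = 0"
    using annihilated_gaussian[OF k] by blast
  have "abs_L2 f \<in> D0" using f(1) by (simp add: D0_def)
  moreover have "A (abs_L2 f) = 0" unfolding A_abs[OF f(1)] f(3) zero_L2_def ..
  moreover have "linear_on_subspace D0 N" "linear_on_subspace D0 M"
    unfolding N_def[abs_def] M_def[abs_def] by (rule lin)+
  ultimately have "abs_L2 f = 0"
    using index_obstruction[OF subspace_D0 linA _ _ adj normal comp bdd dense] by blast
  then show False using f(2) by simp
qed

theorem theorem7p8:
  shows "Liminf (at 0) (\<lambda>hbar :: real. INF (h1, h2)\<in>commuting_pairs. approx_error hbar h1 h2)
           \<ge> ennreal (1 / 32)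
       \<and> (\<exists>\<epsilon>::real. \<epsilon> > 0 \<and>
            (\<forall>\<^sub>F hbar in at 0. \<forall>(h1, h2)\<in>commuting_pairs. approx_error hbar h1 h2 \<ge> ennreal \<epsilon>))"
proof -
  have "\<forall>\<^sub>F hbar :: real in at 0. hbar \<noteq> 0"
    by (simp add: eventually_at_filter)
  \<comment> \<open>For nonzero \<open>hbar\<close> every error is \<open>top\<close>, so 1/32
    bounds the infimum from below and also witnesses the second conjunct.\<close>
  then have ev: "\<forall>\<^sub>F hbar in at 0. \<forall>(h1, h2)\<in>commuting_pairs. approx_error hbar h1 h2 \<ge> ennreal (1 / 32)"
    by (rule eventually_mono) (auto simp: approx_error_infinite)
  then have "\<forall>\<^sub>F hbar in at 0. (INF (h1, h2)\<in>commuting_pairs. approx_error hbar h1 h2) \<ge> ennreal (1 / 32)"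
    by (rule eventually_mono) (auto intro!: INF_greatest)
  then have "Liminf (at 0) (\<lambda>hbar :: real. INF (h1, h2)\<in>commuting_pairs. approx_error hbar h1 h2) \<ge> ennreal (1 / 32)"
    by (rule Liminf_bounded)
  then show ?thesis using ev by (intro conjI exI[of _ "1 / 32"]) auto
qed

end
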